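(* Let the scalar field be $\mathbb{K}=\mathbb{R}$ or $\mathbb{C}$. Let $w$ be an admissible sequence in $\ell_r$, for some $1<r<\infty$. Then the Lindenstrauss-Bollobás theorem does not hold in the following cases: (a) for $\mathcal{L}(^Nd_*(w,1))$, for every $N\in\mathbb{N}$ with $N\ge r$; (b) for $\mathcal{L}(^Nd_*(w,1);\ell_r)$, for every $N\in\mathbb{N}$.
   Context: A sequence $w=(w_i)_{i\in\mathbb{N}}$ is admissible if it is a decreasing (non-increasing) sequence of nonnegative real numbers with $w_1=1$, $\lim_i w_i=0$ and $\sum_i w_i=\infty$. Put $W(n)=\sum_{i=1}^nw_i$. For a bounded scalar sequence $x=(x(i))_i$, $x^*=(x^*(i))_i$ denotes the decreasing rearrangement of $(|x(i)|)_i$. The space $d^*(w,1)$ consists of all bounded sequences $x$ of scalars with $\|x\|_W:=\sup_n\frac{\sum_{i=1}^nx^*(i)}{W(n)}<\infty$, with norm $\|\cdot\|_W$; $d_*(w,1)$ (the predual of the Lorentz sequence space $d(w,1)$) is the closed subspace of those $x$ with $\lim_{n\to\infty}\frac{\sum_{i=1}^nx^*(i)}{W(n)}=0$. $S_X$ is the unit sphere of $X$, and $X$ is regarded as a subspace of its bidual $X''$. $\mathcal{L}(X_1,\dots,X_N;Y)$ is the space of continuous $N$-linear maps with the supremum norm over the product of the closed unit balls; it is written $\mathcal{L}(^NX;Y)$ if all $X_j=X$, and $\mathcal{L}(^NX)$ if moreover $Y=\mathbb{K}$. Arens extensions: given $\Phi\in\mathcal{L}(X_1,\dots,X_N;Y)$,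 its canonical Arens extension is $\overline\Phi:X_1''\times\cdots\times X_N''\to Y''$, $\overline{\Phi}(x_1'',\dots,x_N'')=w^*\text{-}\lim_{\alpha_1}\cdots\lim_{\alpha_N}\Phi(x_{1,\alpha_1},\dots,x_{N,\alpha_N})$, where $(x_{j,\alpha_j})_{\alpha_j}\subset X_j$ is a net $w^*$-convergent to $x_j''$; the other Arens extensions are obtained by taking the iterated limits in the other orders (one for each permutation of $\{1,\dots,N\}$). For $N=1$ the only Arens extension is the bitranspose. The Lindenstrauss-Bollobás theorem is said to hold for $\mathcal{L}(X_1,\dots,X_N;Y)$ if for every $\varepsilon>0$ there are $\eta(\varepsilon),\beta(\varepsilon)>0$, with $\beta(t)\to0$ as $t\to0$, such that: given $\Phi\in\mathcal{L}(X_1,\dots,X_N;Y)$ with $\|\Phi\|=1$ and $\tilde x_j\in S_{X_j}$, $j=1,\dots,N$, with $\|\Phi(\tilde x_1,\dots,\tilde x_N)\|>1-\eta(\varepsilon)$, there exist $\Psi\in\mathcal{L}(X_1,\dots,X_N;Y)$ with $\|\Psi\|=1$ and $a_j\in S_{X_j''}$, $j=1,\dots,N$, such that all the Arens extensions of $\Psi$ attain their norm at $(a_1,\dots,a_N)$ (i.e. each takes there a value of norm $1$), $\|a_j-\tilde x_j\|<\beta(\varepsilon)$ for $j=1,\dots,N$, and $\|\Phi-\Psi\|<\varepsilon$. *)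

theory Defs
  imports "HOL-Analysis.Analysis" "HOL-Library.Function_Algebras"
    "HOL-Combinatorics.Multiset_Permutations"
begin

section \<open>Normed spaces given by a carrier set\<close>

text \<open>
  The spaces below depend on a sequence \<open>w\<close> and an exponent \<open>r\<close>, so they cannot be types.  A space is
  a subset of an ambient additive group (function types carry the pointwise one) together with a scalar
  multiplication and a norm.  All definitions are meaningful for carriers that are linear subspaces.
\<close>

record ('k, 'v) nspace =
  vcarrier :: "'v set"
  vscale :: "'k \<Rightarrow> 'v \<Rightarrow> 'v"
  vnorm :: "'v \<Rightarrow> real"

definition unit_ball :: "('k, 'v, 'm) nspace_scheme \<Rightarrow> 'v set" where
  "unit_ball X = {x \<in> vcarrier X. vnorm X x \<le> 1}"

definition unit_sphere :: "('k, 'v, 'm) nspace_scheme \<Rightarrow> 'v set" where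
  "unit_sphere X = {x \<in> vcarrier X. vnorm X x = 1}"

definition scalar_space :: "('k::real_normed_field, 'k) nspace" where
  "scalar_space = \<lparr>vcarrier = UNIV, vscale = (*), vnorm = norm\<rparr>"

text \<open>
  A functional on \<open>X\<close> is represented by the function that vanishes off the carrier of \<open>X\<close>, so that
  equality of functionals is equality of functions.
\<close>

definition dual :: "('k::real_normed_field, 'v::ab_group_add) nspace \<Rightarrow> ('k, 'v \<Rightarrow> 'k) nspace" where
  "dual X = \<lparr>
     vcarrier = {f.
       (\<forall>x\<in>vcarrier X. \<forall>y\<in>vcarrier X. f (x + y) = f x + f y) \<and>
       (\<forall>c. \<forall>x\<in>vcarrier X. f (vscale X c x) = c * f x) \<and>
       (\<exists>C. \<forall>x\<in>vcarrier X. norm (f x) \<le> C * vnorm X x) \<and>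
       (\<forall>x. x \<notin> vcarrier X \<longrightarrow> f x = 0)},
     vscale = (\<lambda>c f x. c * f x),
     vnorm = (\<lambda>f. SUP x\<in>unit_ball X. norm (f x))\<rparr>"

abbreviation bidual ::
  "('k::real_normed_field, 'v::ab_group_add) nspace \<Rightarrow> ('k, ('v \<Rightarrow> 'k) \<Rightarrow> 'k) nspace" where
  "bidual X \<equiv> dual (dual X)"

definition canon ::
  "('k::real_normed_field, 'v::ab_group_add) nspace \<Rightarrow> 'v \<Rightarrow> ('v \<Rightarrow> 'k) \<Rightarrow> 'k" where
  "canon X x = (\<lambda>f. if f \<in> vcarrier (dual X) then f x else 0)"

section \<open>Continuous multilinear maps\<close>

text \<open>
  The \<open>N\<close> variables are indexed by \<open>{..<N}\<close>.  A map is only relevant on the product of the carriers;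
  continuity is expressed, as in \<open>bounded_linear\<close>, by boundedness.
\<close>

definition cont_multilinear ::
  "nat \<Rightarrow> (nat \<Rightarrow> ('k, 'v::ab_group_add) nspace) \<Rightarrow> ('k, 'y::ab_group_add) nspace
    \<Rightarrow> ((nat \<Rightarrow> 'v) \<Rightarrow> 'y) set" where
  "cont_multilinear N X Y = {\<Phi>.
     (\<forall>x \<in> (\<Pi>\<^sub>E j\<in>{..<N}. vcarrier (X j)).
        \<Phi> x \<in> vcarrier Y \<and>
        (\<forall>j<N. \<forall>u\<in>vcarrier (X j). \<forall>v\<in>vcarrier (X j).
           \<Phi> (x(j := u + v)) = \<Phi> (x(j := u)) + \<Phi> (x(j := v))) \<and>
        (\<forall>j<N. \<forall>c. \<forall>u\<in>vcarrier (X j).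
           \<Phi> (x(j := vscale (X j) c u)) = vscale Y c (\<Phi> (x(j := u))))) \<and>
     (\<exists>C. \<forall>x \<in> (\<Pi>\<^sub>E j\<in>{..<N}. vcarrier (X j)).
        vnorm Y (\<Phi> x) \<le> C * (\<Prod>j<N. vnorm (X j) (x j)))}"

definition multi_norm ::
  "nat \<Rightarrow> (nat \<Rightarrow> ('k, 'v) nspace) \<Rightarrow> ('k, 'y) nspace \<Rightarrow> ((nat \<Rightarrow> 'v) \<Rightarrow> 'y) \<Rightarrow> real" where
  "multi_norm N X Y \<Phi> = (SUP x \<in> (\<Pi>\<^sub>E j\<in>{..<N}. unit_ball (X j)). vnorm Y (\<Phi> x))"

section \<open>Arens extensions\<close>

definition wstar_lim ::
  "('k::real_normed_field, 'v::ab_group_add) nspace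
    \<Rightarrow> ('i \<Rightarrow> ('v \<Rightarrow> 'k) \<Rightarrow> 'k) \<Rightarrow> (('v \<Rightarrow> 'k) \<Rightarrow> 'k) \<Rightarrow> 'i filter \<Rightarrow> bool" where
  "wstar_lim X g z F \<longleftrightarrow>
     z \<in> vcarrier (bidual X) \<and> (\<forall>f\<in>vcarrier (dual X). ((\<lambda>i. g i f) \<longlongrightarrow> z f) F)"

text \<open>Nets in \<open>X\<close> are represented by the filters of their tails.\<close>

definition wstar_net ::
  "('k::real_normed_field, 'v::ab_group_add) nspace \<Rightarrow> 'v filter \<Rightarrow> (('v \<Rightarrow> 'k) \<Rightarrow> 'k) \<Rightarrow> bool" where
  "wstar_net X F a \<longleftrightarrow>
     F \<noteq> bot \<and> (\<forall>\<^sub>F x in F. x \<in> vcarrier X) \<and> wstar_lim X (canon X) a F"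

text \<open>
  \<open>iter_wstar_lim Y \<Phi> F [j\<^sub>1, \<dots>, j\<^sub>N] x z\<close>: the iterated limit of \<open>\<Phi>\<close>, outermost along \<open>F j\<^sub>1\<close> and
  innermost along \<open>F j\<^sub>N\<close>, exists in the weak-star topology of the bidual of \<open>Y\<close> and equals \<open>z\<close>.
  The variables not listed are kept fixed at their values in \<open>x\<close>.
\<close>

fun iter_wstar_lim ::
  "('k::real_normed_field, 'y::ab_group_add) nspace \<Rightarrow> ((nat \<Rightarrow> 'v) \<Rightarrow> 'y) \<Rightarrow> (nat \<Rightarrow> 'v filter)
    \<Rightarrow> nat list \<Rightarrow> (nat \<Rightarrow> 'v) \<Rightarrow> (('y \<Rightarrow> 'k) \<Rightarrow> 'k) \<Rightarrow> bool" where
  "iter_wstar_lim Y \<Phi> F [] x z \<longleftrightarrow> z = canon Y (\<Phi> x)"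
| "iter_wstar_lim Y \<Phi> F (j # js) x z \<longleftrightarrow>
     (\<exists>g. (\<forall>\<^sub>F u in F j. iter_wstar_lim Y \<Phi> F js (x(j := u)) (g u)) \<and> wstar_lim Y g z (F j))"

text \<open>
  The Arens extension for the order of limits \<open>js\<close>, an enumeration of \<open>{..<N}\<close>; the canonical one is
  \<open>js = [0..<N]\<close>.  The iterated limit exists and does not depend on the choice of the nets.  All
  variables get overwritten by the limits, so they start as \<open>undefined\<close>, the value that elements
  of \<open>\<Pi>\<^sub>E j\<in>{..<N}\<close> have outside \<open>{..<N}\<close>.
\<close>

definition arens_ext ::
  "nat \<Rightarrow> (nat \<Rightarrow> ('k::real_normed_field, 'v::ab_group_add) nspace) \<Rightarrow> ('k, 'y::ab_group_add) nspace
    \<Rightarrow> nat list \<Rightarrow> ((nat \<Rightarrow> 'v) \<Rightarrow> 'y) \<Rightarrow> (nat \<Rightarrow> ('v \<Rightarrow> 'k) \<Rightarrow> 'k) \<Rightarrow> ('y \<Rightarrow> 'k) \<Rightarrow> 'k" where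
  "arens_ext N X Y js \<Phi> a = (THE z. \<exists>F.
     (\<forall>j<N. wstar_net (X j) (F j) (a j)) \<and> iter_wstar_lim Y \<Phi> F js (\<lambda>_. undefined) z)"

section \<open>The Lindenstrauss--Bollobas theorem for a space of multilinear maps\<close>

definition lindenstrauss_bollobas ::
  "nat \<Rightarrow> (nat \<Rightarrow> ('k::real_normed_field, 'v::ab_group_add) nspace) \<Rightarrow> ('k, 'y::ab_group_add) nspace
    \<Rightarrow> bool" where
  "lindenstrauss_bollobas N X Y \<longleftrightarrow>
    (\<exists>\<eta> \<beta> :: real \<Rightarrow> real.
      (\<forall>\<epsilon>>0. \<eta> \<epsilon> > 0 \<and> \<beta> \<epsilon> > 0) \<and> (\<beta> \<longlongrightarrow> 0) (at_right 0) \<and>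
      (\<forall>\<epsilon>>0. \<forall>\<Phi> \<in> cont_multilinear N X Y. \<forall>x \<in> (\<Pi>\<^sub>E j\<in>{..<N}. unit_sphere (X j)).
         multi_norm N X Y \<Phi> = 1 \<and> vnorm Y (\<Phi> x) > 1 - \<eta> \<epsilon> \<longrightarrow>
         (\<exists>\<Psi> \<in> cont_multilinear N X Y. \<exists>a \<in> (\<Pi>\<^sub>E j\<in>{..<N}. unit_sphere (bidual (X j))).
            multi_norm N X Y \<Psi> = 1 \<and>
            (\<forall>js \<in> permutations_of_set {..<N}. vnorm (bidual Y) (arens_ext N X Y js \<Psi> a) = 1) \<and>
            (\<forall>j<N. vnorm (bidual (X j)) (a j - canon (X j) (x j)) < \<beta> \<epsilon>) \<and>
            multi_norm N X Y (\<Phi> - \<Psi>) < \<epsilon>)))"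

section \<open>The sequence spaces\<close>

text \<open>Sequences are indexed from 0, so \<open>w 0\<close>, \<open>x 0\<close> are the first terms.\<close>

definition admissible :: "(nat \<Rightarrow> real) \<Rightarrow> bool" where
  "admissible w \<longleftrightarrow> decseq w \<and> (\<forall>i. 0 \<le> w i) \<and> w 0 = 1 \<and> w \<longlonglongrightarrow> 0 \<and> \<not> summable w"

text \<open>
  The decreasing rearrangement, via the distribution function of \<open>|x|\<close>; this covers bounded sequences
  that do not tend to 0, where the terms cannot be literally sorted.
\<close>

definition rearr :: "(nat \<Rightarrow> 'k::real_normed_field) \<Rightarrow> nat \<Rightarrow> real" where
  "rearr x n = Inf {t. 0 \<le> t \<and> finite {i. norm (x i) > t} \<and> card {i. norm (x i) > t} \<le> n}"

definition W_quot :: "(nat \<Rightarrow> real) \<Rightarrow> (nat \<Rightarrow> 'k::real_normed_field) \<Rightarrow> nat \<Rightarrow> real" where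
  "W_quot w x n = (\<Sum>i<n. rearr x i) / (\<Sum>i<n. w i)"

text \<open>\<open>d_star w\<close> is $d^*(w,1)$ and \<open>d_predual w\<close> is $d_*(w,1)$.\<close>

definition d_star :: "(nat \<Rightarrow> real) \<Rightarrow> ('k::real_normed_field, nat \<Rightarrow> 'k) nspace" where
  "d_star w = \<lparr>
     vcarrier = {x. Bseq x \<and> bdd_above (W_quot w x ` {1..})},
     vscale = (\<lambda>c x i. c * x i),
     vnorm = (\<lambda>x. SUP n\<in>{1..}. W_quot w x n)\<rparr>"

definition d_predual :: "(nat \<Rightarrow> real) \<Rightarrow> ('k::real_normed_field, nat \<Rightarrow> 'k) nspace" where
  "d_predual w = (d_star w)\<lparr>vcarrier := {x \<in> vcarrier (d_star w). W_quot w x \<longlonglongrightarrow> 0}\<rparr>"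

definition ell :: "real \<Rightarrow> ('k::real_normed_field, nat \<Rightarrow> 'k) nspace" where
  "ell r = \<lparr>
     vcarrier = {x. summable (\<lambda>i. norm (x i) powr r)},
     vscale = (\<lambda>c x i. c * x i),
     vnorm = (\<lambda>x. (\<Sum>i. norm (x i) powr r) powr (1 / r))\<rparr>"

end

theory Submission
  imports Defs
begin

text \<open>
  Put \<open>\<Phi>(x\<^sub>1, \<dots>, x\<^sub>N) = M\<^sup>-\<^sup>1 \<Sum>i. x\<^sub>1(i) \<cdots> x\<^sub>N(i)\<close> with \<open>M = \<Sum>i. w(i)\<^sup>N\<close> in the scalar case, and
  \<open>\<Phi>(x\<^sub>1, \<dots>, x\<^sub>N) = (L\<^sup>-\<^sup>1 x\<^sub>1(i) \<cdots> x\<^sub>N(i))\<^sub>i\<close> with \<open>L\<^sup>r = \<Sum>i. w(i)\<^sup>N\<^sup>r\<close> in the \<open>\<ell>\<^sub>r\<close>-valued case.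
  Majorization by \<open>w\<close> gives \<open>\<parallel>\<Phi>\<parallel> = 1\<close>, nearly attained at the truncations of \<open>w\<close>, while
  \<open>\<parallel>\<Phi>(e\<^sub>n, \<dots>, e\<^sub>n)\<parallel>\<close> is the same positive number for all \<open>n\<close>.

  If \<open>a\<close> lies in the unit ball of the bidual of \<open>d\<^sub>*(w,1)\<close> at distance less than one from a finitely supported
  sequence, then \<open>a \<plusminus> c e\<^sub>n\<close> stays in the ball for small \<open>c\<close> and all large \<open>n\<close>.  So if an Arens extension
  of \<open>\<Psi>\<close> attains its norm at \<open>(a\<^sub>1, \<dots>, a\<^sub>N)\<close>, strict convexity of the bidual of the range makes it
  constant in the directions \<open>e\<^sub>n\<close>, whence \<open>\<Psi>(e\<^sub>n, \<dots>, e\<^sub>n) = 0\<close> and \<open>\<Psi>\<close> is far from \<open>\<Phi>\<close>.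

  The biduals are accessible because the unit vectors form a shrinking basis both of \<open>d\<^sub>*(w,1)\<close> and of
  \<open>\<ell>\<^sub>r\<close>: every element of the bidual is the weak-star limit of its finite sections.
\<close>

section \<open>Duals of normed carriers\<close>

text \<open>The index n at which Psi is tested depends on the points a_j, hence on Psi itself. This
  is why a lower bound for the distance that is the same for all n is required; the diagonal maps
  give one because they treat all coordinates alike. The tolerance is fixed before Psi appears: it
  is at most that lower bound, and small enough for the allowed displacement of the points to be
  less than one.

  The perturbation by c e_n fits into the ball for different reasons on different sets S. When S is
  large, distance less than one from a finitely supported sequence leaves a slack that grows with
  W(card S), and W is unbounded. When S is small, either the coordinates of a_j have finite support
  and W gains a positive term from the additional index n, or a larger coordinate outside S can be
  exchanged for the small one at n.

  Iterated limits are awkward for the midpoint argument, which needs multilinearity in (a_1, ...,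
  a_N). Each weak-star limit is therefore rewritten as a_j applied to a bounded functional of the
  variable that tends to it.\<close>

locale normed_carrier =
  fixes X :: "('k::real_normed_field, 'v::ab_group_add) nspace"
  assumes nonempty: "vcarrier X \<noteq> {}"
    and add_closed: "\<lbrakk>x \<in> vcarrier X; y \<in> vcarrier X\<rbrakk> \<Longrightarrow> x + y \<in> vcarrier X"
    and scale_closed: "x \<in> vcarrier X \<Longrightarrow> vscale X c x \<in> vcarrier X"
    and norm_nonneg: "x \<in> vcarrier X \<Longrightarrow> 0 \<le> vnorm X x"
    and norm_scale: "x \<in> vcarrier X \<Longrightarrow> vnorm X (vscale X c x) = norm c * vnorm X x"

lemma dual_sel [simp]:
  "vscale (dual X) c f x = c * f x"
  "vnorm (dual X) f = (SUP x\<in>unit_ball X. norm (f x))"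
  by (simp_all add: dual_def)

lemma dualI:
  assumes "\<And>x y. \<lbrakk>x \<in> vcarrier X; y \<in> vcarrier X\<rbrakk> \<Longrightarrow> f (x + y) = f x + f y"
    and "\<And>c x. x \<in> vcarrier X \<Longrightarrow> f (vscale X c x) = c * f x"
    and "\<And>x. x \<in> vcarrier X \<Longrightarrow> norm (f x) \<le> C * vnorm X x"
    and "\<And>x. x \<notin> vcarrier X \<Longrightarrow> f x = 0"
  shows "f \<in> vcarrier (dual X)"
  unfolding dual_def using assms by (auto intro!: exI[of _ C])

lemma dual_add: "\<lbrakk>f \<in> vcarrier (dual X); x \<in> vcarrier X; y \<in> vcarrier X\<rbrakk> \<Longrightarrow> f (x + y) = f x + f y"
  and dual_scale: "\<lbrakk>f \<in> vcarrier (dual X); x \<in> vcarrier X\<rbrakk> \<Longrightarrow> f (vscale X c x) = c * f x"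
  and dual_off: "\<lbrakk>f \<in> vcarrier (dual X); x \<notin> vcarrier X\<rbrakk> \<Longrightarrow> f x = 0"
  unfolding dual_def by auto

context normed_carrier
begin

lemma dual_bounded:
  assumes "f \<in> vcarrier (dual X)"
  obtains C where "0 \<le> C" "\<And>x. x \<in> vcarrier X \<Longrightarrow> norm (f x) \<le> C * vnorm X x"
proof -
  obtain C where C: "\<And>x. x \<in> vcarrier X \<Longrightarrow> norm (f x) \<le> C * vnorm X x"
    using assms unfolding dual_def by fastforce
  have "norm (f x) \<le> \<bar>C\<bar> * vnorm X x" if "x \<in> vcarrier X" for x
    using C[OF that] mult_right_mono[OF abs_ge_self[of C] norm_nonneg[OF that]] by linarith
  then show ?thesis using that[of "\<bar>C\<bar>"] by auto
qed

lemma ball_nonempty: "unit_ball X \<noteq> {}"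
proof -
  obtain x where x: "x \<in> vcarrier X" using nonempty by blast
  then have "vscale X 0 x \<in> unit_ball X"
    using scale_closed[OF x] norm_scale[OF x, of 0] by (simp add: unit_ball_def)
  then show ?thesis by blast
qed

lemma dual_bdd:
  assumes "f \<in> vcarrier (dual X)"
  shows "bdd_above ((\<lambda>x. norm (f x)) ` unit_ball X)"
proof -
  obtain C where C: "0 \<le> C" "\<And>x. x \<in> vcarrier X \<Longrightarrow> norm (f x) \<le> C * vnorm X x"
    using dual_bounded[OF assms] by blast
  have "norm (f x) \<le> C" if "x \<in> unit_ball X" for x
    using C(2)[of x] mult_left_mono[of "vnorm X x" 1 C] C(1) that by (auto simp: unit_ball_def)
  then show ?thesis by (intro bdd_aboveI2)
qed

lemma dual_norm_ge:
  assumes "f \<in> vcarrier (dual X)" "x \<in> unit_ball X"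
  shows "norm (f x) \<le> vnorm (dual X) f"
  unfolding dual_sel using dual_bdd[OF assms(1)] assms(2) by (rule cSUP_upper2) simp

lemma dual_norm_le:
  assumes "\<And>x. x \<in> unit_ball X \<Longrightarrow> norm (f x) \<le> B"
  shows "vnorm (dual X) f \<le> B"
  unfolding dual_sel by (intro cSUP_least ball_nonempty assms)

lemma dual_norm_nonneg: "f \<in> vcarrier (dual X) \<Longrightarrow> 0 \<le> vnorm (dual X) f"
  using dual_norm_ge ball_nonempty by (meson all_not_in_conv norm_ge_zero order_trans)

lemma dual_bound:
  assumes f: "f \<in> vcarrier (dual X)" and x: "x \<in> vcarrier X"
  shows "norm (f x) \<le> vnorm (dual X) f * vnorm X x"
proof (cases "vnorm X x = 0")
  \<comment> \<open>A vector of norm zero cannot be normalized, but boundedness already makes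
    \<open>f\<close> vanish on it.\<close>
  case True
  then show ?thesis using dual_bounded[OF f] x by (metis mult_zero_right)
next
  case False
  then have pos: "vnorm X x > 0" using norm_nonneg[OF x] by simp
  let ?c = "of_real (1 / vnorm X x) :: 'k"
  have "vscale X ?c x \<in> unit_ball X"
    using scale_closed[OF x] norm_scale[OF x, of ?c] pos by (simp add: unit_ball_def norm_divide)
  from dual_norm_ge[OF f this] have "norm (?c * f x) \<le> vnorm (dual X) f"
    by (simp only: dual_scale[OF f x])
  then show ?thesis using pos by (simp add: norm_mult norm_divide field_simps)
qed

lemma dual_lincomb:
  assumes f: "f \<in> vcarrier (dual X)" and g: "g \<in> vcarrier (dual X)"
  shows "(\<lambda>x. c * f x + d * g x) \<in> vcarrier (dual X)"
proof -
  obtain C where C: "\<And>x. x \<in> vcarrier X \<Longrightarrow> norm (f x) \<le> C * vnorm X x"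
    using dual_bounded[OF f] by metis
  obtain D where D: "\<And>x. x \<in> vcarrier X \<Longrightarrow> norm (g x) \<le> D * vnorm X x"
    using dual_bounded[OF g] by metis
  show ?thesis
  proof (rule dualI)
    fix x assume x: "x \<in> vcarrier X"
    have "norm (c * f x + d * g x) \<le> norm c * norm (f x) + norm d * norm (g x)"
      by (metis norm_mult norm_triangle_ineq)
    also have "\<dots> \<le> norm c * (C * vnorm X x) + norm d * (D * vnorm X x)"
      using C[OF x] D[OF x] by (intro add_mono mult_left_mono) auto
    finally show "norm (c * f x + d * g x) \<le> (norm c * C + norm d * D) * vnorm X x"
      by (simp add: algebra_simps)
  qed (simp_all add: dual_add[OF f] dual_add[OF g] dual_scale[OF f] dual_scale[OF g]
      dual_off[OF f] dual_off[OF g] algebra_simps)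
qed

lemma dual_zero: "(\<lambda>_. 0) \<in> vcarrier (dual X)"
  by (rule dualI[where C = 0]) auto

lemma dual_sum:
  assumes "finite S" "\<And>i. i \<in> S \<Longrightarrow> f i \<in> vcarrier (dual X)"
  shows "(\<lambda>x. \<Sum>i\<in>S. c i * f i x) \<in> vcarrier (dual X)"
  using assms
proof (induction S rule: finite_induct)
  case empty
  then show ?case using dual_zero by simp
next
  case (insert i S)
  then have "(\<lambda>x. c i * f i x + 1 * (\<Sum>i\<in>S. c i * f i x)) \<in> vcarrier (dual X)"
    by (intro dual_lincomb) auto
  then show ?case using insert by simp
qed

text \<open>Interpreting the locale again at \<open>dual X\<close> gives all its facts for the
  bidual.\<close>

lemma normed_carrier_dual: "normed_carrier (dual X)"
proof
  show "vcarrier (dual X) \<noteq> {}" using dual_zero by blast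
next
  fix f g assume "f \<in> vcarrier (dual X)" "g \<in> vcarrier (dual X)"
  from dual_lincomb[OF this, of 1 1] show "f + g \<in> vcarrier (dual X)"
    by (simp add: plus_fun_def)
next
  fix f c assume f: "f \<in> vcarrier (dual X)"
  from dual_lincomb[OF f f, of c 0] show "vscale (dual X) c f \<in> vcarrier (dual X)"
    by (simp add: dual_def)
next
  fix f c assume f: "f \<in> vcarrier (dual X)"
  then show "0 \<le> vnorm (dual X) f" by (rule dual_norm_nonneg)
  have f': "vscale (dual X) c f \<in> vcarrier (dual X)"
    using dual_lincomb[OF f f, of c 0] by (simp add: dual_def)
  show "vnorm (dual X) (vscale (dual X) c f) = norm c * vnorm (dual X) f"
  proof (rule antisym)
    show "vnorm (dual X) (vscale (dual X) c f) \<le> norm c * vnorm (dual X) f"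
      by (rule dual_norm_le)
        (simp only: dual_sel(1) norm_mult mult_left_mono[OF dual_norm_ge[OF f]] norm_ge_zero)
    show "norm c * vnorm (dual X) f \<le> vnorm (dual X) (vscale (dual X) c f)"
    proof (cases "c = 0")
      case True
      then show ?thesis using dual_norm_nonneg[OF f'] by simp
    next
      case False
      have "vnorm (dual X) f \<le> vnorm (dual X) (vscale (dual X) c f) / norm c"
      proof (rule dual_norm_le)
        fix x assume "x \<in> unit_ball X"
        from dual_norm_ge[OF f' this] show "norm (f x) \<le> vnorm (dual X) (vscale (dual X) c f) / norm c"
          using False by (simp only: dual_sel(1) norm_mult) (simp add: field_simps)
      qed
      then show ?thesis using False by (simp add: field_simps)
    qed
  qed
qed

lemma canon_bidual:
  assumes x: "x \<in> vcarrier X"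
  shows "canon X x \<in> vcarrier (bidual X)"
proof -
  interpret D: normed_carrier "dual X" by (rule normed_carrier_dual)
  show ?thesis
  proof (rule dualI)
    fix f assume "f \<in> vcarrier (dual X)"
    then show "norm (canon X x f) \<le> vnorm X x * vnorm (dual X) f"
      using dual_bound[OF _ x] by (simp add: canon_def mult.commute)
  qed (use D.add_closed D.scale_closed in \<open>auto simp: canon_def\<close>)
qed

end

text \<open>Norms of functionals stay folded from here on, so that \<open>dual_bound\<close>,
  \<open>dual_norm_ge\<close> and \<open>dual_norm_le\<close> match.\<close>

lemmas [simp del] = dual_sel(2)

section \<open>Arens extensions of multilinear forms\<close>

text \<open>The Arens extension of a form without nets: if u tends weak-star to \<open>a j\<close>,
  a bounded functional of u tends to the value of \<open>a j\<close> at it. The head of the list is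
  the outermost limit. The cut-off outside the carrier makes the section an element of
  \<open>dual X\<close>.\<close>

fun arens_form :: "('k::real_normed_field, 'v::ab_group_add) nspace \<Rightarrow> ((nat \<Rightarrow> 'v) \<Rightarrow> 'k)
    \<Rightarrow> (nat \<Rightarrow> ('v \<Rightarrow> 'k) \<Rightarrow> 'k) \<Rightarrow> nat list \<Rightarrow> (nat \<Rightarrow> 'v) \<Rightarrow> 'k" where
  "arens_form X \<phi> a [] x = \<phi> x"
| "arens_form X \<phi> a (j # js) x =
     a j (\<lambda>u. if u \<in> vcarrier X then arens_form X \<phi> a js (x(j := u)) else 0)"

locale multilinear_form = normed_carrier X
  for X :: "('k::real_normed_field, 'v::ab_group_add) nspace" +
  fixes N :: nat and \<phi> :: "(nat \<Rightarrow> 'v) \<Rightarrow> 'k"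
  assumes form: "\<phi> \<in> cont_multilinear N (\<lambda>_. X) scalar_space"
begin

text \<open>Variables below \<open>N\<close> outside \<open>J\<close> are left free because a later
  update overwrites them; from \<open>N\<close> on the values are those of the extensional
  product.\<close>

definition args :: "nat set \<Rightarrow> (nat \<Rightarrow> 'v) set" where
  "args J = {x. (\<forall>i\<in>J. x i \<in> vcarrier X) \<and> (\<forall>i\<ge>N. x i = undefined)}"

definition bounded_by :: "real \<Rightarrow> bool" where
  "bounded_by C \<longleftrightarrow> (\<forall>x\<in>args {..<N}. norm (\<phi> x) \<le> C * (\<Prod>i<N. vnorm X (x i)))"

text \<open>The induction invariant for partially evaluated extensions. Linearity and the bound must
  travel together, since \<open>a j\<close> can only be applied once the section is known to be a
  bounded functional. Quantifying over every bound \<open>C\<close> of the form allows one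
  proportional to the norm of a functional, as \<open>extension_bidual\<close> requires.\<close>

definition separately_linear :: "nat list \<Rightarrow> (nat \<Rightarrow> ('v \<Rightarrow> 'k) \<Rightarrow> 'k) \<Rightarrow> bool" where
  "separately_linear js a \<longleftrightarrow>
    (\<forall>i x u v. i < N \<and> i \<notin> set js \<and> x \<in> args ({..<N} - set js - {i}) \<and> u \<in> vcarrier X \<and> v \<in> vcarrier X \<longrightarrow>
       arens_form X \<phi> a js (x(i := u + v)) = arens_form X \<phi> a js (x(i := u)) + arens_form X \<phi> a js (x(i := v))) \<and>
    (\<forall>i x u c. i < N \<and> i \<notin> set js \<and> x \<in> args ({..<N} - set js - {i}) \<and> u \<in> vcarrier X \<longrightarrow>
       arens_form X \<phi> a js (x(i := vscale X c u)) = c * arens_form X \<phi> a js (x(i := u))) \<and>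
    (\<forall>C\<ge>0. bounded_by C \<longrightarrow> (\<forall>x\<in>args ({..<N} - set js). norm (arens_form X \<phi> a js x)
       \<le> (C * (\<Prod>i\<in>set js. vnorm (bidual X) (a i))) * (\<Prod>i\<in>{..<N} - set js. vnorm X (x i))))"

abbreviation (input) sect :: "(nat \<Rightarrow> ('v \<Rightarrow> 'k) \<Rightarrow> 'k) \<Rightarrow> nat list \<Rightarrow> nat \<Rightarrow> (nat \<Rightarrow> 'v) \<Rightarrow> 'v \<Rightarrow> 'k" where
  "sect a js j x \<equiv> (\<lambda>u. if u \<in> vcarrier X then arens_form X \<phi> a js (x(j := u)) else 0)"

lemma PiE_args: "(\<Pi>\<^sub>E j\<in>{..<N}. vcarrier X) = args {..<N}"
  by (auto simp: args_def PiE_def extensional_def Pi_def)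

lemma bounded: "\<exists>C\<ge>0. bounded_by C"
proof -
  obtain C where C: "\<And>x. x \<in> (\<Pi>\<^sub>E j\<in>{..<N}. vcarrier X) \<Longrightarrow> norm (\<phi> x) \<le> C * (\<Prod>j<N. vnorm X (x j))"
    using form unfolding cont_multilinear_def scalar_space_def by fastforce
  show ?thesis unfolding bounded_by_def
  proof (intro exI[of _ "\<bar>C\<bar>"] conjI ballI)
    fix x assume x: "x \<in> args {..<N}"
    then have "0 \<le> (\<Prod>i\<in>{..<N}. vnorm X (x i))"
      by (intro prod_nonneg) (auto simp: args_def intro: norm_nonneg)
    from mult_right_mono[OF abs_ge_self[of C] this] C[of x] x
    show "norm (\<phi> x) \<le> \<bar>C\<bar> * (\<Prod>i\<in>{..<N}. vnorm X (x i))" by (auto simp: PiE_args)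
  qed simp
qed

lemma sect_bound:
  assumes sl: "separately_linear js a" and j: "j < N" "j \<notin> set js" and C: "0 \<le> C" "bounded_by C"
    and x: "x \<in> args ({..<N} - set (j # js))" and u: "u \<in> vcarrier X"
  shows "norm (arens_form X \<phi> a js (x(j := u)))
    \<le> ((C * (\<Prod>i\<in>set js. vnorm (bidual X) (a i))) * (\<Prod>i\<in>{..<N} - set (j # js). vnorm X (x i))) * vnorm X u"
proof -
  have split: "{..<N} - set js = insert j ({..<N} - set (j # js))" using j by auto
  have "x(j := u) \<in> args ({..<N} - set js)" using x u j by (auto simp: args_def)
  then have "norm (arens_form X \<phi> a js (x(j := u))) \<le> (C * (\<Prod>i\<in>set js. vnorm (bidual X) (a i)))
      * (\<Prod>i\<in>{..<N} - set js. vnorm X ((x(j := u)) i))"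
    using sl C unfolding separately_linear_def by blast
  then show ?thesis unfolding split by (simp add: mult_ac)
qed

lemma sect_dual:
  assumes sl: "separately_linear js a" and j: "j < N" "j \<notin> set js"
    and x: "x \<in> args ({..<N} - set (j # js))"
  shows "sect a js j x \<in> vcarrier (dual X)"
proof -
  have x': "x \<in> args ({..<N} - set js - {j})" using x by (auto simp: args_def)
  obtain C where C: "0 \<le> C" "bounded_by C" using bounded by blast
  show ?thesis
  proof (rule dualI)
    fix u v assume "u \<in> vcarrier X" "v \<in> vcarrier X"
    then show "sect a js j x (u + v) = sect a js j x u + sect a js j x v"
      using sl j x' add_closed unfolding separately_linear_def by auto
  next
    fix u c assume "u \<in> vcarrier X"
    then show "sect a js j x (vscale X c u) = c * sect a js j x u"
      using sl j x' scale_closed unfolding separately_linear_def by auto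
  next
    fix u assume u: "u \<in> vcarrier X"
    then show "norm (sect a js j x u)
      \<le> ((C * (\<Prod>i\<in>set js. vnorm (bidual X) (a i))) * (\<Prod>i\<in>{..<N} - set (j # js). vnorm X (x i))) * vnorm X u"
      using sect_bound[OF sl j C x u] by simp
  qed auto
qed

text \<open>Induction on the list. Updates at \<open>i\<close> and \<open>j\<close> commute, so the
  section in variable \<open>j\<close> depends linearly on the value at \<open>i\<close>, and the
  linear \<open>a j\<close> preserves this. In the bound, applying \<open>a j\<close> trades the
  factor \<open>vnorm X (x j)\<close> for \<open>vnorm (bidual X) (a j)\<close>.\<close>

lemma arens_form_separately_linear:
  assumes "distinct js" "set js \<subseteq> {..<N}" "\<And>j. j \<in> set js \<Longrightarrow> a j \<in> vcarrier (bidual X)"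
  shows "separately_linear js a"
  using assms
proof (induction js)
  case Nil
  have lin: "\<phi> (x(i := u + v)) = \<phi> (x(i := u)) + \<phi> (x(i := v))"
    if "i < N" "x \<in> args ({..<N} - {i})" "u \<in> vcarrier X" "v \<in> vcarrier X" for i x u v
  proof -
    have "x(i := u) \<in> (\<Pi>\<^sub>E j\<in>{..<N}. vcarrier X)" using that by (auto simp: PiE_args args_def)
    then have "\<phi> ((x(i := u))(i := u + v)) = \<phi> ((x(i := u))(i := u)) + \<phi> ((x(i := u))(i := v))"
      using form that unfolding cont_multilinear_def by blast
    then show ?thesis by simp
  qed
  have scal: "\<phi> (x(i := vscale X c u)) = c * \<phi> (x(i := u))"
    if "i < N" "x \<in> args ({..<N} - {i})" "u \<in> vcarrier X" for i x u c
  proof -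
    have "x(i := u) \<in> (\<Pi>\<^sub>E j\<in>{..<N}. vcarrier X)" using that by (auto simp: PiE_args args_def)
    then have "\<phi> ((x(i := u))(i := vscale X c u)) = vscale scalar_space c (\<phi> ((x(i := u))(i := u)))"
      using form that unfolding cont_multilinear_def by blast
    then show ?thesis by (simp add: scalar_space_def)
  qed
  show ?case using lin scal by (auto simp: separately_linear_def bounded_by_def)
next
  case (Cons j js)
  interpret D: normed_carrier "dual X" by (rule normed_carrier_dual)
  have IH: "separately_linear js a" and j: "j < N" "j \<notin> set js" and aj: "a j \<in> vcarrier (bidual X)"
    using Cons by auto
  note S = sect_dual[OF IH j]
  have IH_add: "arens_form X \<phi> a js (x(i := u + v)) = arens_form X \<phi> a js (x(i := u)) + arens_form X \<phi> a js (x(i := v))"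
    if "i < N" "i \<notin> set js" "x \<in> args ({..<N} - set js - {i})" "u \<in> vcarrier X" "v \<in> vcarrier X" for i x u v
    using IH that unfolding separately_linear_def by blast
  have IH_scale: "arens_form X \<phi> a js (x(i := vscale X c u)) = c * arens_form X \<phi> a js (x(i := u))"
    if "i < N" "i \<notin> set js" "x \<in> args ({..<N} - set js - {i})" "u \<in> vcarrier X" for i x u c
    using IH that unfolding separately_linear_def by blast
  have add: "arens_form X \<phi> a (j # js) (x(i := u + v))
      = arens_form X \<phi> a (j # js) (x(i := u)) + arens_form X \<phi> a (j # js) (x(i := v))"
    if i: "i < N" "i \<notin> set (j # js)" and x: "x \<in> args ({..<N} - set (j # js) - {i})"
      and u: "u \<in> vcarrier X" and v: "v \<in> vcarrier X" for i x u v
  proof -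
    have ij: "i \<noteq> j" using i by auto
    have *: "sect a js j (x(i := u + v)) = sect a js j (x(i := u)) + sect a js j (x(i := v))"
    proof
      fix t
      show "sect a js j (x(i := u + v)) t = (sect a js j (x(i := u)) + sect a js j (x(i := v))) t"
      proof (cases "t \<in> vcarrier X")
        case True
        then have "x(j := t) \<in> args ({..<N} - set js - {i})" using x i j by (auto simp: args_def)
        from IH_add[OF i(1) _ this u v] show ?thesis using i True
          by (simp add: fun_upd_twist[OF ij])
      qed simp
    qed
    have "sect a js j (x(i := u)) \<in> vcarrier (dual X)" "sect a js j (x(i := v)) \<in> vcarrier (dual X)"
      using x i u v by (auto intro!: S simp: args_def)
    from dual_add[OF aj this] show ?thesis by (simp only: arens_form.simps *)
  qed
  have scale: "arens_form X \<phi> a (j # js) (x(i := vscale X c u)) = c * arens_form X \<phi> a (j # js) (x(i := u))"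
    if i: "i < N" "i \<notin> set (j # js)" and x: "x \<in> args ({..<N} - set (j # js) - {i})"
      and u: "u \<in> vcarrier X" for i x u c
  proof -
    have ij: "i \<noteq> j" using i by auto
    have *: "sect a js j (x(i := vscale X c u)) = vscale (dual X) c (sect a js j (x(i := u)))"
    proof
      fix t
      show "sect a js j (x(i := vscale X c u)) t = vscale (dual X) c (sect a js j (x(i := u))) t"
      proof (cases "t \<in> vcarrier X")
        case True
        then have "x(j := t) \<in> args ({..<N} - set js - {i})" using x i j by (auto simp: args_def)
        from IH_scale[OF i(1) _ this u] show ?thesis using i True
          by (simp add: fun_upd_twist[OF ij])
      qed simp
    qed
    have "sect a js j (x(i := u)) \<in> vcarrier (dual X)"
      using x i u by (auto intro!: S simp: args_def)
    from dual_scale[OF aj this] show ?thesis by (simp only: arens_form.simps *)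
  qed
  have bound: "norm (arens_form X \<phi> a (j # js) x)
      \<le> (C * (\<Prod>i\<in>set (j # js). vnorm (bidual X) (a i))) * (\<Prod>i\<in>{..<N} - set (j # js). vnorm X (x i))"
    if C: "0 \<le> C" "bounded_by C" and x: "x \<in> args ({..<N} - set (j # js))" for C x
  proof -
    let ?P = "\<Prod>i\<in>{..<N} - set (j # js). vnorm X (x i)"
    let ?K = "C * (\<Prod>i\<in>set js. vnorm (bidual X) (a i))"
    have P: "0 \<le> ?P" using x by (intro prod_nonneg) (auto simp: args_def intro: norm_nonneg)
    have K: "0 \<le> ?K" using C(1) Cons.prems
      by (intro mult_nonneg_nonneg prod_nonneg ballI D.dual_norm_nonneg) auto
    have "vnorm (dual X) (sect a js j x) \<le> ?K * ?P"
    proof (rule dual_norm_le)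
      fix u assume "u \<in> unit_ball X"
      then have u: "u \<in> vcarrier X" "vnorm X u \<le> 1" by (auto simp: unit_ball_def)
      have "norm (sect a js j x u) \<le> (?K * ?P) * vnorm X u"
        using sect_bound[OF IH j C x u(1)] u by simp
      also have "\<dots> \<le> (?K * ?P) * 1" using u P K by (intro mult_left_mono) auto
      finally show "norm (sect a js j x u) \<le> ?K * ?P" by simp
    qed
    then have "vnorm (bidual X) (a j) * vnorm (dual X) (sect a js j x) \<le> vnorm (bidual X) (a j) * (?K * ?P)"
      using D.dual_norm_nonneg[OF aj] by (intro mult_left_mono)
    with D.dual_bound[OF aj S[OF x]] j show ?thesis by (simp add: mult_ac)
  qed
  show ?case unfolding separately_linear_def
    by (intro conjI allI impI ballI; (elim conjE)?)
      (rule add scale bound; assumption)+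
qed

text \<open>The extension does not increase the supremum over the balls: every section has dual norm
  at most \<open>B\<close>, and \<open>a j\<close> has norm at most one.\<close>

lemma arens_form_bound:
  assumes "distinct js" "set js \<subseteq> {..<N}" "\<And>j. j \<in> set js \<Longrightarrow> a j \<in> unit_ball (bidual X)"
    and "x \<in> args ({..<N} - set js)" "\<And>i. i \<in> {..<N} - set js \<Longrightarrow> x i \<in> unit_ball X"
    and "\<And>x. x \<in> (\<Pi>\<^sub>E j\<in>{..<N}. unit_ball X) \<Longrightarrow> norm (\<phi> x) \<le> B"
  shows "norm (arens_form X \<phi> a js x) \<le> B"
  using assms
proof (induction js arbitrary: x)
  case Nil
  have "x \<in> (\<Pi>\<^sub>E j\<in>{..<N}. unit_ball X)"
    using Nil(4,5) by (auto simp: args_def PiE_def extensional_def Pi_def)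
  then show ?case using Nil(6) by simp
next
  case (Cons j js)
  interpret D: normed_carrier "dual X" by (rule normed_carrier_dual)
  have j: "j < N" "j \<notin> set js" and aj: "a j \<in> vcarrier (bidual X)" "vnorm (bidual X) (a j) \<le> 1"
    using Cons.prems by (auto simp: unit_ball_def)
  have sl: "separately_linear js a"
    using Cons.prems by (intro arens_form_separately_linear) (auto simp: unit_ball_def)
  note S = sect_dual[OF sl j Cons.prems(4)]
  have "vnorm (dual X) (sect a js j x) \<le> B"
  proof (rule dual_norm_le)
    fix u assume u: "u \<in> unit_ball X"
    then have "norm (arens_form X \<phi> a js (x(j := u))) \<le> B"
      using Cons.prems by (intro Cons.IH) (auto simp: args_def unit_ball_def)
    then show "norm (sect a js j x u) \<le> B" using u by (simp add: unit_ball_def)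
  qed
  moreover have "norm (a j (sect a js j x)) \<le> 1 * vnorm (dual X) (sect a js j x)"
    using D.dual_bound[OF aj(1) S] mult_right_mono[OF aj(2) dual_norm_nonneg[OF S]] by linarith
  ultimately show ?case by simp
qed

text \<open>Linearity in the bidual variable \<open>a j\<close>. It is immediate at the list
  position of \<open>j\<close>, and the evaluations further out are linear.\<close>

lemma arens_form_lincomb:
  assumes "distinct js" "set js \<subseteq> {..<N}" "\<And>i. i \<in> set js \<Longrightarrow> a i \<in> vcarrier (bidual X)"
    and "p \<in> vcarrier (bidual X)" "q \<in> vcarrier (bidual X)" "j \<in> set js"
    and "x \<in> args ({..<N} - set js)"
  shows "arens_form X \<phi> (a(j := (\<lambda>f. c * p f + d * q f))) js x
    = c * arens_form X \<phi> (a(j := p)) js x + d * arens_form X \<phi> (a(j := q)) js x"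
  using assms
proof (induction js arbitrary: x)
  case (Cons i js)
  interpret D: normed_carrier "dual X" by (rule normed_carrier_dual)
  show ?case
  proof (cases "i = j")
    case True
    \<comment> \<open>The list is distinct, so the remaining entries never read \<open>a j\<close>:
      all three evaluations apply their functional to the same section.\<close>
    have cong: "arens_form X \<phi> (a(j := b)) js y = arens_form X \<phi> a js y" for b y
    proof -
      have "arens_form X \<phi> (a(j := b)) js' y = arens_form X \<phi> a js' y" if "j \<notin> set js'" for js' y
        using that by (induction js' arbitrary: y) (auto cong: if_cong)
      then show ?thesis using Cons.prems(1) True by auto
    qed
    show ?thesis using True by (simp add: cong fun_upd_same del: fun_upd_apply cong: if_cong)
  next
    case False
    then have jj: "j \<in> set js" using Cons.prems by auto
    have i: "i < N" "i \<notin> set js" and ai: "a i \<in> vcarrier (bidual X)" using Cons.prems by auto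
    have D1: "sect (a(j := b)) js i x \<in> vcarrier (dual X)" if "b \<in> vcarrier (bidual X)" for b
      using Cons.prems that
      by (intro sect_dual[OF arens_form_separately_linear i]) auto
    have eq: "sect (a(j := (\<lambda>f. c * p f + d * q f))) js i x
       = vscale (dual X) c (sect (a(j := p)) js i x) + vscale (dual X) d (sect (a(j := q)) js i x)"
    proof
      fix u
      show "sect (a(j := (\<lambda>f. c * p f + d * q f))) js i x u
       = (vscale (dual X) c (sect (a(j := p)) js i x) + vscale (dual X) d (sect (a(j := q)) js i x)) u"
      proof (cases "u \<in> vcarrier X")
        case True
        then have "x(i := u) \<in> args ({..<N} - set js)" using Cons.prems by (auto simp: args_def)
        with Cons.IH[of "x(i := u)"] Cons.prems jj True show ?thesis
          by (auto simp del: fun_upd_apply)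
      qed simp
    qed
    have "a i (sect (a(j := (\<lambda>f. c * p f + d * q f))) js i x)
      = c * a i (sect (a(j := p)) js i x) + d * a i (sect (a(j := q)) js i x)"
      unfolding eq dual_add[OF ai D.scale_closed[OF D1[OF Cons.prems(4)]] D.scale_closed[OF D1[OF Cons.prems(5)]]]
        dual_scale[OF ai D1[OF Cons.prems(4)]] dual_scale[OF ai D1[OF Cons.prems(5)]] ..
    then show ?thesis using False by (simp del: fun_upd_apply add: fun_upd_other)
  qed
qed simp

text \<open>Evaluating a section at \<open>canon X e\<close> substitutes \<open>e\<close>, so on
  points of \<open>X\<close> the extension is the form itself.\<close>

lemma arens_form_canon:
  assumes "distinct js" "set js \<subseteq> {..<N}" "e \<in> vcarrier X" "x \<in> args ({..<N} - set js)"
    and "\<And>j. j \<in> set js \<Longrightarrow> a j = canon X e"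
  shows "arens_form X \<phi> a js x = \<phi> (\<lambda>i. if i \<in> set js then e else x i)"
  using assms
proof (induction js arbitrary: x)
  case (Cons j js)
  have j: "j < N" "j \<notin> set js" using Cons.prems by auto
  have sl: "separately_linear js a"
    using Cons.prems canon_bidual[OF Cons.prems(3)] by (intro arens_form_separately_linear) auto
  note S = sect_dual[OF sl j Cons.prems(4)]
  have "arens_form X \<phi> a (j # js) x = arens_form X \<phi> a js (x(j := e))"
    using S Cons.prems(3,5) by (simp add: canon_def)
  also have "\<dots> = \<phi> (\<lambda>i. if i \<in> set js then e else (x(j := e)) i)"
    using Cons.prems by (intro Cons.IH) (auto simp: args_def)
  also have "(\<lambda>i. if i \<in> set js then e else (x(j := e)) i) = (\<lambda>i. if i \<in> set (j # js) then e else x i)"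
    by auto
  finally show ?case .
qed simp

end

section \<open>Vector-valued multilinear maps and their Arens extensions\<close>

lemma comp_multilinear:
  assumes "normed_carrier Y" "\<Phi> \<in> cont_multilinear N X Y" "f \<in> vcarrier (dual Y)"
  shows "(\<lambda>x. f (\<Phi> x)) \<in> cont_multilinear N X scalar_space"
proof -
  interpret Y: normed_carrier Y by fact
  obtain C where C: "0 \<le> C" "\<And>y. y \<in> vcarrier Y \<Longrightarrow> norm (f y) \<le> C * vnorm Y y"
    using Y.dual_bounded[OF assms(3)] by blast
  have mem: "\<Phi> x \<in> vcarrier Y" if "x \<in> (\<Pi>\<^sub>E j\<in>{..<N}. vcarrier (X j))" for x
    using assms(2) that unfolding cont_multilinear_def by blast
  have upd: "x(j := u) \<in> (\<Pi>\<^sub>E j\<in>{..<N}. vcarrier (X j))"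
    if "x \<in> (\<Pi>\<^sub>E j\<in>{..<N}. vcarrier (X j))" "j < N" "u \<in> vcarrier (X j)" for x j u
    using PiE_fun_upd[of u "\<lambda>j. vcarrier (X j)" j x "{..<N}"] that by (simp add: insert_absorb)
  obtain D where D: "\<And>x. x \<in> (\<Pi>\<^sub>E j\<in>{..<N}. vcarrier (X j)) \<Longrightarrow> vnorm Y (\<Phi> x) \<le> D * (\<Prod>j<N. vnorm (X j) (x j))"
    using assms(2) unfolding cont_multilinear_def mem_Collect_eq by (elim conjE exE) metis
  have bound: "norm (f (\<Phi> x)) \<le> (C * D) * (\<Prod>j<N. vnorm (X j) (x j))"
    if "x \<in> (\<Pi>\<^sub>E j\<in>{..<N}. vcarrier (X j))" for x
    using order_trans[OF C(2)[OF mem[OF that]] mult_left_mono[OF D[OF that] C(1)]]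
    by (simp add: mult.assoc)
  have add: "f (\<Phi> (x(j := u + v))) = f (\<Phi> (x(j := u))) + f (\<Phi> (x(j := v)))"
    if "x \<in> (\<Pi>\<^sub>E j\<in>{..<N}. vcarrier (X j))" "j < N" "u \<in> vcarrier (X j)" "v \<in> vcarrier (X j)" for x j u v
  proof -
    have "\<Phi> (x(j := u + v)) = \<Phi> (x(j := u)) + \<Phi> (x(j := v))"
      using assms(2) that unfolding cont_multilinear_def by blast
    then show ?thesis using dual_add[OF assms(3)] mem[OF upd] that by simp
  qed
  have scale: "f (\<Phi> (x(j := vscale (X j) c u))) = c * f (\<Phi> (x(j := u)))"
    if "x \<in> (\<Pi>\<^sub>E j\<in>{..<N}. vcarrier (X j))" "j < N" "u \<in> vcarrier (X j)" for x j u c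
  proof -
    have "\<Phi> (x(j := vscale (X j) c u)) = vscale Y c (\<Phi> (x(j := u)))"
      using assms(2) that unfolding cont_multilinear_def by blast
    then show ?thesis using dual_scale[OF assms(3)] mem[OF upd] that by simp
  qed
  show ?thesis unfolding cont_multilinear_def scalar_space_def
    using add scale bound by (intro CollectI conjI ballI allI impI exI[of _ "C * D"]) auto
qed

text \<open>Linearity in the form, needed for the extension of a vector-valued map to be linear in
  the functional composed with it.\<close>

lemma arens_form_lincomb_form:
  assumes "multilinear_form X N \<phi>" "multilinear_form X N \<psi>"
    and "distinct js" "set js \<subseteq> {..<N}" "\<And>i. i \<in> set js \<Longrightarrow> a i \<in> vcarrier (bidual X)"
    and "x \<in> multilinear_form.args X N ({..<N} - set js)"
  shows "arens_form X (\<lambda>x. c * \<phi> x + d * \<psi> x) a js x = c * arens_form X \<phi> a js x + d * arens_form X \<psi> a js x"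
  using assms(3-)
proof (induction js arbitrary: x)
  case (Cons j js)
  interpret P: multilinear_form X N \<phi> by fact
  interpret Q: multilinear_form X N \<psi> by fact
  interpret D: normed_carrier "dual X" by (rule P.normed_carrier_dual)
  have j: "j < N" "j \<notin> set js" and aj: "a j \<in> vcarrier (bidual X)" using Cons.prems by auto
  let ?s = "\<lambda>\<phi> u. if u \<in> vcarrier X then arens_form X \<phi> a js (x(j := u)) else 0"
  have p: "?s \<phi> \<in> vcarrier (dual X)" and q: "?s \<psi> \<in> vcarrier (dual X)"
    using P.sect_dual[OF P.arens_form_separately_linear j Cons.prems(4)]
      Q.sect_dual[OF Q.arens_form_separately_linear j Cons.prems(4)] Cons.prems by auto
  have "?s (\<lambda>x. c * \<phi> x + d * \<psi> x) = vscale (dual X) c (?s \<phi>) + vscale (dual X) d (?s \<psi>)"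
  proof
    fix u
    show "?s (\<lambda>x. c * \<phi> x + d * \<psi> x) u = (vscale (dual X) c (?s \<phi>) + vscale (dual X) d (?s \<psi>)) u"
    proof (cases "u \<in> vcarrier X")
      case True
      then have "x(j := u) \<in> P.args ({..<N} - set js)" using Cons.prems by (auto simp: P.args_def)
      with Cons.IH[of "x(j := u)"] Cons.prems True show ?thesis by (auto simp del: fun_upd_apply)
    qed simp
  qed
  with dual_add[OF aj D.scale_closed[OF p] D.scale_closed[OF q]] dual_scale[OF aj p] dual_scale[OF aj q]
  show ?case by simp
qed simp

text \<open>Stated for any map with a product bound, so that it also covers a difference of two
  multilinear maps, where the bound comes from a weakened triangle inequality.\<close>

lemma multi_norm_ge:
  assumes "\<And>j. j < N \<Longrightarrow> normed_carrier (X j)"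
    and "\<And>x. x \<in> (\<Pi>\<^sub>E j\<in>{..<N}. vcarrier (X j)) \<Longrightarrow> vnorm Y (\<Phi> x) \<le> C * (\<Prod>j<N. vnorm (X j) (x j))"
    and x: "x \<in> (\<Pi>\<^sub>E j\<in>{..<N}. unit_ball (X j))"
  shows "vnorm Y (\<Phi> x) \<le> multi_norm N X Y \<Phi>"
  unfolding multi_norm_def
proof (rule cSUP_upper[OF x], rule bdd_aboveI2)
  fix x assume x: "x \<in> (\<Pi>\<^sub>E j\<in>{..<N}. unit_ball (X j))"
  have *: "x \<in> (\<Pi>\<^sub>E j\<in>{..<N}. vcarrier (X j))" using x by (auto simp: unit_ball_def PiE_def Pi_def)
  have "0 \<le> vnorm (X j) (x j) \<and> vnorm (X j) (x j) \<le> 1" if "j < N" for j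
  proof -
    interpret normed_carrier "X j" using assms(1)[OF that] .
    have "x j \<in> unit_ball (X j)" using x that by auto
    then show ?thesis by (auto simp: unit_ball_def norm_nonneg)
  qed
  then have "(\<Prod>j<N. vnorm (X j) (x j)) \<le> 1" "0 \<le> (\<Prod>j<N. vnorm (X j) (x j))"
    by (auto intro!: prod_le_1 prod_nonneg)
  then have "\<bar>C\<bar> * (\<Prod>j<N. vnorm (X j) (x j)) \<le> \<bar>C\<bar> * 1" "C * (\<Prod>j<N. vnorm (X j) (x j)) \<le> \<bar>C\<bar> * (\<Prod>j<N. vnorm (X j) (x j))"
    by (intro mult_left_mono mult_right_mono; simp)+
  then show "vnorm Y (\<Phi> x) \<le> \<bar>C\<bar>" using assms(2)[OF *] by linarith
qed

text \<open>The endpoints range over the ball: in the application only the midpoint is known to have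
  norm one.\<close>

definition strictly_convex_nspace :: "('k::real_normed_field, 'v::ab_group_add) nspace \<Rightarrow> bool" where
  "strictly_convex_nspace Z \<longleftrightarrow>
    (\<forall>p\<in>unit_ball Z. \<forall>q\<in>unit_ball Z. vnorm Z (vscale Z (1 / 2) (p + q)) = 1 \<longrightarrow> p = q)"

locale multilinear_map = X: normed_carrier X + Y: normed_carrier Y
  for X :: "('k::real_normed_field, 'v::ab_group_add) nspace"
    and Y :: "('k, 'y::ab_group_add) nspace" +
  fixes N :: nat and \<Phi> :: "(nat \<Rightarrow> 'v) \<Rightarrow> 'y"
  assumes multilinear: "\<Phi> \<in> cont_multilinear N (\<lambda>_. X) Y"
begin

sublocale YD: normed_carrier "dual Y" by (rule Y.normed_carrier_dual)

abbreviation "args \<equiv> multilinear_form.args X N"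

lemma form: "f \<in> vcarrier (dual Y) \<Longrightarrow> multilinear_form X N (\<lambda>x. f (\<Phi> x))"
  by (intro multilinear_form.intro multilinear_form_axioms.intro X.normed_carrier_axioms
      comp_multilinear[OF Y.normed_carrier_axioms multilinear])

text \<open>The set does not depend on the form; composing with the zero functional supplies an
  instance of the scalar locale to read it off.\<close>

lemma args_def: "args J = {x. (\<forall>i\<in>J. x i \<in> vcarrier X) \<and> (\<forall>i\<ge>N. x i = undefined)}"
  using multilinear_form.args_def[OF form[OF Y.dual_zero]] .

lemma PiE_args: "(\<Pi>\<^sub>E j\<in>{..<N}. vcarrier X) = args {..<N}"
  using multilinear_form.PiE_args[OF form[OF Y.dual_zero]] .

lemma map_in: "x \<in> args {..<N} \<Longrightarrow> \<Phi> x \<in> vcarrier Y"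
  using multilinear unfolding cont_multilinear_def PiE_args[symmetric] by blast

lemma map_bound: "\<exists>C\<ge>0. \<forall>x\<in>args {..<N}. vnorm Y (\<Phi> x) \<le> C * (\<Prod>j<N. vnorm X (x j))"
proof -
  obtain C where C: "\<And>x. x \<in> args {..<N} \<Longrightarrow> vnorm Y (\<Phi> x) \<le> C * (\<Prod>j<N. vnorm X (x j))"
    using multilinear unfolding cont_multilinear_def mem_Collect_eq PiE_args by (elim conjE exE) metis
  show ?thesis
  proof (intro exI[of _ "\<bar>C\<bar>"] conjI ballI)
    fix x assume x: "x \<in> args {..<N}"
    then have "0 \<le> (\<Prod>i<N. vnorm X (x i))"
      by (intro prod_nonneg) (auto simp: args_def intro: X.norm_nonneg)
    from mult_right_mono[OF abs_ge_self[of C] this] C[OF x]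
    show "vnorm Y (\<Phi> x) \<le> \<bar>C\<bar> * (\<Prod>i<N. vnorm X (x i))" by linarith
  qed simp
qed

lemma map_norm_le:
  assumes "x \<in> (\<Pi>\<^sub>E j\<in>{..<N}. unit_ball X)"
  shows "vnorm Y (\<Phi> x) \<le> multi_norm N (\<lambda>_. X) Y \<Phi>"
proof -
  obtain C where "\<And>x. x \<in> args {..<N} \<Longrightarrow> vnorm Y (\<Phi> x) \<le> C * (\<Prod>j<N. vnorm X (x j))"
    using map_bound by blast
  then show ?thesis
    using multi_norm_ge[OF X.normed_carrier_axioms _ assms, unfolded PiE_args] by blast
qed

text \<open>Weak-star limits in the bidual of \<open>Y\<close> are tested on functionals
  \<open>f\<close>, so the extension is assembled from those of the scalar forms
  \<open>f (\<Phi> x)\<close>.\<close>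

definition extension :: "(nat \<Rightarrow> ('v \<Rightarrow> 'k) \<Rightarrow> 'k) \<Rightarrow> nat list \<Rightarrow> (nat \<Rightarrow> 'v) \<Rightarrow> ('y \<Rightarrow> 'k) \<Rightarrow> 'k" where
  "extension a js x = (\<lambda>f. if f \<in> vcarrier (dual Y) then arens_form X (\<lambda>x. f (\<Phi> x)) a js x else 0)"

lemma extension_bidual:
  assumes js: "distinct js" "set js \<subseteq> {..<N}" "\<And>i. i \<in> set js \<Longrightarrow> a i \<in> vcarrier (bidual X)"
    and x: "x \<in> args ({..<N} - set js)"
  shows "extension a js x \<in> vcarrier (bidual Y)"
proof -
  obtain C where C: "0 \<le> C" "\<And>x. x \<in> args {..<N} \<Longrightarrow> vnorm Y (\<Phi> x) \<le> C * (\<Prod>j<N. vnorm X (x j))"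
    using map_bound by blast
  show ?thesis
  proof (rule dualI)
    fix f g assume fg: "f \<in> vcarrier (dual Y)" "g \<in> vcarrier (dual Y)"
    from arens_form_lincomb_form[OF form[OF fg(1)] form[OF fg(2)] js x, where c = 1 and d = 1] YD.add_closed[OF fg]
    show "extension a js x (f + g) = extension a js x f + extension a js x g"
      using fg by (simp add: extension_def)
  next
    fix f c assume f: "f \<in> vcarrier (dual Y)"
    from arens_form_lincomb_form[OF form[OF f] form[OF f] js x, where c = c and d = 0] YD.scale_closed[OF f]
    show "extension a js x (vscale (dual Y) c f) = c * extension a js x f"
      using f by (simp add: extension_def)
  next
    fix f assume f: "f \<in> vcarrier (dual Y)"
    interpret F: multilinear_form X N "\<lambda>x. f (\<Phi> x)" by (rule form[OF f])
    have nn: "0 \<le> vnorm (dual Y) f" using f by (rule YD.norm_nonneg)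
    have "norm (f (\<Phi> x)) \<le> (vnorm (dual Y) f * C) * (\<Prod>i<N. vnorm X (x i))" if "x \<in> args {..<N}" for x
      using order_trans[OF Y.dual_bound[OF f map_in[OF that]] mult_left_mono[OF C(2)[OF that] nn]]
      by (simp add: mult.assoc)
    then have "F.bounded_by (vnorm (dual Y) f * C)" by (simp add: F.bounded_by_def)
    moreover have "0 \<le> vnorm (dual Y) f * C" using nn C by simp
    ultimately have "norm (arens_form X (\<lambda>x. f (\<Phi> x)) a js x) \<le> ((vnorm (dual Y) f * C)
        * (\<Prod>i\<in>set js. vnorm (bidual X) (a i))) * (\<Prod>i\<in>{..<N} - set js. vnorm X (x i))"
      using F.arens_form_separately_linear[where a = a, OF js] x unfolding F.separately_linear_def by blast
    then show "norm (extension a js x f) \<le> (C * (\<Prod>i\<in>set js. vnorm (bidual X) (a i))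
        * (\<Prod>i\<in>{..<N} - set js. vnorm X (x i))) * vnorm (dual Y) f"
      using f by (simp add: extension_def mult_ac)
  qed (simp add: extension_def)
qed

text \<open>The link between iterated limits and iterated evaluations. By induction the inner limits
  are eventually determined by the outer variable u; after composition with f they are a section
  evaluated at u, whose limit is its value under \<open>a j\<close>. Since \<open>F j\<close> is
  proper, that limit is unique.\<close>

lemma iter_wstar_lim_iff:
  assumes "distinct js" "set js \<subseteq> {..<N}" "\<And>i. i \<in> set js \<Longrightarrow> a i \<in> vcarrier (bidual X)"
    and "\<And>i. i \<in> set js \<Longrightarrow> wstar_net X (F i) (a i)"
    and "x \<in> args ({..<N} - set js)"
  shows "iter_wstar_lim Y \<Phi> F js x z \<longleftrightarrow> z = extension a js x"
  using assms
proof (induction js arbitrary: x z)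
  case Nil
  then show ?case by (simp add: extension_def canon_def cong: if_cong)
next
  case (Cons j js)
  have j: "j < N" "j \<notin> set js" and aj: "a j \<in> vcarrier (bidual X)" using Cons.prems by auto
  have net: "F j \<noteq> bot" "\<forall>\<^sub>F u in F j. u \<in> vcarrier X"
    "\<And>f. f \<in> vcarrier (dual X) \<Longrightarrow> ((\<lambda>u. canon X u f) \<longlongrightarrow> a j f) (F j)"
    using Cons.prems(4)[of j] by (auto simp: wstar_net_def wstar_lim_def)
  have IH: "iter_wstar_lim Y \<Phi> F js (x(j := u)) z \<longleftrightarrow> z = extension a js (x(j := u))" if "u \<in> vcarrier X" for u z
    using Cons.prems that by (intro Cons.IH) (auto simp: args_def)
  have ext: "extension a (j # js) x \<in> vcarrier (bidual Y)"
    by (rule extension_bidual) (use Cons.prems in auto)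
  have lim: "((\<lambda>u. extension a js (x(j := u)) f) \<longlongrightarrow> extension a (j # js) x f) (F j)"
    if f: "f \<in> vcarrier (dual Y)" for f
  proof -
    interpret G: multilinear_form X N "\<lambda>x. f (\<Phi> x)" by (rule form[OF f])
    let ?s = "\<lambda>u. if u \<in> vcarrier X then arens_form X (\<lambda>x. f (\<Phi> x)) a js (x(j := u)) else 0"
    have s: "?s \<in> vcarrier (dual X)"
      using Cons.prems by (intro G.sect_dual[OF G.arens_form_separately_linear j]) auto
    have "((\<lambda>u. extension a js (x(j := u)) f) \<longlongrightarrow> a j ?s) (F j)"
    proof (rule Lim_transform_eventually[OF net(3)[OF s]])
      show "\<forall>\<^sub>F u in F j. canon X u ?s = extension a js (x(j := u)) f"
        using net(2) by eventually_elim (use s f in \<open>simp add: canon_def extension_def\<close>)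
    qed
    then show ?thesis using f by (simp add: extension_def)
  qed
  show ?case
  proof
    assume "iter_wstar_lim Y \<Phi> F (j # js) x z"
    then obtain g where g: "\<forall>\<^sub>F u in F j. iter_wstar_lim Y \<Phi> F js (x(j := u)) (g u)"
      and z: "wstar_lim Y g z (F j)" by auto
    have eq: "\<forall>\<^sub>F u in F j. g u = extension a js (x(j := u))"
      using g net(2) by eventually_elim (simp add: IH)
    show "z = extension a (j # js) x"
    proof
      fix f
      show "z f = extension a (j # js) x f"
      proof (cases "f \<in> vcarrier (dual Y)")
        case True
        have "((\<lambda>u. g u f) \<longlongrightarrow> z f) (F j)" using z True by (simp add: wstar_lim_def)
        then have "((\<lambda>u. extension a js (x(j := u)) f) \<longlongrightarrow> z f) (F j)"
          by (rule Lim_transform_eventually) (use eq in eventually_elim, simp)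
        then show ?thesis using tendsto_unique[OF net(1)] lim[OF True] by blast
      next
        case False
        have "z \<in> vcarrier (bidual Y)" using z by (simp add: wstar_lim_def)
        then show ?thesis using dual_off[OF _ False] ext by metis
      qed
    qed
  next
    assume z: "z = extension a (j # js) x"
    show "iter_wstar_lim Y \<Phi> F (j # js) x z"
      unfolding iter_wstar_lim.simps
    proof (intro exI[of _ "\<lambda>u. extension a js (x(j := u))"] conjI)
      show "\<forall>\<^sub>F u in F j. iter_wstar_lim Y \<Phi> F js (x(j := u)) (extension a js (x(j := u)))"
        using net(2) by eventually_elim (simp add: IH)
      show "wstar_lim Y (\<lambda>u. extension a js (x(j := u))) z (F j)"
        using ext lim z by (simp add: wstar_lim_def)
    qed
  qed
qed

abbreviation "canonical a \<equiv> extension a [0..<N] (\<lambda>_. undefined)"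

text \<open>Any choice of nets gives the same value, and existence of nets keeps the definite
  description from being vacuous.\<close>

lemma arens_ext_canonical:
  assumes "\<And>j. j < N \<Longrightarrow> a j \<in> vcarrier (bidual X)" "\<And>j. j < N \<Longrightarrow> \<exists>F. wstar_net X F (a j)"
  shows "arens_ext N (\<lambda>_. X) Y [0..<N] \<Phi> a = canonical a"
proof -
  have iff: "iter_wstar_lim Y \<Phi> F [0..<N] (\<lambda>_. undefined) z \<longleftrightarrow> z = canonical a"
    if "\<forall>j<N. wstar_net X (F j) (a j)" for F z
    using assms(1) that by (intro iter_wstar_lim_iff) (auto simp: args_def)
  obtain F where F: "\<forall>j<N. wstar_net X (F j) (a j)" using assms(2) by metis
  show ?thesis unfolding arens_ext_def
    by (rule the_equality) (use iff F in blast)+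
qed

lemma canonical_ball:
  assumes "\<And>j. j < N \<Longrightarrow> a j \<in> unit_ball (bidual X)" and "multi_norm N (\<lambda>_. X) Y \<Phi> \<le> 1"
  shows "canonical a \<in> unit_ball (bidual Y)"
proof -
  have "canonical a \<in> vcarrier (bidual Y)"
    using assms by (intro extension_bidual) (auto simp: args_def unit_ball_def)
  moreover have "vnorm (bidual Y) (canonical a) \<le> 1"
  proof (rule YD.dual_norm_le)
    fix f assume "f \<in> unit_ball (dual Y)"
    then have f: "f \<in> vcarrier (dual Y)" "vnorm (dual Y) f \<le> 1" by (auto simp: unit_ball_def)
    interpret G: multilinear_form X N "\<lambda>x. f (\<Phi> x)" by (rule form[OF f(1)])
    have "norm (arens_form X (\<lambda>x. f (\<Phi> x)) a [0..<N] (\<lambda>_. undefined)) \<le> 1"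
    proof (rule G.arens_form_bound)
      fix x assume x: "x \<in> (\<Pi>\<^sub>E j\<in>{..<N}. unit_ball X)"
      then have x': "x \<in> args {..<N}"
        by (auto simp: args_def unit_ball_def PiE_def extensional_def Pi_def)
      have "norm (f (\<Phi> x)) \<le> vnorm (dual Y) f * vnorm Y (\<Phi> x)"
        by (rule Y.dual_bound[OF f(1) map_in[OF x']])
      also have "\<dots> \<le> 1 * 1"
        using f(2) map_norm_le[OF x] assms(2) Y.norm_nonneg[OF map_in[OF x']]
        by (intro mult_mono) auto
      finally show "norm (f (\<Phi> x)) \<le> 1" by simp
    qed (use assms in \<open>auto simp: args_def\<close>)
    then show "norm (canonical a f) \<le> 1" using f by (simp add: extension_def)
  qed
  ultimately show ?thesis by (simp add: unit_ball_def)
qed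

lemma canonical_lincomb:
  assumes "\<And>j. j < N \<Longrightarrow> a j \<in> vcarrier (bidual X)" "j < N"
    and "p \<in> vcarrier (bidual X)" "q \<in> vcarrier (bidual X)"
  shows "canonical (a(j := (\<lambda>f. c * p f + d * q f))) f
    = c * canonical (a(j := p)) f + d * canonical (a(j := q)) f"
proof (cases "f \<in> vcarrier (dual Y)")
  case True
  have "arens_form X (\<lambda>x. f (\<Phi> x)) (a(j := (\<lambda>f. c * p f + d * q f))) [0..<N] (\<lambda>_. undefined)
    = c * arens_form X (\<lambda>x. f (\<Phi> x)) (a(j := p)) [0..<N] (\<lambda>_. undefined)
    + d * arens_form X (\<lambda>x. f (\<Phi> x)) (a(j := q)) [0..<N] (\<lambda>_. undefined)"
    using assms by (intro multilinear_form.arens_form_lincomb[OF form[OF True]]) (auto simp: args_def)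
  then show ?thesis using True by (simp add: extension_def del: fun_upd_apply)
qed (simp add: extension_def)

text \<open>Let each variable range over \<open>a j\<close> and \<open>a j + c d\<close>. By strict
  convexity the extension takes a single value at all these points (\<open>const\<close>). As d is
  the difference of the two choices divided by c, putting d into one variable gives zero, and then
  so does putting it into all of them.\<close>

lemma vanishes_if_attained:
  assumes sc: "strictly_convex_nspace (bidual Y)" and norm: "multi_norm N (\<lambda>_. X) Y \<Phi> \<le> 1"
    and a: "\<And>j. j < N \<Longrightarrow> a j \<in> unit_ball (bidual X)" and attained: "vnorm (bidual Y) (canonical a) = 1"
    and d: "d \<in> vcarrier X" and c: "c \<noteq> 0" and N: "0 < N"
    and plus: "\<And>j. j < N \<Longrightarrow> (\<lambda>f. a j f + c * canon X d f) \<in> unit_ball (bidual X)"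
    and minus: "\<And>j. j < N \<Longrightarrow> (\<lambda>f. a j f - c * canon X d f) \<in> unit_ball (bidual X)"
    and f: "f \<in> vcarrier (dual Y)"
  shows "f (\<Phi> (\<lambda>i. if i < N then d else undefined)) = 0"
proof -
  let ?p = "\<lambda>j f. a j f + c * canon X d f" and ?q = "\<lambda>j f. a j f - c * canon X d f"
  have cd: "canon X d \<in> vcarrier (bidual X)" by (rule X.canon_bidual[OF d])
  have ballD: "\<And>z. z \<in> unit_ball (bidual X) \<Longrightarrow> z \<in> vcarrier (bidual X)" by (simp add: unit_ball_def)
  \<comment> \<open>Replacing \<open>a j\<close> by \<open>a j + c d\<close> one variable at a time: the old value is the midpoint of two points
    of the ball and has norm one.\<close>
  have const: "canonical b = canonical a"
    if "\<And>j. j < k \<Longrightarrow> b j \<in> {a j, ?p j}" "\<And>j. k \<le> j \<Longrightarrow> b j = a j" "k \<le> N" for k b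
    using that
  proof (induction k arbitrary: b)
    case 0
    then show ?case by (metis le0 ext)
  next
    case (Suc k)
    have k: "k < N" using Suc.prems by simp
    have b: "b j \<in> unit_ball (bidual X)" if "j < N" for j
    proof (cases "j < Suc k")
      case True
      then show ?thesis using Suc.prems(1)[OF True] a[OF that] plus[OF that] by auto
    next
      case False
      then show ?thesis using Suc.prems(2)[of j] a[OF that] by auto
    qed
    have IH: "canonical (b(k := a k)) = canonical a"
      by (rule Suc.IH) (use Suc.prems k in auto)
    have ak: "a k = (\<lambda>f. 1 / 2 * ?p k f + 1 / 2 * ?q k f)" by (simp add: field_simps)
    have mid: "canonical (b(k := a k)) = vscale (bidual Y) (1 / 2) (canonical (b(k := ?p k)) + canonical (b(k := ?q k)))"
    proof
      fix f
      show "canonical (b(k := a k)) f = vscale (bidual Y) (1 / 2) (canonical (b(k := ?p k)) + canonical (b(k := ?q k))) f"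
        by (subst ak, subst canonical_lincomb[OF ballD[OF b] k ballD[OF plus[OF k]] ballD[OF minus[OF k]]])
          (simp_all add: algebra_simps)
    qed
    have upd: "canonical (b(k := z)) \<in> unit_ball (bidual Y)" if "z \<in> unit_ball (bidual X)" for z
      by (rule canonical_ball[OF _ norm]) (use b that in simp)
    have "canonical (b(k := ?p k)) \<in> unit_ball (bidual Y)" "canonical (b(k := ?q k)) \<in> unit_ball (bidual Y)"
      by (rule upd, rule plus[OF k], rule upd, rule minus[OF k])
    moreover have "vnorm (bidual Y) (vscale (bidual Y) (1 / 2) (canonical (b(k := ?p k)) + canonical (b(k := ?q k)))) = 1"
      by (simp only: mid[symmetric] IH attained)
    ultimately have eq: "canonical (b(k := ?p k)) = canonical (b(k := ?q k))"
      using sc unfolding strictly_convex_nspace_def by blast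
    have "canonical (b(k := ?p k)) = canonical a"
    proof
      fix f
      show "canonical (b(k := ?p k)) f = canonical a f"
        using fun_cong[OF mid, of f] eq IH by simp
    qed
    moreover have "b = b(k := a k) \<or> b = b(k := ?p k)"
      using Suc.prems(1)[of k] by (metis fun_upd_triv insertE lessI singletonD)
    ultimately show ?case using IH by metis
  qed
  \<comment> \<open>Linearity in variable \<open>k\<close>, with \<open>canon X d\<close> written as
    \<open>(?p k - a k) / c\<close>.\<close>
  have diff: "canonical b f = 1 / c * canonical (b(k := ?p k)) f + (- 1 / c) * canonical (b(k := a k)) f"
    if b: "\<And>j. j < N \<Longrightarrow> b j \<in> vcarrier (bidual X)" and k: "k < N" "b k = canon X d" for b k
  proof -
    have "b k = (\<lambda>f. 1 / c * ?p k f + (- 1 / c) * a k f)"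
      using k c by (auto simp: field_simps)
    then have "b = b(k := (\<lambda>f. 1 / c * ?p k f + (- 1 / c) * a k f))" by (metis fun_upd_triv)
    then have "canonical b f = canonical (b(k := (\<lambda>f. 1 / c * ?p k f + (- 1 / c) * a k f))) f" by metis
    then show ?thesis
      by (subst canonical_lincomb[OF b k(1) ballD[OF plus[OF k(1)]] ballD[OF a[OF k(1)]], symmetric])
  qed
  \<comment> \<open>Induction on the number of variables equal to \<open>canon X d\<close>, starting
    from one: the first replacement is a difference of equal values by \<open>const\<close>, every
    further one a difference of values that already vanish.\<close>
  have zero: "canonical b f = 0"
    if "\<And>j. j < Suc k \<Longrightarrow> b j = canon X d" "\<And>j. Suc k \<le> j \<Longrightarrow> j < N \<Longrightarrow> b j \<in> {a j, ?p j}"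
      "\<And>j. N \<le> j \<Longrightarrow> b j = a j" "Suc k \<le> N" for k b
    using that
  proof (induction k arbitrary: b)
    case 0
    have b: "b j \<in> vcarrier (bidual X)" if "j < N" for j
      using 0(1)[of j] 0(2)[of j] cd ballD[OF a[OF that]] ballD[OF plus[OF that]] that by (cases j) auto
    have "canonical (b(0 := ?p 0)) = canonical a" "canonical (b(0 := a 0)) = canonical a"
      by (rule const[of N], use 0 in \<open>auto simp: Suc_le_eq\<close>)+
    then show ?case using diff[OF b N] 0(1) by simp
  next
    case (Suc k)
    have b: "b j \<in> vcarrier (bidual X)" if "j < N" for j
      using Suc.prems(1)[of j] Suc.prems(2)[of j] cd ballD[OF a[OF that]] ballD[OF plus[OF that]] that
      by (cases "j < Suc (Suc k)") auto
    have "canonical (b(Suc k := ?p (Suc k))) f = 0" "canonical (b(Suc k := a (Suc k))) f = 0"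
      by (rule Suc.IH, use Suc.prems in \<open>auto simp: Suc_le_eq\<close>)+
    then show ?case using diff[where k = "Suc k", OF b] Suc.prems by simp
  qed
  \<comment> \<open>From \<open>N\<close> on the values of \<open>a\<close> are kept only to meet
    the conditions of \<open>zero\<close>.\<close>
  let ?b = "\<lambda>j. if j < N then canon X d else a j"
  have "canonical ?b f = 0" by (rule zero[of "N - 1"]) (use N in auto)
  moreover have "arens_form X (\<lambda>x. f (\<Phi> x)) ?b [0..<N] (\<lambda>_. undefined)
      = f (\<Phi> (\<lambda>i. if i \<in> set [0..<N] then d else undefined))"
    by (rule multilinear_form.arens_form_canon[OF form[OF f]]) (use d in \<open>auto simp: args_def\<close>)
  ultimately show ?thesis using f by (simp add: extension_def)
qed

end

section \<open>Sequence spaces with a shrinking basis\<close>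

definition unit_seq :: "nat \<Rightarrow> nat \<Rightarrow> 'k::real_normed_field" where
  "unit_seq i = (\<lambda>j. if j = i then 1 else 0)"

definition head :: "nat \<Rightarrow> (nat \<Rightarrow> 'k::real_normed_field) \<Rightarrow> nat \<Rightarrow> 'k" where
  "head n x = (\<lambda>i. if i < n then x i else 0)"

definition tail :: "nat \<Rightarrow> (nat \<Rightarrow> 'k::real_normed_field) \<Rightarrow> nat \<Rightarrow> 'k" where
  "tail n x = (\<lambda>i. if i < n then 0 else x i)"

lemma head_plus_tail: "head n x + tail n x = x"
  by (auto simp: head_def tail_def)

locale sequence_carrier = normed_carrier Z
  for Z :: "('k::real_normed_field, nat \<Rightarrow> 'k) nspace" +
  assumes scale: "vscale Z c x = (\<lambda>i. c * x i)"
    and unit_in: "unit_seq i \<in> vcarrier Z"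
    and coord_bounded: "\<exists>C. \<forall>x\<in>vcarrier Z. norm (x i) \<le> C * vnorm Z x"
begin

lemma head_Suc: "head (Suc n) x = head n x + vscale Z (x n) (unit_seq n)"
  by (auto simp: head_def unit_seq_def scale less_Suc_eq)

lemma head_0: "head 0 x = vscale Z 0 (unit_seq 0)"
  by (auto simp: head_def scale)

lemma head_in: "head n x \<in> vcarrier Z"
proof (induction n)
  case 0
  show ?case unfolding head_0 by (intro scale_closed unit_in)
next
  case (Suc n)
  then show ?case unfolding head_Suc by (intro add_closed scale_closed unit_in)
qed

lemma tail_in: "x \<in> vcarrier Z \<Longrightarrow> tail n x \<in> vcarrier Z"
proof -
  assume x: "x \<in> vcarrier Z"
  have "tail n x = x + vscale Z (- 1) (head n x)"
    by (auto simp: head_def tail_def scale)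
  then show ?thesis using x by (simp add: add_closed scale_closed head_in)
qed

lemma dual_head:
  assumes f: "f \<in> vcarrier (dual Z)"
  shows "f (head n x) = (\<Sum>i<n. x i * f (unit_seq i))"
proof (induction n)
  case 0
  show ?case using dual_scale[OF f unit_in, of 0] by (simp add: head_0)
next
  case (Suc n)
  then show ?case unfolding head_Suc
    by (simp only: sum.lessThan_Suc dual_add[OF f head_in scale_closed[OF unit_in]] dual_scale[OF f unit_in])
qed

lemma dual_split:
  assumes "f \<in> vcarrier (dual Z)" "x \<in> vcarrier Z"
  shows "f x = f (head n x) + f (tail n x)"
  using dual_add[OF assms(1) head_in tail_in[OF assms(2)], of n x n] by (simp add: head_plus_tail)

definition coord :: "nat \<Rightarrow> (nat \<Rightarrow> 'k) \<Rightarrow> 'k" where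
  "coord i x = (if x \<in> vcarrier Z then x i else 0)"

lemma coord_dual: "coord i \<in> vcarrier (dual Z)"
proof -
  obtain C where C: "\<And>x. x \<in> vcarrier Z \<Longrightarrow> norm (x i) \<le> C * vnorm Z x"
    using coord_bounded by metis
  have coord: "coord i x = x i" if "x \<in> vcarrier Z" for x using that by (simp add: coord_def)
  show ?thesis
    by (rule dualI[where C = C])
      (use C in \<open>simp_all add: coord add_closed scale_closed\<close>, simp_all add: scale coord_def)
qed

text \<open>Passes a bound from finite sections, where \<open>f\<close> is a finite sum, to
  \<open>x\<close> itself.\<close>

lemma tail_functional_le:
  assumes lim: "(\<lambda>k. vnorm Z (tail k x)) \<longlonglongrightarrow> 0" and f: "f \<in> vcarrier (dual Z)" and x: "x \<in> vcarrier Z"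
    and le: "\<And>k. norm (f (head k x)) \<le> B"
  shows "norm (f x) \<le> B"
proof (rule Lim_bounded2)
  show "(\<lambda>k. B + vnorm (dual Z) f * vnorm Z (tail k x)) \<longlonglongrightarrow> B"
    using tendsto_add[OF tendsto_const tendsto_mult[OF tendsto_const lim], of B "vnorm (dual Z) f"] by simp
  show "\<forall>k\<ge>0. norm (f x) \<le> B + vnorm (dual Z) f * vnorm Z (tail k x)"
  proof (intro allI impI)
    fix k
    have "norm (f x) \<le> norm (f (head k x)) + norm (f (tail k x))"
      using dual_split[OF f x, of k] by (simp add: norm_triangle_ineq)
    then show "norm (f x) \<le> B + vnorm (dual Z) f * vnorm Z (tail k x)"
      using le[of k] dual_bound[OF f tail_in[OF x], of k] by linarith
  qed
qed

end

text \<open>The axiom says that the norms of the functionals \<open>f\<close> restricted to tails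
  tend to zero, which is the definition of a shrinking basis.\<close>

locale shrinking_carrier = sequence_carrier +
  assumes shrinking: "\<lbrakk>f \<in> vcarrier (dual Z); 0 < \<epsilon>\<rbrakk> \<Longrightarrow>
      \<exists>m. \<forall>n\<ge>m. \<forall>x\<in>vcarrier Z. norm (f (tail n x)) \<le> \<epsilon> * vnorm Z x"
begin

text \<open>The finite sums \<open>h n\<close> of coordinate functionals differ from
  \<open>f\<close> by \<open>f\<close> on tails, hence converge to it in the dual norm. Applying
  \<open>a\<close> to \<open>h n\<close> gives \<open>f\<close> at the n-th section of the
  coordinates of \<open>a\<close>.\<close>

lemma bidual_tendsto:
  assumes a: "a \<in> vcarrier (bidual Z)" and f: "f \<in> vcarrier (dual Z)"
  shows "(\<lambda>n. f (head n (\<lambda>i. a (coord i)))) \<longlonglongrightarrow> a f"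
proof -
  interpret D: normed_carrier "dual Z" by (rule normed_carrier_dual)
  define h where "h n = (\<lambda>x. \<Sum>i<n. f (unit_seq i) * coord i x)" for n
  have h: "h n \<in> vcarrier (dual Z)" for n
    unfolding h_def by (rule dual_sum) (auto intro: coord_dual)
  have fh: "(\<lambda>x. 1 * f x + (- 1) * h n x) \<in> vcarrier (dual Z)" for n
    by (rule dual_lincomb[OF f h])
  have ah: "a (h n) = f (head n (\<lambda>i. a (coord i)))" for n
  proof (induction n)
    case 0
    show ?case using dual_scale[OF a D.scale_closed[OF f], of 0 0]
      by (simp add: h_def dual_head[OF f] dual_def)
  next
    case (Suc n)
    have "h (Suc n) = h n + vscale (dual Z) (f (unit_seq n)) (coord n)"
      by (auto simp: h_def)
    then have "a (h (Suc n)) = a (h n) + f (unit_seq n) * a (coord n)"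
      by (simp only: dual_add[OF a h D.scale_closed[OF coord_dual]] dual_scale[OF a coord_dual])
    then show ?case using Suc by (simp add: dual_head[OF f] mult.commute)
  qed
  have diff: "f x - h n x = f (tail n x)" if "x \<in> vcarrier Z" for n x
    using dual_split[OF f that, of n] that by (simp add: h_def dual_head[OF f] coord_def mult.commute)
  have "(\<lambda>n. a (h n)) \<longlonglongrightarrow> a f"
  proof (rule metric_LIMSEQ_I)
    fix \<epsilon> :: real assume \<epsilon>: "0 < \<epsilon>"
    let ?A = "vnorm (bidual Z) a"
    have A: "0 \<le> ?A" by (rule D.dual_norm_nonneg[OF a])
    define \<delta> where "\<delta> = \<epsilon> / (?A + 1)"
    have \<delta>: "0 < \<delta>" "?A * \<delta> < \<epsilon>" using \<epsilon> A by (auto simp: \<delta>_def field_simps)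
    obtain m where m: "\<And>n x. n \<ge> m \<Longrightarrow> x \<in> vcarrier Z \<Longrightarrow> norm (f (tail n x)) \<le> \<delta> * vnorm Z x"
      using shrinking[OF f \<delta>(1)] by blast
    show "\<exists>no. \<forall>n\<ge>no. dist (a (h n)) (a f) < \<epsilon>"
    proof (intro exI[of _ m] allI impI)
      fix n assume n: "n \<ge> m"
      let ?d = "\<lambda>x. 1 * f x + (- 1) * h n x"
      have "vnorm (dual Z) ?d \<le> \<delta>"
      proof (rule dual_norm_le)
        fix x assume "x \<in> unit_ball Z"
        then have x: "x \<in> vcarrier Z" "vnorm Z x \<le> 1" by (auto simp: unit_ball_def)
        show "norm (?d x) \<le> \<delta>"
          using order_trans[OF m[OF n x(1)] mult_left_mono[OF x(2)]] \<delta>(1) by (simp add: diff[OF x(1)])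
      qed
      then have "norm (a ?d) \<le> ?A * \<delta>"
        using D.dual_bound[OF a fh] mult_left_mono[OF _ A] by (meson order_trans)
      moreover have "f = ?d + h n" by auto
      then have "a f = a ?d + a (h n)" using dual_add[OF a fh h] by metis
      ultimately show "dist (a (h n)) (a f) < \<epsilon>"
        using \<delta>(2) by (simp add: dist_norm norm_minus_commute)
    qed
  qed
  then show ?thesis by (simp add: ah)
qed

text \<open>The sequence of finite sections serves as the net and takes the place of an appeal to
  Goldstine.\<close>

lemma wstar_net_exists:
  assumes a: "a \<in> vcarrier (bidual Z)"
  shows "\<exists>F. wstar_net Z F a"
proof
  show "wstar_net Z (filtermap (\<lambda>n. head n (\<lambda>i. a (coord i))) sequentially) a"
    unfolding wstar_net_def wstar_lim_def
    using a bidual_tendsto[OF a]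
    by (auto simp: filtermap_bot_iff eventually_filtermap head_in filterlim_filtermap canon_def)
qed

text \<open>Weak-star lower semicontinuity of the norm along the sections: a bound in the bidual
  reduces to bounds for finitely supported sequences.\<close>

lemma bidual_ballI:
  assumes a: "a \<in> vcarrier (bidual Z)"
    and ball: "\<And>n. vnorm Z (head n (\<lambda>i. a (coord i))) \<le> B"
  shows "vnorm (bidual Z) a \<le> B"
proof -
  interpret D: normed_carrier "dual Z" by (rule normed_carrier_dual)
  show ?thesis
  proof (rule D.dual_norm_le)
    fix f assume "f \<in> unit_ball (dual Z)"
    then have f: "f \<in> vcarrier (dual Z)" "vnorm (dual Z) f \<le> 1" by (auto simp: unit_ball_def)
    have "norm (f (head n (\<lambda>i. a (coord i)))) \<le> B" for n
      using dual_bound[OF f(1) head_in, of n "\<lambda>i. a (coord i)"] ball[of n]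
        mult_right_mono[OF f(2) norm_nonneg[OF head_in], of n "\<lambda>i. a (coord i)"] by linarith
    then show "norm (a f) \<le> B"
      by (intro Lim_bounded[OF tendsto_norm[OF bidual_tendsto[OF a f(1)]], of 0]) auto
  qed
qed

lemma bidual_eqI:
  assumes "a \<in> vcarrier (bidual Z)" "b \<in> vcarrier (bidual Z)" "\<And>i. a (coord i) = b (coord i)"
  shows "a = b"
proof
  fix f
  show "a f = b f"
  proof (cases "f \<in> vcarrier (dual Z)")
    case True
    then show ?thesis
      using bidual_tendsto[OF assms(1) True] bidual_tendsto[OF assms(2) True] LIMSEQ_unique
      by (simp add: assms(3))
  next
    case False
    then show ?thesis using dual_off[OF assms(1)] dual_off[OF assms(2)] by simp
  qed
qed

end

section \<open>Decreasing rearrangements and sums over finite sets\<close>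

text \<open>Remove an index \<open>k\<close> of smallest modulus from a set of n + 1 elements. A
  level below that modulus is exceeded on the whole set, hence more than n times, so
  \<open>rearr x n\<close> is at least that modulus.\<close>

lemma sum_le_rearr:
  fixes x :: "nat \<Rightarrow> 'k::real_normed_field"
  assumes x: "Bseq x" and S: "finite S"
  shows "(\<Sum>i\<in>S. norm (x i)) \<le> (\<Sum>i<card S. rearr x i)"
  using S
proof (induction "card S" arbitrary: S)
  case (Suc n)
  then have "S \<noteq> {}" by auto
  obtain k where k: "k \<in> S" "\<And>i. i \<in> S \<Longrightarrow> norm (x k) \<le> norm (x i)"
    using ex_min_if_finite[of "(\<lambda>i. norm (x i)) ` S"] Suc.prems \<open>S \<noteq> {}\<close>
    by (metis (no_types, lifting) arg_min_if_finite(1) arg_min_least)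
  let ?T = "{t. 0 \<le> t \<and> finite {i. norm (x i) > t} \<and> card {i. norm (x i) > t} \<le> n}"
  obtain B where B: "0 < B" "\<And>i. norm (x i) \<le> B" using x by (auto simp: Bseq_def)
  \<comment> \<open>Boundedness makes the set of levels nonempty, without which its infimum says
    nothing.\<close>
  have "B \<in> ?T" using B by (auto simp: not_less[symmetric])
  moreover have "norm (x k) \<le> t" if t: "t \<in> ?T" for t
  proof (rule ccontr)
    assume "\<not> norm (x k) \<le> t"
    then have "S \<subseteq> {i. norm (x i) > t}" using k(2) by force
    then have "card S \<le> n" using t card_mono[of "{i. norm (x i) > t}" S] by auto
    then show False using Suc.hyps(2) by simp
  qed
  ultimately have "norm (x k) \<le> rearr x n"
    unfolding rearr_def by (intro cInf_greatest) auto
  moreover have "(\<Sum>i\<in>S - {k}. norm (x i)) \<le> (\<Sum>i<n. rearr x i)"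
    using Suc.hyps Suc.prems k(1) by (metis card_Diff_singleton diff_Suc_1 finite_Diff)
  ultimately show ?case
    using Suc.hyps(2)[symmetric] Suc.prems k(1) by (simp add: sum.remove[of S k])
qed simp

text \<open>By definition of the infimum, the level \<open>rearr x n - \<epsilon>\<close> is
  exceeded at more than n indices, so one of them is not yet in \<open>S\<close> and can be added.
  Working up to \<epsilon> is necessary because a value of the rearrangement need not be
  attained.\<close>

lemma rearr_approx:
  fixes x :: "nat \<Rightarrow> 'k::real_normed_field"
  assumes "0 < \<epsilon>"
  shows "\<exists>S. finite S \<and> card S = n \<and> (\<Sum>i<n. rearr x i) \<le> (\<Sum>i\<in>S. norm (x i)) + real n * \<epsilon>"
proof (induction n)
  case (Suc n)
  then obtain S where S: "finite S" "card S = n" "(\<Sum>i<n. rearr x i) \<le> (\<Sum>i\<in>S. norm (x i)) + real n * \<epsilon>"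
    by blast
  let ?A = "{i. norm (x i) > rearr x n - \<epsilon>}"
  have "infinite ?A \<or> card ?A > n"
  proof (cases "rearr x n - \<epsilon> < 0")
    case True
    have "rearr x n - \<epsilon> < norm (x i)" for i using True norm_ge_zero[of "x i"] by linarith
    then have "?A = UNIV" by blast
    then show ?thesis by simp
  next
    case False
    show ?thesis
    proof (rule ccontr)
      assume "\<not> ?thesis"
      then have "rearr x n \<le> rearr x n - \<epsilon>"
        using False by (subst rearr_def, intro cInf_lower bdd_belowI[of _ 0]) auto
      then show False using assms by simp
    qed
  qed
  then have "\<not> ?A \<subseteq> S" using S(1,2) card_mono finite_subset by (metis not_less)
  then obtain k where k: "k \<notin> S" "norm (x k) > rearr x n - \<epsilon>" by blast
  then show ?case
    using S by (intro exI[of _ "insert k S"]) (auto simp: algebra_simps)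
qed (auto intro: exI[of _ "{}"])

text \<open>With \<open>sum_le_rearr\<close> this identifies the partial sums of the rearrangement
  of a bounded sequence as suprema over finite index sets. Rearrangements can then be avoided
  altogether.\<close>

lemma sum_rearr_le:
  fixes x :: "nat \<Rightarrow> 'k::real_normed_field"
  assumes "\<And>S. finite S \<Longrightarrow> card S = n \<Longrightarrow> (\<Sum>i\<in>S. norm (x i)) \<le> c"
  shows "(\<Sum>i<n. rearr x i) \<le> c"
proof (rule field_le_epsilon)
  fix e :: real assume e: "0 < e"
  then obtain S where S: "finite S" "card S = n"
    "(\<Sum>i<n. rearr x i) \<le> (\<Sum>i\<in>S. norm (x i)) + real n * (e / (real n + 1))"
    using rearr_approx[of "e / (real n + 1)" n x] by auto
  have "real n * (e / (real n + 1)) \<le> e" using e by (simp add: field_simps)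
  with S(3) assms[OF S(1,2)] show "(\<Sum>i<n. rearr x i) \<le> c + e" by linarith
qed

section \<open>The predual of the Lorentz space\<close>

locale admissible_weight =
  fixes w :: "nat \<Rightarrow> real"
  assumes admissible: "admissible w"
begin

definition W :: "nat \<Rightarrow> real" where
  "W n = (\<Sum>i<n. w i)"

lemma W_0 [simp]: "W 0 = 0" and W_Suc: "W (Suc n) = W n + w n"
  by (simp_all add: W_def)

lemma w_0 [simp]: "w 0 = 1" and w_nonneg: "0 \<le> w i" and w_dec: "i \<le> j \<Longrightarrow> w j \<le> w i"
  and w_lim: "w \<longlonglongrightarrow> 0" and w_not_summable: "\<not> summable w"
  using admissible by (auto simp: admissible_def decseq_def)

lemma w_le_1: "w i \<le> 1"
  using w_dec[of 0 i] by simp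

lemma w_pos: "0 < w i"
proof (rule ccontr)
  assume "\<not> 0 < w i"
  then have "w j = 0" if "j \<ge> i" for j using w_dec[OF that] w_nonneg[of j] by linarith
  then have "summable w" by (intro summable_finite[of "{..<i}"]) auto
  then show False using w_not_summable by simp
qed

lemma W_mono: "m \<le> n \<Longrightarrow> W m \<le> W n"
  unfolding W_def by (intro sum_mono2) (auto simp: w_nonneg)

lemma W_nonneg: "0 \<le> W n"
  using W_mono[of 0 n] by simp

lemma W_1: "W (Suc 0) = 1"
  by (simp add: W_Suc)

lemma W_ge_1: "0 < n \<Longrightarrow> 1 \<le> W n"
  using W_mono[of "Suc 0" n] by (simp add: W_1)

lemma W_unbounded: "\<exists>n0. \<forall>n\<ge>n0. B \<le> W n"
proof (rule ccontr)
  assume "\<not> ?thesis"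
  then have "W n \<le> B" for n by (meson W_mono le_less_linear less_le_trans order.strict_implies_order)
  then have "summable w"
    by (intro summableI_nonneg_bounded[where x = B] w_nonneg) (simp add: W_def)
  then show False using w_not_summable by simp
qed

text \<open>The averages of a null sequence tend to zero: beyond \<open>p\<close> each term adds at
  most \<mu>/2, and the other half absorbs \<open>W p\<close>.\<close>

lemma W_sublinear:
  assumes "0 < \<mu>"
  shows "\<exists>n. W n < \<mu> * real n"
proof -
  obtain p where p: "\<And>i. i \<ge> p \<Longrightarrow> w i \<le> \<mu> / 2"
    using order_tendstoD(2)[OF w_lim, of "\<mu> / 2"] assms
    by (auto simp: eventually_sequentially intro: less_imp_le)
  have le: "W (p + k) \<le> W p + real k * (\<mu> / 2)" for k
  proof (induction k)
    case (Suc k)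
    then show ?case using p[of "p + k"] by (simp add: W_Suc field_simps)
  qed simp
  obtain k :: nat where "real k > W p / (\<mu> / 2)" using reals_Archimedean2 by blast
  then have "W p < real k * (\<mu> / 2)" using assms by (simp add: field_simps)
  then have "W (p + k) < \<mu> * real k" using le[of k] by (simp add: algebra_simps)
  also have "\<dots> \<le> \<mu> * real (p + k)" using assms by simp
  finally show ?thesis by blast
qed

text \<open>The bound c on the norm of x, free of rearrangements (see
  \<open>d_norm_le_iff\<close>).\<close>

abbreviation dominated :: "(nat \<Rightarrow> 'k::real_normed_field) \<Rightarrow> real \<Rightarrow> bool" where
  "dominated x c \<equiv> (\<forall>S. finite S \<longrightarrow> (\<Sum>i\<in>S. norm (x i)) \<le> c * W (card S))"

text \<open>Infinitely many entries of modulus at least \<mu> would give sums of size n \<mu> over n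
  indices, while W(n) is o(n).\<close>

lemma dominated_tendsto_0:
  assumes "dominated x c" shows "x \<longlonglongrightarrow> 0"
proof (rule metric_LIMSEQ_I)
  fix \<mu> :: real assume \<mu>: "0 < \<mu>"
  let ?A = "{i. norm (x i) \<ge> \<mu>}"
  have "finite ?A"
  proof (rule ccontr)
    assume inf: "infinite ?A"
    obtain n where n: "W n < \<mu> / (\<bar>c\<bar> + 1) * real n" using W_sublinear[of "\<mu> / (\<bar>c\<bar> + 1)"] \<mu> by auto
    obtain S where S: "finite S" "card S = n" "S \<subseteq> ?A"
      using infinite_arbitrarily_large[OF inf] by metis
    have "real n * \<mu> \<le> (\<Sum>i\<in>S. norm (x i))"
      using sum_bounded_below[of S \<mu> "\<lambda>i. norm (x i)"] S by auto
    also have "\<dots> \<le> c * W n" using assms S by blast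
    also have "\<dots> \<le> (\<bar>c\<bar> + 1) * W n" using W_nonneg by (intro mult_right_mono) auto
    also have "\<dots> < real n * \<mu>" using n by (simp add: field_simps)
    finally show False by simp
  qed
  then obtain m where "\<And>i. i \<in> ?A \<Longrightarrow> i < m" using finite_nat_set_iff_bounded by metis
  then have "dist (x n) 0 < \<mu>" if "n \<ge> m" for n
    using that not_le by fastforce
  then show "\<exists>no. \<forall>n\<ge>no. dist (x n) 0 < \<mu>" by blast
qed

lemma dominated_Bseq: "dominated x c \<Longrightarrow> Bseq x"
  by (rule convergent_imp_Bseq[OF convergentI[OF dominated_tendsto_0]])

lemma dominated_iff:
  fixes x :: "nat \<Rightarrow> 'k::real_normed_field"
  assumes "Bseq x"
  shows "dominated x c \<longleftrightarrow> (\<forall>n\<ge>1. W_quot w x n \<le> c)"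
proof
  assume d: "dominated x c"
  show "\<forall>n\<ge>1. W_quot w x n \<le> c"
  proof (intro allI impI)
    fix n :: nat assume n: "n \<ge> 1"
    then have "(\<Sum>i<n. rearr x i) \<le> c * W n" using d by (intro sum_rearr_le) auto
    then show "W_quot w x n \<le> c" using W_ge_1[of n] n
      by (simp add: W_quot_def W_def[symmetric] field_simps)
  qed
next
  assume q: "\<forall>n\<ge>1. W_quot w x n \<le> c"
  show "dominated x c"
  proof (intro allI impI)
    fix S :: "nat set" assume S: "finite S"
    show "(\<Sum>i\<in>S. norm (x i)) \<le> c * W (card S)"
    proof (cases "S = {}")
      case False
      then have n: "card S \<ge> 1" using S by (simp add: Suc_le_eq card_gt_0_iff)
      then have "(\<Sum>i<card S. rearr x i) \<le> c * W (card S)"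
        using q[rule_format, OF n] W_ge_1[of "card S"]
        by (simp add: W_quot_def W_def[symmetric] pos_divide_le_eq)
      then show ?thesis using sum_le_rearr[OF assms S] by linarith
    qed simp
  qed
qed

lemma W_quot_nonneg:
  fixes x :: "nat \<Rightarrow> 'k::real_normed_field"
  assumes "Bseq x" shows "0 \<le> W_quot w x n"
  using sum_le_rearr[OF assms, of "{..<n}"] sum_nonneg[of "{..<n}" "\<lambda>i. norm (x i)"] W_nonneg[of n]
  by (simp add: W_quot_def W_def[symmetric])

text \<open>The working description of the predual. Boundedness is absorbed into domination, and the
  limit becomes a condition on all finite sets of large cardinality.\<close>

lemma d_predual_iff:
  fixes x :: "nat \<Rightarrow> 'k::real_normed_field"
  shows "x \<in> vcarrier (d_predual w) \<longleftrightarrow> (\<exists>c. dominated x c) \<and>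
    (\<forall>\<epsilon>>0. \<exists>n0. \<forall>S. finite S \<and> n0 \<le> card S \<longrightarrow> (\<Sum>i\<in>S. norm (x i)) \<le> \<epsilon> * W (card S))"
    (is "_ \<longleftrightarrow> _ \<and> ?lim")
proof -
  have carrier: "x \<in> vcarrier (d_predual w) \<longleftrightarrow> Bseq x \<and> (\<exists>c. \<forall>n\<ge>1. W_quot w x n \<le> c) \<and> W_quot w x \<longlonglongrightarrow> 0"
    by (auto simp: d_predual_def d_star_def bdd_above_def)
  have lim: "W_quot w x \<longlonglongrightarrow> 0 \<longleftrightarrow> ?lim" if x: "Bseq x"
  proof
    assume L: "W_quot w x \<longlonglongrightarrow> 0"
    show ?lim
    proof (intro allI impI)
      fix \<epsilon> :: real assume "0 < \<epsilon>"
      then obtain n0 where n0: "\<And>n. n \<ge> n0 \<Longrightarrow> W_quot w x n < \<epsilon>"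
        using order_tendstoD(2)[OF L] by (auto simp: eventually_sequentially)
      show "\<exists>n0. \<forall>S. finite S \<and> n0 \<le> card S \<longrightarrow> (\<Sum>i\<in>S. norm (x i)) \<le> \<epsilon> * W (card S)"
      proof (intro exI[of _ "max 1 n0"] allI impI, elim conjE)
        fix S :: "nat set" assume S: "finite S" "max 1 n0 \<le> card S"
        then have "W_quot w x (card S) < \<epsilon>" "1 \<le> W (card S)" using n0 W_ge_1 by auto
        then have "(\<Sum>i<card S. rearr x i) \<le> \<epsilon> * W (card S)"
          by (simp add: W_quot_def W_def[symmetric] field_simps)
        then show "(\<Sum>i\<in>S. norm (x i)) \<le> \<epsilon> * W (card S)" using sum_le_rearr[OF x S(1)] by linarith
      qed
    qed
  next
    assume L: ?lim
    show "W_quot w x \<longlonglongrightarrow> 0"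
    proof (rule metric_LIMSEQ_I)
      fix \<epsilon> :: real assume \<epsilon>: "0 < \<epsilon>"
      then obtain n0 where n0: "\<And>S. finite S \<Longrightarrow> n0 \<le> card S \<Longrightarrow> (\<Sum>i\<in>S. norm (x i)) \<le> \<epsilon> / 2 * W (card S)"
        using L half_gt_zero by metis
      have "dist (W_quot w x n) 0 < \<epsilon>" if n: "n \<ge> max 1 n0" for n
      proof -
        have "(\<Sum>i<n. rearr x i) \<le> \<epsilon> / 2 * W n" using n0 n by (intro sum_rearr_le) auto
        then have "W_quot w x n \<le> \<epsilon> / 2" using W_ge_1[of n] n
          by (simp add: W_quot_def W_def[symmetric] field_simps)
        then show ?thesis using W_quot_nonneg[OF x, of n] \<epsilon> by (simp add: dist_real_def)
      qed
      then show "\<exists>no. \<forall>n\<ge>no. dist (W_quot w x n) 0 < \<epsilon>" by blast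
    qed
  qed
  show ?thesis
  proof (cases "Bseq x")
    case True
    then show ?thesis unfolding carrier lim[OF True] dominated_iff[OF True] by simp
  next
    case False
    then have "\<nexists>c. dominated x c" using dominated_Bseq by metis
    with False show ?thesis unfolding carrier by simp
  qed
qed

lemma d_norm_le_iff:
  fixes x :: "nat \<Rightarrow> 'k::real_normed_field"
  assumes x: "x \<in> vcarrier (d_predual w)"
  shows "vnorm (d_predual w) x \<le> c \<longleftrightarrow> dominated x c"
proof -
  have B: "Bseq x" and bdd: "bdd_above (W_quot w x ` {1..})"
    using x by (auto simp: d_predual_def d_star_def)
  have "vnorm (d_predual w) x = (SUP n\<in>{1..}. W_quot w x n)"
    by (simp add: d_predual_def d_star_def)
  moreover have "(SUP n\<in>{1..}. W_quot w x n) \<le> c \<longleftrightarrow> (\<forall>n\<in>{1..}. W_quot w x n \<le> c)"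
    by (rule cSUP_le_iff[OF _ bdd]) simp
  ultimately show ?thesis unfolding dominated_iff[OF B] by (simp add: Ball_def)
qed

lemma d_norm_bound:
  fixes x :: "nat \<Rightarrow> 'k::real_normed_field"
  assumes "x \<in> vcarrier (d_predual w)" "finite S"
  shows "(\<Sum>i\<in>S. norm (x i)) \<le> vnorm (d_predual w) x * W (card S)"
  using d_norm_le_iff[OF assms(1), of "vnorm (d_predual w) x"] assms(2) by simp

end

section \<open>Majorization by the weight\<close>

lemma decreasing_enumeration:
  fixes v :: "nat \<Rightarrow> real"
  assumes "finite S"
  shows "\<exists>\<sigma>. bij_betw \<sigma> {..<card S} S \<and> (\<forall>i j. i \<le> j \<and> j < card S \<longrightarrow> v (\<sigma> j) \<le> v (\<sigma> i))"
  using assms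
proof (induction "card S" arbitrary: S)
  case (Suc n)
  then have "S \<noteq> {}" by auto
  obtain k where k: "k \<in> S" "\<And>i. i \<in> S \<Longrightarrow> v k \<le> v i"
    using Suc.prems \<open>S \<noteq> {}\<close> by (metis (no_types, lifting) arg_min_if_finite(1) arg_min_least)
  have card: "card (S - {k}) = n" using Suc.hyps(2) Suc.prems k(1) by simp
  obtain \<sigma> where \<sigma>: "bij_betw \<sigma> {..<n} (S - {k})" "\<And>i j. i \<le> j \<Longrightarrow> j < n \<Longrightarrow> v (\<sigma> j) \<le> v (\<sigma> i)"
    using Suc.hyps(1)[of "S - {k}"] card Suc.prems by auto
  have mem: "\<sigma> i \<in> S" if "i < n" for i using \<sigma>(1) that by (auto simp: bij_betw_def)
  have "bij_betw (\<sigma>(n := k)) {..<n} (S - {k})"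
    using \<sigma>(1) by (subst bij_betw_cong[of _ _ \<sigma>]) auto
  from notIn_Un_bij_betw[OF _ _ this, of n] have "bij_betw (\<sigma>(n := k)) {..<Suc n} S"
    using k(1) by (simp add: lessThan_Suc insert_absorb)
  moreover have "v ((\<sigma>(n := k)) j) \<le> v ((\<sigma>(n := k)) i)" if "i \<le> j" "j < Suc n" for i j
    using that \<sigma>(2)[of i j] k(2)[OF mem, of i] by (cases "j = n"; cases "i = n") auto
  ultimately show ?case using Suc.hyps(2) by (intro exI[of _ "\<sigma>(n := k)"]) auto
qed (auto intro: exI[of _ id])

text \<open>Summation by parts: the partial sums of w - d are nonnegative and v decreases, so the
  sum of (w - d) v is at least the last value of v times the last partial sum.\<close>

lemma Abel_sum_le:
  fixes d v w :: "nat \<Rightarrow> real"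
  assumes "\<And>k. k \<le> n \<Longrightarrow> (\<Sum>i<k. d i) \<le> (\<Sum>i<k. w i)"
    and "\<And>i j. i \<le> j \<Longrightarrow> j < n \<Longrightarrow> v j \<le> v i" and "\<And>i. i < n \<Longrightarrow> 0 \<le> v i"
  shows "(\<Sum>i<n. d i * v i) \<le> (\<Sum>i<n. w i * v i)"
proof -
  \<comment> \<open>For \<open>k = 0\<close> truncated subtraction is harmless, as both sums are
    empty. In the step the factor drops from \<open>v (k - 1)\<close> to \<open>v k\<close>, which
    only lowers the left side.\<close>
  have "v (k - 1) * (\<Sum>i<k. w i - d i) \<le> (\<Sum>i<k. (w i - d i) * v i)" if "k \<le> n" for k
    using that
  proof (induction k)
    case (Suc k)
    have nn: "0 \<le> (\<Sum>i<k. w i - d i)" using assms(1)[of k] Suc.prems by (simp add: sum_subtractf)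
    have "v k * (\<Sum>i<k. w i - d i) \<le> v (k - 1) * (\<Sum>i<k. w i - d i)"
      using nn assms(2)[of "k - 1" k] Suc.prems by (intro mult_right_mono) auto
    then show ?case using Suc by (simp add: algebra_simps)
  qed simp
  from this[of n] have "v (n - 1) * (\<Sum>i<n. w i - d i) \<le> (\<Sum>i<n. (w i - d i) * v i)" by simp
  moreover have "0 \<le> v (n - 1) * (\<Sum>i<n. w i - d i)"
    using assms(1)[of n] assms(3)[of "n - 1"] by (cases n) (auto simp: sum_subtractf)
  ultimately show ?thesis by (simp add: algebra_simps sum_subtractf)
qed

context admissible_weight
begin

text \<open>The maximum of a set of n + 1 naturals is at least n, so its weight is at most
  \<open>w n\<close>; remove it and induct.\<close>

lemma sum_w_le: "finite T \<Longrightarrow> (\<Sum>i\<in>T. w i) \<le> W (card T)"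
proof (induction "card T" arbitrary: T)
  case (Suc n)
  then have ne: "T \<noteq> {}" by auto
  have m: "Max T \<in> T" using Suc.prems ne by simp
  have "T \<subseteq> {..Max T}" using Suc.prems by auto
  then have "card T \<le> Suc (Max T)" using card_mono[of "{..Max T}" T] by simp
  then have "w (Max T) \<le> w n" using Suc.hyps(2) by (intro w_dec) simp
  moreover have "(\<Sum>i\<in>T - {Max T}. w i) \<le> W n"
    using Suc.hyps Suc.prems m by (metis card_Diff_singleton diff_Suc_1 finite_Diff)
  ultimately show ?case
    using Suc.hyps(2)[symmetric] Suc.prems m by (simp add: sum.remove[of T "Max T"] W_Suc)
qed simp

text \<open>The majorization inequality behind both the shrinking property and the power sums.
  Enumerating \<open>S\<close> by decreasing \<open>v\<close> makes the partial sums of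
  \<open>b\<close> at most \<open>c * W k\<close>, and \<open>Abel_sum_le\<close> applies.\<close>

lemma decreasing_enumeration_sum:
  fixes b v :: "nat \<Rightarrow> real"
  assumes S: "finite S" and b: "\<And>T. T \<subseteq> S \<Longrightarrow> (\<Sum>i\<in>T. b i) \<le> c * W (card T)"
    and v: "\<And>i. i \<in> S \<Longrightarrow> 0 \<le> v i"
  shows "\<exists>\<sigma>. bij_betw \<sigma> {..<card S} S \<and> (\<Sum>i\<in>S. b i * v i) \<le> c * (\<Sum>i<card S. w i * v (\<sigma> i))"
proof -
  obtain \<sigma> where \<sigma>: "bij_betw \<sigma> {..<card S} S" "\<And>i j. i \<le> j \<Longrightarrow> j < card S \<Longrightarrow> v (\<sigma> j) \<le> v (\<sigma> i)"
    using decreasing_enumeration[OF S, of v] by blast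
  have inj: "inj_on \<sigma> {..<k}" "\<sigma> ` {..<k} \<subseteq> S" if "k \<le> card S" for k
    using \<sigma>(1) that by (auto simp: bij_betw_def inj_on_def)
  have "(\<Sum>i\<in>S. b i * v i) = (\<Sum>i<card S. b (\<sigma> i) * v (\<sigma> i))"
    using sum.reindex_bij_betw[OF \<sigma>(1), of "\<lambda>i. b i * v i"] by simp
  also have "\<dots> \<le> (\<Sum>i<card S. (c * w i) * v (\<sigma> i))"
  proof (rule Abel_sum_le)
    fix k assume k: "k \<le> card S"
    have "(\<Sum>i<k. b (\<sigma> i)) = (\<Sum>i\<in>\<sigma> ` {..<k}. b i)"
      using inj(1)[OF k] by (simp add: sum.reindex)
    also have "\<dots> \<le> c * W k"
      using b[OF inj(2)[OF k]] inj(1)[OF k] by (simp add: card_image)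
    finally show "(\<Sum>i<k. b (\<sigma> i)) \<le> (\<Sum>i<k. c * w i)" by (simp add: W_def sum_distrib_left)
  next
    fix i assume "i < card S"
    then show "0 \<le> v (\<sigma> i)" using v inj(2)[of "card S"] by auto
  qed (use \<sigma>(2) in auto)
  finally show ?thesis using \<sigma>(1) by (auto simp: sum_distrib_left mult.assoc)
qed

section \<open>The predual as a normed sequence space\<close>

lemma vscale_d [simp]: "vscale (d_predual w) c x = (\<lambda>i. c * x i)"
  by (simp add: d_predual_def d_star_def)

lemma d_solid:
  fixes x y :: "nat \<Rightarrow> 'k::real_normed_field"
  assumes x: "x \<in> vcarrier (d_predual w)" and le: "\<And>i. norm (y i) \<le> norm (x i)"
  shows "y \<in> vcarrier (d_predual w)" "vnorm (d_predual w) y \<le> vnorm (d_predual w) x"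
proof -
  have sum: "(\<Sum>i\<in>S. norm (y i)) \<le> (\<Sum>i\<in>S. norm (x i))" for S by (intro sum_mono le)
  show y: "y \<in> vcarrier (d_predual w)"
    unfolding d_predual_iff
  proof (intro conjI allI impI)
    obtain c where "dominated x c" using x unfolding d_predual_iff by blast
    then have "dominated y c" by (intro allI impI order_trans[OF sum]) simp
    then show "\<exists>c. dominated y c" by blast
  next
    fix \<epsilon> :: real assume "0 < \<epsilon>"
    then obtain m where "\<And>S. finite S \<Longrightarrow> m \<le> card S \<Longrightarrow> (\<Sum>i\<in>S. norm (x i)) \<le> \<epsilon> * W (card S)"
      using x unfolding d_predual_iff by metis
    then show "\<exists>n0. \<forall>S. finite S \<and> n0 \<le> card S \<longrightarrow> (\<Sum>i\<in>S. norm (y i)) \<le> \<epsilon> * W (card S)"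
      by (intro exI[of _ m] allI impI order_trans[OF sum]) simp
  qed
  show "vnorm (d_predual w) y \<le> vnorm (d_predual w) x"
    unfolding d_norm_le_iff[OF y] using d_norm_bound[OF x] by (intro allI impI order_trans[OF sum])
qed

lemma normed_carrier_d: "normed_carrier (d_predual w :: ('k::real_normed_field, nat \<Rightarrow> 'k) nspace)"
proof
  have "(\<lambda>_. 0 :: 'k) \<in> vcarrier (d_predual w)"
    unfolding d_predual_iff using W_nonneg by (auto intro!: exI[of _ 0])
  then show "vcarrier (d_predual w :: ('k, nat \<Rightarrow> 'k) nspace) \<noteq> {}" by blast
next
  fix x y :: "nat \<Rightarrow> 'k"
  assume x: "x \<in> vcarrier (d_predual w)" and y: "y \<in> vcarrier (d_predual w)"
  have tri: "(\<Sum>i\<in>S. norm ((x + y) i)) \<le> (\<Sum>i\<in>S. norm (x i)) + (\<Sum>i\<in>S. norm (y i))" for S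
    by (simp add: sum.distrib[symmetric] sum_mono norm_triangle_ineq)
  show "x + y \<in> vcarrier (d_predual w)"
    unfolding d_predual_iff
  proof (intro conjI allI impI)
    have "dominated (x + y) (vnorm (d_predual w) x + vnorm (d_predual w) y)"
    proof (intro allI impI)
      fix S :: "nat set" assume S: "finite S"
      show "(\<Sum>i\<in>S. norm ((x + y) i)) \<le> (vnorm (d_predual w) x + vnorm (d_predual w) y) * W (card S)"
        using tri[of S] d_norm_bound[OF x S] d_norm_bound[OF y S] unfolding distrib_right by linarith
    qed
    then show "\<exists>c. dominated (x + y) c" by blast
  next
    fix \<epsilon> :: real assume "0 < \<epsilon>"
    then have "0 < \<epsilon> / 2" by simp
    obtain m where m: "\<And>S. finite S \<Longrightarrow> m \<le> card S \<Longrightarrow> (\<Sum>i\<in>S. norm (x i)) \<le> \<epsilon> / 2 * W (card S)"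
      using x \<open>0 < \<epsilon> / 2\<close> unfolding d_predual_iff by metis
    obtain n where n: "\<And>S. finite S \<Longrightarrow> n \<le> card S \<Longrightarrow> (\<Sum>i\<in>S. norm (y i)) \<le> \<epsilon> / 2 * W (card S)"
      using y \<open>0 < \<epsilon> / 2\<close> unfolding d_predual_iff by metis
    show "\<exists>n0. \<forall>S. finite S \<and> n0 \<le> card S \<longrightarrow> (\<Sum>i\<in>S. norm ((x + y) i)) \<le> \<epsilon> * W (card S)"
    proof (intro exI[of _ "max m n"] allI impI, elim conjE)
      fix S :: "nat set" assume S: "finite S" "max m n \<le> card S"
      have "\<epsilon> * W (card S) = \<epsilon> / 2 * W (card S) + \<epsilon> / 2 * W (card S)" by simp
      then show "(\<Sum>i\<in>S. norm ((x + y) i)) \<le> \<epsilon> * W (card S)"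
        using tri[of S] m[OF S(1)] n[OF S(1)] S(2) by linarith
    qed
  qed
next
  fix x :: "nat \<Rightarrow> 'k" and c :: 'k assume x: "x \<in> vcarrier (d_predual w)"
  have eq: "(\<Sum>i\<in>S. norm ((vscale (d_predual w) c x) i)) = norm c * (\<Sum>i\<in>S. norm (x i))" for S
    by (simp add: norm_mult sum_distrib_left)
  have dom: "dominated (vscale (d_predual w) c x) (norm c * vnorm (d_predual w) x)"
    unfolding eq mult.assoc by (intro allI impI mult_left_mono d_norm_bound[OF x]) auto
  show cx: "vscale (d_predual w) c x \<in> vcarrier (d_predual w)"
    unfolding d_predual_iff
  proof (intro conjI allI impI)
    show "\<exists>c'. dominated (vscale (d_predual w) c x) c'" using dom by blast
  next
    fix \<epsilon> :: real assume \<epsilon>: "0 < \<epsilon>"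
    then have "0 < \<epsilon> / (norm c + 1)" by (simp add: add_nonneg_pos)
    then obtain m where m: "\<And>S. finite S \<Longrightarrow> m \<le> card S \<Longrightarrow> (\<Sum>i\<in>S. norm (x i)) \<le> \<epsilon> / (norm c + 1) * W (card S)"
      using x unfolding d_predual_iff by metis
    show "\<exists>n0. \<forall>S. finite S \<and> n0 \<le> card S \<longrightarrow> (\<Sum>i\<in>S. norm ((vscale (d_predual w) c x) i)) \<le> \<epsilon> * W (card S)"
    proof (intro exI[of _ m] allI impI, elim conjE)
      fix S :: "nat set" assume S: "finite S" "m \<le> card S"
      have "norm c * (\<Sum>i\<in>S. norm (x i)) \<le> norm c * (\<epsilon> / (norm c + 1) * W (card S))"
        by (intro mult_left_mono m S) simp
      also have "\<dots> = (norm c / (norm c + 1)) * (\<epsilon> * W (card S))" by simp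
      also have "\<dots> \<le> 1 * (\<epsilon> * W (card S))"
        using \<epsilon> W_nonneg by (intro mult_right_mono) (auto simp: divide_le_eq add_nonneg_pos)
      finally show "(\<Sum>i\<in>S. norm ((vscale (d_predual w) c x) i)) \<le> \<epsilon> * W (card S)"
        unfolding eq by simp
    qed
  qed
  have "norm (x 0) \<le> vnorm (d_predual w) x" using d_norm_bound[OF x, of "{0}"] by (simp add: W_1)
  then show nn: "0 \<le> vnorm (d_predual w) x" using norm_ge_zero order_trans by blast
  show "vnorm (d_predual w) (vscale (d_predual w) c x) = norm c * vnorm (d_predual w) x"
  proof (rule antisym)
    show "vnorm (d_predual w) (vscale (d_predual w) c x) \<le> norm c * vnorm (d_predual w) x"
      using dom by (subst d_norm_le_iff[OF cx])
    show "norm c * vnorm (d_predual w) x \<le> vnorm (d_predual w) (vscale (d_predual w) c x)"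
    proof (cases "c = 0")
      case True
      have "norm ((vscale (d_predual w) c x) 0) \<le> vnorm (d_predual w) (vscale (d_predual w) c x)"
        using d_norm_bound[OF cx, of "{0}"] by (simp add: W_1)
      then show ?thesis using True by simp
    next
      case False
      have "vnorm (d_predual w) x \<le> vnorm (d_predual w) (vscale (d_predual w) c x) / norm c"
        unfolding d_norm_le_iff[OF x]
      proof (intro allI impI)
        fix S :: "nat set" assume "finite S"
        from d_norm_bound[OF cx this]
        have "norm c * (\<Sum>i\<in>S. norm (x i)) \<le> vnorm (d_predual w) (vscale (d_predual w) c x) * W (card S)"
          unfolding eq .
        then show "(\<Sum>i\<in>S. norm (x i)) \<le> vnorm (d_predual w) (vscale (d_predual w) c x) / norm c * W (card S)"
          using False by (simp add: field_simps)
      qed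
      then show ?thesis using False by (simp add: field_simps)
    qed
  qed
qed

lemma finite_support_in_d:
  fixes x :: "nat \<Rightarrow> 'k::real_normed_field"
  assumes supp: "\<And>i. n \<le> i \<Longrightarrow> x i = 0"
  shows "x \<in> vcarrier (d_predual w)"
proof -
  define B where "B = (\<Sum>i<n. norm (x i))"
  have B0: "0 \<le> B" by (simp add: B_def sum_nonneg)
  have B: "(\<Sum>i\<in>S. norm (x i)) \<le> B" if S: "finite S" for S
  proof -
    have "(\<Sum>i\<in>S. norm (x i)) = (\<Sum>i\<in>S \<inter> {..<n}. norm (x i))"
      using S supp by (intro sum.mono_neutral_right) (auto simp: not_less)
    also have "\<dots> \<le> B" unfolding B_def by (intro sum_mono2) auto
    finally show ?thesis .
  qed
  show ?thesis
    unfolding d_predual_iff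
  proof (intro conjI allI impI)
    have "dominated x B"
    proof (intro allI impI)
      fix S :: "nat set" assume S: "finite S"
      show "(\<Sum>i\<in>S. norm (x i)) \<le> B * W (card S)"
      proof (cases "S = {}")
        case False
        then have "1 \<le> W (card S)" using S by (intro W_ge_1) (simp add: card_gt_0_iff)
        from mult_left_mono[OF this B0] B[OF S] show ?thesis by simp
      qed simp
    qed
    then show "\<exists>c. dominated x c" by blast
  next
    fix \<epsilon> :: real assume \<epsilon>: "0 < \<epsilon>"
    \<comment> \<open>All sums are at most \<open>B\<close>, which is negligible against
      \<open>W\<close> because the weight is not summable.\<close>
    obtain n0 where n0: "\<And>n. n0 \<le> n \<Longrightarrow> B / \<epsilon> \<le> W n" using W_unbounded by blast
    show "\<exists>n0. \<forall>S. finite S \<and> n0 \<le> card S \<longrightarrow> (\<Sum>i\<in>S. norm (x i)) \<le> \<epsilon> * W (card S)"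
    proof (intro exI[of _ n0] allI impI, elim conjE)
      fix S :: "nat set" assume S: "finite S" "n0 \<le> card S"
      show "(\<Sum>i\<in>S. norm (x i)) \<le> \<epsilon> * W (card S)"
        using B[OF S(1)] n0[OF S(2)] \<epsilon> by (simp add: field_simps)
    qed
  qed
qed

text \<open>Two regimes of index sets. Sets with at least \<open>n0\<close> elements are controlled
  by the limit condition on \<open>x\<close>. Smaller ones carry fewer than \<open>n0\<close>
  entries of a null sequence, which are tiny far out, while \<open>W\<close> is at least
  one.\<close>

lemma d_tail_tendsto_0:
  fixes x :: "nat \<Rightarrow> 'k::real_normed_field"
  assumes x: "x \<in> vcarrier (d_predual w)"
  shows "(\<lambda>k. vnorm (d_predual w) (tail k x)) \<longlonglongrightarrow> 0"
proof (rule metric_LIMSEQ_I)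
  interpret normed_carrier "d_predual w :: ('k, nat \<Rightarrow> 'k) nspace" by (rule normed_carrier_d)
  fix \<epsilon> :: real assume "0 < \<epsilon>"
  then have \<epsilon>: "0 < \<epsilon> / 2" by simp
  obtain n0 where n0: "\<And>S. finite S \<Longrightarrow> n0 \<le> card S \<Longrightarrow> (\<Sum>i\<in>S. norm (x i)) \<le> \<epsilon> / 2 * W (card S)"
    using x \<epsilon> unfolding d_predual_iff by metis
  obtain c where "dominated x c" using x unfolding d_predual_iff by blast
  then have "x \<longlonglongrightarrow> 0" by (rule dominated_tendsto_0)
  moreover have "0 < \<epsilon> / 2 / (real n0 + 1)" using \<epsilon> by simp
  ultimately obtain k0 where k0: "\<And>i. k0 \<le> i \<Longrightarrow> norm (x i) < \<epsilon> / 2 / (real n0 + 1)"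
    using LIMSEQ_D[of x 0] by (metis diff_zero)
  have "vnorm (d_predual w) (tail k x) \<le> \<epsilon> / 2" if k: "k0 \<le> k" for k
  proof -
    have le: "norm (tail k x i) \<le> norm (x i)" for i by (simp add: tail_def)
    show ?thesis
      unfolding d_norm_le_iff[OF d_solid(1)[OF x le]]
    proof (intro allI impI)
      fix S :: "nat set" assume S: "finite S"
      show "(\<Sum>i\<in>S. norm (tail k x i)) \<le> \<epsilon> / 2 * W (card S)"
      proof (cases "n0 \<le> card S")
        case True
        have "(\<Sum>i\<in>S. norm (tail k x i)) \<le> (\<Sum>i\<in>S. norm (x i))" by (intro sum_mono le)
        then show ?thesis using n0[OF S True] by linarith
      next
        case False
        have "(\<Sum>i\<in>S. norm (tail k x i)) \<le> real (card S) * (\<epsilon> / 2 / (real n0 + 1))"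
          using \<epsilon> k k0 by (intro sum_bounded_above) (auto simp: tail_def intro: less_imp_le)
        also have "\<dots> = (real (card S) / (real n0 + 1)) * (\<epsilon> / 2)" by simp
        also have "\<dots> \<le> 1 * (\<epsilon> / 2)" using False \<epsilon> by (intro mult_right_mono) auto
        finally have *: "(\<Sum>i\<in>S. norm (tail k x i)) \<le> \<epsilon> / 2" by simp
        show ?thesis
        proof (cases "S = {}")
          case False
          then have "1 \<le> W (card S)" using S by (intro W_ge_1) (simp add: card_gt_0_iff)
          from mult_left_mono[OF this, of "\<epsilon> / 2"] * \<epsilon> show ?thesis by linarith
        qed simp
      qed
    qed
  qed
  moreover have "0 \<le> vnorm (d_predual w) (tail k x)" for k
    by (intro norm_nonneg d_solid(1)[OF x]) (simp add: tail_def)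
  ultimately show "\<exists>no. \<forall>k\<ge>no. dist (vnorm (d_predual w) (tail k x)) 0 < \<epsilon>"
    using \<open>0 < \<epsilon>\<close> by (intro exI[of _ k0]) (force simp: dist_real_def)
qed

lemma sequence_carrier_d: "sequence_carrier (d_predual w :: ('k::real_normed_field, nat \<Rightarrow> 'k) nspace)"
proof (intro sequence_carrier.intro sequence_carrier_axioms.intro normed_carrier_d)
  fix i
  show "(unit_seq i :: nat \<Rightarrow> 'k) \<in> vcarrier (d_predual w)"
    by (rule finite_support_in_d[of "Suc i"]) (simp add: unit_seq_def)
  show "\<exists>C. \<forall>x\<in>vcarrier (d_predual w :: ('k, nat \<Rightarrow> 'k) nspace). norm (x i) \<le> C * vnorm (d_predual w) x"
    using d_norm_bound[where S = "{i}"] by (intro exI[of _ 1]) (auto simp: W_1)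
qed simp

end

section \<open>Coefficients of functionals and the shrinking property\<close>

lemma norm_phase_le: "norm (of_real (norm z) / z :: 'k::real_normed_field) \<le> 1"
  by (cases "z = 0") (auto simp: norm_divide)

text \<open>The quotient acts as the conjugate phase in any \<open>real_normed_field\<close>.
  Division by zero yields 0, so the identity survives at \<open>z = 0\<close>.\<close>

lemma phase_mult: "of_real (norm z) / z * z = (of_real (norm z) :: 'k::real_normed_field)"
  by (cases "z = 0") auto

lemma (in normed_carrier) bidual_sum:
  assumes z: "z \<in> vcarrier (bidual X)" and S: "finite S" "\<And>i. i \<in> S \<Longrightarrow> g i \<in> vcarrier (dual X)"
  shows "z (\<lambda>x. \<Sum>i\<in>S. c i * g i x) = (\<Sum>i\<in>S. c i * z (g i))"
  using S
proof (induction S rule: finite_induct)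
  case empty
  show ?case using dual_scale[OF z dual_zero, of 0] by (simp add: dual_def)
next
  case (insert i S)
  interpret D: normed_carrier "dual X" by (rule normed_carrier_dual)
  have g: "g i \<in> vcarrier (dual X)" and h: "(\<lambda>x. \<Sum>i\<in>S. c i * g i x) \<in> vcarrier (dual X)"
    using insert by (auto intro: dual_sum)
  have "(\<lambda>x. \<Sum>i\<in>insert i S. c i * g i x) = vscale (dual X) (c i) (g i) + (\<lambda>x. \<Sum>i\<in>S. c i * g i x)"
    using insert by auto
  then show ?case
    using insert by (simp only: dual_add[OF z D.scale_closed[OF g] h] dual_scale[OF z g]) simp
qed

context admissible_weight
begin

text \<open>The Lorentz norm of the coefficients of \<open>f\<close> is at most its dual norm. The
  test vector carries the weights of \<open>w\<close> along \<sigma>, with phases aligned to the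
  coefficients, and lies in the ball by \<open>sum_w_le\<close>.\<close>

lemma flat_le:
  fixes f :: "(nat \<Rightarrow> 'k::real_normed_field) \<Rightarrow> 'k"
  assumes f: "f \<in> vcarrier (dual (d_predual w))" and inj: "inj_on \<sigma> {..<n}"
  shows "(\<Sum>i<n. w i * norm (f (unit_seq (\<sigma> i)))) \<le> vnorm (dual (d_predual w)) f"
proof -
  interpret sequence_carrier "d_predual w :: ('k, nat \<Rightarrow> 'k) nspace" by (rule sequence_carrier_d)
  define y where "y j = f (unit_seq j)" for j
  define \<tau> where "\<tau> = the_inv_into {..<n} \<sigma>"
  have \<tau>: "\<tau> (\<sigma> i) = i" if "i < n" for i
    using the_inv_into_f_f[OF inj] that by (simp add: \<tau>_def)
  define R where "R = \<sigma> ` {..<n}"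
  define u where "u j = (if j \<in> R then of_real (w (\<tau> j)) * (of_real (norm (y j)) / y j) else 0)" for j
  obtain m where m: "R \<subseteq> {..<m}" using finite_nat_bounded[of R] by (auto simp: R_def)
  have head: "head m u = u" using m by (auto simp: head_def u_def fun_eq_iff)
  have u: "u \<in> vcarrier (d_predual w)"
    by (rule finite_support_in_d[of m]) (use m in \<open>auto simp: u_def\<close>)
  have inj_\<tau>: "inj_on \<tau> R" using \<tau> by (auto simp: R_def inj_on_def)
  have "dominated u 1"
  proof (intro allI impI)
    fix S :: "nat set" assume S: "finite S"
    have "(\<Sum>j\<in>S. norm (u j)) = (\<Sum>j\<in>S \<inter> R. norm (u j))"
      using S by (intro sum.mono_neutral_right) (auto simp: u_def)
    also have "\<dots> \<le> (\<Sum>j\<in>S \<inter> R. w (\<tau> j))"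
    proof (rule sum_mono)
      fix j assume "j \<in> S \<inter> R"
      then show "norm (u j) \<le> w (\<tau> j)"
        using mult_left_mono[OF norm_phase_le[of "y j"] w_nonneg[of "\<tau> j"]] w_nonneg[of "\<tau> j"]
        by (simp add: u_def norm_mult del: times_divide_eq_right)
    qed
    also have "\<dots> = (\<Sum>i\<in>\<tau> ` (S \<inter> R). w i)"
      using inj_on_subset[OF inj_\<tau>, of "S \<inter> R"] by (simp add: sum.reindex)
    also have "\<dots> \<le> W (card (\<tau> ` (S \<inter> R)))" using S by (intro sum_w_le) auto
    also have "\<dots> \<le> W (card S)"
      using S by (intro W_mono order_trans[OF card_image_le card_mono]) auto
    finally show "(\<Sum>j\<in>S. norm (u j)) \<le> 1 * W (card S)" by simp
  qed
  then have "u \<in> unit_ball (d_predual w)" using u by (simp add: unit_ball_def d_norm_le_iff)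
  then have le: "norm (f u) \<le> vnorm (dual (d_predual w)) f" by (rule dual_norm_ge[OF f])
  have "f u = (\<Sum>j<m. u j * y j)" using dual_head[OF f, of m u] by (simp add: head y_def)
  also have "\<dots> = (\<Sum>j\<in>R. u j * y j)"
    using m by (intro sum.mono_neutral_right) (auto simp: u_def)
  also have "\<dots> = (\<Sum>j\<in>R. of_real (w (\<tau> j) * norm (y j)))"
  proof (rule sum.cong[OF refl])
    fix j assume "j \<in> R"
    then have "u j * y j = of_real (w (\<tau> j)) * (of_real (norm (y j)) / y j * y j)"
      by (simp only: u_def if_True mult.assoc)
    then show "u j * y j = of_real (w (\<tau> j) * norm (y j))" by (simp only: phase_mult of_real_mult)
  qed
  also have "\<dots> = of_real (\<Sum>i<n. w i * norm (y (\<sigma> i)))"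
    using inj \<tau> by (simp add: R_def sum.reindex)
  finally have "norm (f u) = (\<Sum>i<n. w i * norm (y (\<sigma> i)))"
    using w_nonneg by (simp add: sum_nonneg del: of_real_sum of_real_mult)
  with le show ?thesis by (simp add: y_def)
qed

text \<open>Enumerating infinitely many coefficients of modulus at least \<mu> in
  \<open>flat_le\<close> would bound \<mu> W(n) by the norm of \<open>f\<close> for every n.\<close>

lemma dual_coeff_tendsto_0:
  fixes f :: "(nat \<Rightarrow> 'k::real_normed_field) \<Rightarrow> 'k"
  assumes f: "f \<in> vcarrier (dual (d_predual w))" and \<mu>: "0 < \<mu>"
  shows "\<exists>m. \<forall>i\<ge>m. norm (f (unit_seq i)) < \<mu>"
proof (rule ccontr)
  assume "\<not> ?thesis"
  then have inf: "infinite {i. \<mu> \<le> norm (f (unit_seq i))}"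
    unfolding infinite_nat_iff_unbounded_le by (auto simp: not_less)
  define \<sigma> where "\<sigma> = enumerate {i. \<mu> \<le> norm (f (unit_seq i))}"
  have \<sigma>: "inj \<sigma>" "\<And>i. \<mu> \<le> norm (f (unit_seq (\<sigma> i)))"
    using strict_mono_enumerate[OF inf] enumerate_in_set[OF inf]
    by (auto simp: \<sigma>_def strict_mono_imp_inj_on)
  have "\<mu> * W n \<le> vnorm (dual (d_predual w)) f" for n
  proof -
    have "\<mu> * W n = (\<Sum>i<n. w i * \<mu>)" by (simp add: W_def sum_distrib_left mult.commute)
    also have "\<dots> \<le> (\<Sum>i<n. w i * norm (f (unit_seq (\<sigma> i))))"
      by (intro sum_mono mult_left_mono \<sigma> w_nonneg)
    also have "\<dots> \<le> vnorm (dual (d_predual w)) f"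
      using inj_on_subset[OF \<sigma>(1)] by (intro flat_le[OF f]) auto
    finally show ?thesis .
  qed
  then have "W n \<le> vnorm (dual (d_predual w)) f / \<mu>" for n using \<mu> by (simp add: field_simps)
  moreover obtain n where "vnorm (dual (d_predual w)) f / \<mu> + 1 \<le> W n" using W_unbounded by blast
  ultimately show False by (metis add_le_same_cancel1 not_one_le_zero order_trans)
qed

text \<open>
  Start from an injection \<open>\<sigma>\<close> for which \<open>\<Sum>i<k. w i * \<bar>f (e (\<sigma> i))\<bar>\<close> is nearly maximal.  Far out, the
  first \<open>k\<close> terms of such a sum are small because the coefficients of \<open>f\<close> tend to zero, and its
  remaining terms are small because they could be appended to those of \<open>\<sigma>\<close>.
\<close>

lemma flat_tail_small:
  fixes f :: "(nat \<Rightarrow> 'k::real_normed_field) \<Rightarrow> 'k"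
  assumes f: "f \<in> vcarrier (dual (d_predual w))" and \<epsilon>: "0 < \<epsilon>"
  shows "\<exists>m. \<forall>n \<tau>. inj_on \<tau> {..<n} \<and> (\<forall>i<n. m \<le> \<tau> i) \<longrightarrow> (\<Sum>i<n. w i * norm (f (unit_seq (\<tau> i)))) \<le> \<epsilon>"
proof -
  define y where "y j = norm (f (unit_seq j))" for j
  define V where "V = {(\<Sum>i<n. w i * y (\<sigma> i)) |n \<sigma>. inj_on \<sigma> {..<n}}"
  define \<delta> where "\<delta> = \<epsilon> / 2"
  have \<delta>: "0 < \<delta>" using \<epsilon> by (simp add: \<delta>_def)
  have ne: "V \<noteq> {}" unfolding V_def by (auto intro!: exI[of _ "0 :: nat"])
  have bdd: "bdd_above V" unfolding V_def y_def using flat_le[OF f] by (auto simp: bdd_above_def)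
  have "\<exists>v\<in>V. Sup V - \<delta> < v" using less_cSup_iff[OF ne bdd, of "Sup V - \<delta>"] \<delta> by simp
  then obtain k \<sigma> where \<sigma>: "inj_on \<sigma> {..<k}" "Sup V - \<delta> < (\<Sum>i<k. w i * y (\<sigma> i))"
    unfolding V_def by blast
  obtain m1 where m1: "\<sigma> ` {..<k} \<subseteq> {..<m1}" using finite_nat_bounded[of "\<sigma> ` {..<k}"] by auto
  have "0 < \<delta> / (W k + 1)" using \<delta> W_nonneg[of k] by (simp add: add_nonneg_pos)
  \<comment> \<open>Below this threshold the first \<open>k\<close> weighted terms add up to at most
    \<delta>; the added 1 keeps the denominator positive when \<open>k = 0\<close>.\<close>
  then obtain m2 where m2: "\<And>i. m2 \<le> i \<Longrightarrow> y i < \<delta> / (W k + 1)"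
    using dual_coeff_tendsto_0[OF f] unfolding y_def by blast
  show ?thesis
  proof (intro exI[of _ "max m1 m2"] allI impI, elim conjE)
    fix n :: nat and \<tau> :: "nat \<Rightarrow> nat"
    assume \<tau>: "inj_on \<tau> {..<n}" "\<forall>i<n. max m1 m2 \<le> \<tau> i"
    have first: "(\<Sum>i<l. w i * y (\<tau> i)) \<le> \<delta>" if l: "l \<le> k" "l \<le> n" for l
    proof -
      have "(\<Sum>i<l. w i * y (\<tau> i)) \<le> (\<Sum>i<l. w i * (\<delta> / (W k + 1)))"
        using l \<tau>(2) by (intro sum_mono mult_left_mono w_nonneg less_imp_le[OF m2]) auto
      also have "\<dots> = W l * (\<delta> / (W k + 1))" by (simp only: W_def sum_distrib_right)
      also have "\<dots> \<le> W k * (\<delta> / (W k + 1))"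
        using \<delta> W_nonneg[of k] by (intro mult_right_mono W_mono l(1)) auto
      also have "\<dots> \<le> \<delta>" using \<delta> W_nonneg[of k] by (simp add: divide_le_eq add_nonneg_pos)
      finally show ?thesis .
    qed
    show "(\<Sum>i<n. w i * norm (f (unit_seq (\<tau> i)))) \<le> \<epsilon>"
      unfolding y_def[symmetric]
    proof (cases "n \<le> k")
      case True
      then show "(\<Sum>i<n. w i * y (\<tau> i)) \<le> \<epsilon>" using first[of n] \<delta> by (simp add: \<delta>_def)
    next
      case False
      then have kn: "k \<le> n" by simp
      \<comment> \<open>Keeping \<tau> at its positions keeps its weights. Injectivity holds because
        \<sigma> stays below \<open>m1\<close> and \<tau> does not. Comparison with
        \<open>Sup V\<close> then leaves at most \<delta> for the terms from \<open>k\<close>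
        on.\<close>
      define \<rho> where "\<rho> i = (if i < k then \<sigma> i else \<tau> i)" for i
      have "inj_on \<rho> {..<n}"
      proof (rule inj_onI)
        fix i j assume ij: "i \<in> {..<n}" "j \<in> {..<n}" "\<rho> i = \<rho> j"
        have lt: "\<sigma> i < m1" if "i < k" for i using m1 that by auto
        have ge: "m1 \<le> \<tau> i" if "i < n" for i using \<tau>(2) that by auto
        show "i = j"
          using ij lt[of i] lt[of j] ge[of i] ge[of j] inj_onD[OF \<sigma>(1), of i j] inj_onD[OF \<tau>(1), of i j]
          by (cases "i < k"; cases "j < k") (auto simp: \<rho>_def)
      qed
      then have "(\<Sum>i<n. w i * y (\<rho> i)) \<le> Sup V" by (intro cSup_upper bdd) (auto simp: V_def)
      moreover have split: "(\<Sum>i<n. g i) = (\<Sum>i<k. g i) + (\<Sum>i=k..<n. g i)" for g :: "nat \<Rightarrow> real"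
        using sum.atLeastLessThan_concat[of 0 k n g] kn by (simp add: atLeast0LessThan)
      ultimately have "(\<Sum>i=k..<n. w i * y (\<tau> i)) \<le> \<delta>"
        using \<sigma>(2) by (simp add: \<rho>_def)
      then show "(\<Sum>i<n. w i * y (\<tau> i)) \<le> \<epsilon>"
        using first[of k] kn by (simp add: split \<delta>_def)
    qed
  qed
qed

text \<open>By majorization, \<open>f\<close> on a finite piece of the tail of \<open>x\<close> is
  at most the norm of \<open>x\<close> times a weighted sum of coefficients beyond \<open>n\<close>,
  which \<open>flat_tail_small\<close> makes small.\<close>

lemma shrinking_carrier_d: "shrinking_carrier (d_predual w :: ('k::real_normed_field, nat \<Rightarrow> 'k) nspace)"
proof (intro shrinking_carrier.intro sequence_carrier_d shrinking_carrier_axioms.intro)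
  interpret sequence_carrier "d_predual w :: ('k, nat \<Rightarrow> 'k) nspace" by (rule sequence_carrier_d)
  fix f :: "(nat \<Rightarrow> 'k) \<Rightarrow> 'k" and \<epsilon> :: real
  assume f: "f \<in> vcarrier (dual (d_predual w))" and \<epsilon>: "0 < \<epsilon>"
  obtain m where m: "\<And>n \<tau>. inj_on \<tau> {..<n} \<Longrightarrow> (\<And>i. i < n \<Longrightarrow> m \<le> \<tau> i) \<Longrightarrow>
      (\<Sum>i<n. w i * norm (f (unit_seq (\<tau> i)))) \<le> \<epsilon>"
    using flat_tail_small[OF f \<epsilon>] by blast
  show "\<exists>m. \<forall>n\<ge>m. \<forall>x\<in>vcarrier (d_predual w). norm (f (tail n x)) \<le> \<epsilon> * vnorm (d_predual w) x"
  proof (intro exI[of _ m] allI impI ballI)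
    fix n x assume n: "m \<le> n" and x: "x \<in> vcarrier (d_predual w :: ('k, nat \<Rightarrow> 'k) nspace)"
    show "norm (f (tail n x)) \<le> \<epsilon> * vnorm (d_predual w) x"
    proof (rule tail_functional_le[OF d_tail_tendsto_0[OF tail_in[OF x]] f tail_in[OF x]])
      fix k
      have "norm (f (head k (tail n x))) = norm (\<Sum>i<k. tail n x i * f (unit_seq i))"
        by (simp add: dual_head[OF f])
      also have "(\<Sum>i<k. tail n x i * f (unit_seq i)) = (\<Sum>i\<in>{n..<k}. x i * f (unit_seq i))"
        by (rule sum.mono_neutral_cong_right) (auto simp: tail_def)
      also have "norm \<dots> \<le> (\<Sum>i\<in>{n..<k}. norm (x i) * norm (f (unit_seq i)))"
        by (rule order_trans[OF norm_sum]) (simp add: norm_mult)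
      also have "\<dots> \<le> vnorm (d_predual w) x * \<epsilon>"
      proof -
        have b: "(\<Sum>i\<in>T. norm (x i)) \<le> vnorm (d_predual w) x * W (card T)" if "T \<subseteq> {n..<k}" for T
          using that by (intro d_norm_bound[OF x] finite_subset[OF that]) auto
        obtain \<sigma> where \<sigma>: "bij_betw \<sigma> {..<card {n..<k}} {n..<k}"
          "(\<Sum>i\<in>{n..<k}. norm (x i) * norm (f (unit_seq i)))
            \<le> vnorm (d_predual w) x * (\<Sum>i<card {n..<k}. w i * norm (f (unit_seq (\<sigma> i))))"
          using decreasing_enumeration_sum[of "{n..<k}" "\<lambda>i. norm (x i)" "vnorm (d_predual w) x"
              "\<lambda>i. norm (f (unit_seq i))"] b by auto
        have "(\<Sum>i<card {n..<k}. w i * norm (f (unit_seq (\<sigma> i)))) \<le> \<epsilon>"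
        proof (rule m)
          show "inj_on \<sigma> {..<card {n..<k}}" using \<sigma>(1) by (simp add: bij_betw_def)
          fix i assume "i < card {n..<k}"
          then have "\<sigma> i \<in> {n..<k}" using \<sigma>(1) by (auto simp: bij_betw_def)
          then show "m \<le> \<sigma> i" using n by simp
        qed
        from mult_left_mono[OF this norm_nonneg[OF x]] \<sigma>(2) show ?thesis by linarith
      qed
      finally show "norm (f (head k (tail n x))) \<le> \<epsilon> * vnorm (d_predual w) x" by (simp add: mult.commute)
    qed
  qed
qed

section \<open>Perturbing points of the bidual ball\<close>

text \<open>From cardinality \<open>K\<close> on, \<open>room\<close> leaves slack one. For smaller
  sets, if b has finite support and n lies beyond it, omitting n costs nothing while
  \<open>W\<close> drops by at least \<open>w K\<close>. Otherwise there is a nonzero entry outside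
  \<open>S\<close> at least as large as \<open>norm (b n) + norm c\<close>, and exchanging n for it
  gives the bound.\<close>

lemma dominated_perturb:
  fixes b :: "nat \<Rightarrow> 'k::real_normed_field"
  assumes b: "dominated b 1"
    and room: "\<And>S. finite S \<Longrightarrow> (\<Sum>i\<in>S. norm (b i)) \<le> C + \<beta> * W (card S)" and \<beta>: "\<beta> < 1"
  shows "\<exists>\<theta>>0. \<exists>n0. \<forall>n\<ge>n0. \<forall>c. norm c \<le> \<theta> \<longrightarrow> dominated (\<lambda>i. b i + (if i = n then c else 0)) 1"
proof -
  obtain K where K: "\<And>k. K \<le> k \<Longrightarrow> (C + 1) / (1 - \<beta>) \<le> W k" using W_unbounded by blast
  have large: "(\<Sum>i\<in>S. norm (b i)) + 1 \<le> W (card S)" if S: "finite S" "K \<le> card S" for S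
  proof -
    have "C + 1 \<le> (1 - \<beta>) * W (card S)" using K[OF S(2)] \<beta> by (simp add: field_simps)
    then show ?thesis using room[OF S(1)] by (simp add: algebra_simps)
  qed
  have perturb: "dominated (\<lambda>i. b i + (if i = n then c else 0)) 1"
    if c: "norm c \<le> 1" and small: "\<And>S. finite S \<Longrightarrow> n \<in> S \<Longrightarrow> card S < K \<Longrightarrow>
      (\<Sum>i\<in>S - {n}. norm (b i)) + norm (b n) + norm c \<le> W (card S)" for n c
  proof (intro allI impI)
    fix S :: "nat set" assume S: "finite S"
    show "(\<Sum>i\<in>S. norm (b i + (if i = n then c else 0))) \<le> 1 * W (card S)"
    proof (cases "n \<in> S")
      case True
      have "(\<Sum>i\<in>S. norm (b i + (if i = n then c else 0))) = norm (b n + c) + (\<Sum>i\<in>S - {n}. norm (b i))"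
        using S True by (simp add: sum.remove[of S n])
      also have "\<dots> \<le> (\<Sum>i\<in>S - {n}. norm (b i)) + norm (b n) + norm c"
        using norm_triangle_ineq[of "b n" c] by simp
      finally have *: "(\<Sum>i\<in>S. norm (b i + (if i = n then c else 0)))
        \<le> (\<Sum>i\<in>S - {n}. norm (b i)) + norm (b n) + norm c" .
      show ?thesis
      proof (cases "card S < K")
        case True
        then show ?thesis using small[OF S \<open>n \<in> S\<close>] * by linarith
      next
        case False
        then have "(\<Sum>i\<in>S - {n}. norm (b i)) + norm (b n) + 1 \<le> W (card S)"
          using large[OF S] S True by (simp add: sum.remove[of S n])
        then show ?thesis using * c by linarith
      qed
    next
      case False
      then have "(\<Sum>i\<in>S. norm (b i + (if i = n then c else 0))) = (\<Sum>i\<in>S. norm (b i))"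
        by (intro sum.cong) auto
      then show ?thesis using b S by simp
    qed
  qed
  show ?thesis
  proof (cases "finite {i. b i \<noteq> 0}")
    case True
    then obtain n0 where n0: "{i. b i \<noteq> 0} \<subseteq> {..<n0}" using finite_nat_bounded by blast
    \<comment> \<open>\<open>w K\<close> is a lower bound for every increment of \<open>W\<close> at
      cardinalities below \<open>K\<close>, and is positive.\<close>
    have "dominated (\<lambda>i. b i + (if i = n then c else 0)) 1" if n: "n0 \<le> n" and c: "norm c \<le> w K" for n c
    proof (rule perturb)
      have bn: "b n = 0" using n0 n by auto
      show "norm c \<le> 1" using c w_le_1[of K] by linarith
      fix S assume S: "finite S" "n \<in> S" "card S < K"
      then have "0 < card S" by (auto simp: card_gt_0_iff)
      then obtain k where k: "card S = Suc k" by (metis gr0_implies_Suc)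
      then have "(\<Sum>i\<in>S - {n}. norm (b i)) \<le> W k"
        using b S by (metis card_Diff_singleton diff_Suc_1 finite_Diff mult_1)
      moreover have "w K \<le> w k" using S(3) k by (intro w_dec) simp
      ultimately show "(\<Sum>i\<in>S - {n}. norm (b i)) + norm (b n) + norm c \<le> W (card S)"
        using bn c by (simp add: k W_Suc)
    qed
    then show ?thesis using w_pos[of K] by (intro exI[of _ "w K"] conjI exI[of _ n0]) simp_all
  next
    case False
    \<comment> \<open>\<open>T\<close> has more elements than any \<open>S\<close> with fewer than
      \<open>K\<close>, so some index of \<open>T\<close> is always available outside
      \<open>S\<close>.\<close>
    then obtain T where T: "finite T" "card T = Suc K" "T \<subseteq> {i. b i \<noteq> 0}"
      using infinite_arbitrarily_large by metis
    then have ne: "T \<noteq> {}" by auto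
    \<comment> \<open>One half is for the entry \<open>b n\<close>, small because n is far out, and
      the other for the perturbation \<open>c\<close>.\<close>
    define \<mu> where "\<mu> = Min ((\<lambda>i. norm (b i)) ` T) / 2"
    have \<mu>: "0 < \<mu>" using T ne by (auto simp: \<mu>_def)
    have T\<mu>: "2 * \<mu> \<le> norm (b i)" if "i \<in> T" for i using T that by (simp add: \<mu>_def)
    obtain n0 where n0: "\<And>n. n0 \<le> n \<Longrightarrow> norm (b n) < \<mu>"
      using LIMSEQ_D[OF dominated_tendsto_0[OF b] \<mu>] by auto
    have "dominated (\<lambda>i. b i + (if i = n then c else 0)) 1" if n: "n0 \<le> n" and c: "norm c \<le> min 1 \<mu>" for n c
    proof (rule perturb)
      show "norm c \<le> 1" using c by simp
      fix S assume S: "finite S" "n \<in> S" "card S < K"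
      have "\<not> T \<subseteq> S" using card_mono[OF S(1), of T] T(2) S(3) by auto
      then obtain p where p: "p \<in> T" "p \<notin> S" by blast
      have card: "card (insert p (S - {n})) = card S"
        using S p by (simp add: card_Suc_Diff1 del: card_Diff_insert)
      have "(\<Sum>i\<in>S - {n}. norm (b i)) + norm (b p) = (\<Sum>i\<in>insert p (S - {n}). norm (b i))"
        using S p by simp
      also have "\<dots> \<le> 1 * W (card (insert p (S - {n})))"
        using b[rule_format, of "insert p (S - {n})"] S by simp
      finally have "(\<Sum>i\<in>S - {n}. norm (b i)) + norm (b p) \<le> W (card S)" by (simp add: card)
      then show "(\<Sum>i\<in>S - {n}. norm (b i)) + norm (b n) + norm c \<le> W (card S)"
        using T\<mu>[OF p(1)] n0[OF n] c by simp
    qed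
    then show ?thesis using \<mu> by (intro exI[of _ "min 1 \<mu>"] conjI exI[of _ n0]) simp_all
  qed
qed

text \<open>Test \<open>z\<close> on the sum of the coordinate functionals over \<open>S\<close>
  with phases: its dual norm is at most \<open>W (card S)\<close>. Thus coordinates of bidual
  elements obey the same domination as elements of the space.\<close>

lemma bidual_sum_le:
  fixes z :: "((nat \<Rightarrow> 'k::real_normed_field) \<Rightarrow> 'k) \<Rightarrow> 'k"
  assumes z: "z \<in> vcarrier (bidual (d_predual w))" and S: "finite S"
  shows "(\<Sum>i\<in>S. norm (z (sequence_carrier.coord (d_predual w) i))) \<le> vnorm (bidual (d_predual w)) z * W (card S)"
proof -
  interpret sequence_carrier "d_predual w :: ('k, nat \<Rightarrow> 'k) nspace" by (rule sequence_carrier_d)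
  interpret D: normed_carrier "dual (d_predual w :: ('k, nat \<Rightarrow> 'k) nspace)" by (rule normed_carrier_dual)
  define p where "p i = of_real (norm (z (coord i))) / z (coord i)" for i
  define g where "g = (\<lambda>x. \<Sum>i\<in>S. p i * coord i x)"
  have g: "g \<in> vcarrier (dual (d_predual w))" unfolding g_def using S by (intro dual_sum coord_dual)
  have "vnorm (dual (d_predual w)) g \<le> W (card S)"
  proof (rule dual_norm_le)
    fix x :: "nat \<Rightarrow> 'k" assume "x \<in> unit_ball (d_predual w)"
    then have x: "x \<in> vcarrier (d_predual w)" "vnorm (d_predual w) x \<le> 1" by (auto simp: unit_ball_def)
    have "norm (g x) \<le> (\<Sum>i\<in>S. norm (p i * x i))"
      using norm_sum[of "\<lambda>i. p i * x i" S] x by (simp add: g_def coord_def)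
    also have "\<dots> \<le> (\<Sum>i\<in>S. norm (x i))"
      unfolding p_def norm_mult by (intro sum_mono mult_left_le_one_le norm_phase_le) auto
    also have "\<dots> \<le> W (card S)"
      using d_norm_bound[OF x(1) S] mult_right_mono[OF x(2) W_nonneg[of "card S"]] by linarith
    finally show "norm (g x) \<le> W (card S)" .
  qed
  from mult_left_mono[OF this D.dual_norm_nonneg[OF z]] D.dual_bound[OF z g]
  have le: "norm (z g) \<le> vnorm (bidual (d_predual w)) z * W (card S)" by linarith
  have "z g = (\<Sum>i\<in>S. p i * z (coord i))"
    unfolding g_def by (rule bidual_sum[OF z S coord_dual])
  also have "\<dots> = of_real (\<Sum>i\<in>S. norm (z (coord i)))"
    by (simp add: p_def phase_mult del: times_divide_eq_left)
  finally have "norm (z g) = (\<Sum>i\<in>S. norm (z (coord i)))"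
    by (simp add: sum_nonneg del: of_real_sum)
  with le show ?thesis by simp
qed

text \<open>Domination passes from \<open>a\<close> to its coordinates by
  \<open>bidual_sum_le\<close>, the perturbation happens there, and \<open>bidual_ballI\<close>
  brings the result back to the bidual.\<close>

lemma bidual_perturb:
  fixes a :: "((nat \<Rightarrow> 'k::real_normed_field) \<Rightarrow> 'k) \<Rightarrow> 'k"
  assumes a: "a \<in> unit_ball (bidual (d_predual w))" and x: "\<And>i. m \<le> i \<Longrightarrow> x i = 0"
    and near: "vnorm (bidual (d_predual w)) (a - canon (d_predual w) x) < 1"
  shows "\<exists>\<theta>>0. \<exists>n0. \<forall>n\<ge>n0. \<forall>c. norm c \<le> \<theta> \<longrightarrow>
    (\<lambda>f. a f + c * canon (d_predual w) (unit_seq n) f) \<in> unit_ball (bidual (d_predual w))"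
proof -
  interpret shrinking_carrier "d_predual w :: ('k, nat \<Rightarrow> 'k) nspace" by (rule shrinking_carrier_d)
  interpret D: normed_carrier "dual (d_predual w :: ('k, nat \<Rightarrow> 'k) nspace)" by (rule normed_carrier_dual)
  let ?\<beta> = "vnorm (bidual (d_predual w)) (a - canon (d_predual w) x)"
  have a': "a \<in> vcarrier (bidual (d_predual w))" "vnorm (bidual (d_predual w)) a \<le> 1"
    using a by (auto simp: unit_ball_def)
  have xd: "x \<in> vcarrier (d_predual w)" by (rule finite_support_in_d[OF x])
  have diff: "a - canon (d_predual w) x \<in> vcarrier (bidual (d_predual w))"
    using D.dual_lincomb[OF a'(1) canon_bidual[OF xd], of 1 "- 1"] by (simp add: fun_diff_def)
  define b where "b i = a (coord i)" for i
  have b: "dominated b 1"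
  proof (intro allI impI)
    fix S :: "nat set" assume "finite S"
    from bidual_sum_le[OF a'(1) this] mult_right_mono[OF a'(2) W_nonneg[of "card S"]]
    show "(\<Sum>i\<in>S. norm (b i)) \<le> 1 * W (card S)" unfolding b_def by linarith
  qed
  \<comment> \<open>\<open>x\<close> contributes at most its total sum to any finite set; the
    difference \<open>b - x\<close> contributes at most
    \<open>?\<beta> * W (card S)\<close>.\<close>
  define C where "C = (\<Sum>i<m. norm (x i))"
  have room: "(\<Sum>i\<in>S. norm (b i)) \<le> C + ?\<beta> * W (card S)" if S: "finite S" for S
  proof -
    have "(\<Sum>i\<in>S. norm (b i)) \<le> (\<Sum>i\<in>S. norm (x i) + norm (b i - x i))"
    proof (rule sum_mono)
      fix i show "norm (b i) \<le> norm (x i) + norm (b i - x i)"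
        using norm_triangle_ineq[of "x i" "b i - x i"] by simp
    qed
    also have "\<dots> = (\<Sum>i\<in>S. norm (x i)) + (\<Sum>i\<in>S. norm (b i - x i))" by (simp add: sum.distrib)
    also have "(\<Sum>i\<in>S. norm (x i)) \<le> C"
    proof -
      have "(\<Sum>i\<in>S. norm (x i)) = (\<Sum>i\<in>S \<inter> {..<m}. norm (x i))"
        using S x by (intro sum.mono_neutral_right) (auto simp: not_less)
      also have "\<dots> \<le> C" unfolding C_def by (intro sum_mono2) auto
      finally show ?thesis .
    qed
    also have "(\<Sum>i\<in>S. norm (b i - x i)) \<le> ?\<beta> * W (card S)"
      using bidual_sum_le[OF diff S] by (simp add: canon_def coord_dual b_def) (simp add: coord_def xd)
    finally show ?thesis by simp
  qed
  obtain \<theta> n0 where l: "0 < \<theta>" "\<And>n c. n0 \<le> n \<Longrightarrow> norm c \<le> \<theta> \<Longrightarrow> dominated (\<lambda>i. b i + (if i = n then c else 0)) 1"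
    using dominated_perturb[OF b room near] by blast
  show ?thesis
  proof (intro exI[of _ \<theta>] conjI l(1) exI[of _ n0] allI impI)
    fix n and c :: 'k assume nc: "n0 \<le> n" "norm c \<le> \<theta>"
    let ?p = "\<lambda>f. a f + c * canon (d_predual w) (unit_seq n) f"
    have p: "?p \<in> vcarrier (bidual (d_predual w))"
      using D.dual_lincomb[OF a'(1) canon_bidual[OF unit_in], of 1 c n] by simp
    have coord_p: "?p (coord i) = b i + (if i = n then c else 0)" for i
      using unit_in[of n] by (simp add: b_def canon_def coord_dual) (simp add: coord_def unit_seq_def)
    have "vnorm (bidual (d_predual w)) ?p \<le> 1"
    proof (rule bidual_ballI[OF p])
      fix k
      show "vnorm (d_predual w) (head k (\<lambda>i. ?p (coord i))) \<le> 1"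
        unfolding d_norm_le_iff[OF head_in]
      proof (intro allI impI)
        fix S :: "nat set" assume S: "finite S"
        have "(\<Sum>i\<in>S. norm (head k (\<lambda>i. ?p (coord i)) i)) \<le> (\<Sum>i\<in>S. norm (b i + (if i = n then c else 0)))"
          by (intro sum_mono) (simp add: head_def coord_p)
        also have "\<dots> \<le> 1 * W (card S)" using l(2)[OF nc] S by blast
        finally show "(\<Sum>i\<in>S. norm (head k (\<lambda>i. ?p (coord i)) i)) \<le> 1 * W (card S)" .
      qed
    qed
    then show "?p \<in> unit_ball (bidual (d_predual w))" using p by (simp add: unit_ball_def)
  qed
qed

section \<open>Power sums\<close>

text \<open>Write b^p as b v with v = b^(p-1). Majorization replaces b by w against a permuted v,
  and Young's inequality splits the products into p-th powers of w and of b.\<close>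

lemma power_sum_le:
  fixes b :: "nat \<Rightarrow> real"
  assumes nn: "\<And>i. 0 \<le> b i" and dom: "\<And>S. finite S \<Longrightarrow> (\<Sum>i\<in>S. b i) \<le> W (card S)" and p: "1 < p"
  shows "(\<Sum>i<m. b i powr p) \<le> (\<Sum>i<m. w i powr p)"
proof -
  define q where "q = p / (p - 1)"
  have q: "1 < q" "1 / p + 1 / q = 1" "(p - 1) * q = p" using p by (auto simp: q_def field_simps)
  define v where "v i = b i powr (p - 1)" for i
  obtain \<sigma> where \<sigma>: "bij_betw \<sigma> {..<m} {..<m}" "(\<Sum>i<m. b i * v i) \<le> (\<Sum>i<m. w i * v (\<sigma> i))"
    using decreasing_enumeration_sum[of "{..<m}" b 1 v] dom finite_subset[of _ "{..<m}"]
    by (auto simp: v_def)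
  have bv: "b i * v i = b i powr p" for i
    using powr_mult_base[OF nn[of i], of "p - 1"] by (simp add: v_def)
  have vq: "v i powr q = b i powr p" for i by (simp add: v_def powr_powr q(3))
  have "(\<Sum>i<m. b i powr p) \<le> (\<Sum>i<m. w i * v (\<sigma> i))" using \<sigma>(2) by (simp add: bv)
  also have "\<dots> \<le> (\<Sum>i<m. w i powr p / p + v (\<sigma> i) powr q / q)"
    using Youngs_inequality[OF p q(1,2)] w_nonneg by (intro sum_mono) (simp add: v_def)
  also have "\<dots> = (\<Sum>i<m. w i powr p) / p + (\<Sum>i<m. b (\<sigma> i) powr p) / q"
    by (simp add: vq sum.distrib sum_divide_distrib)
  \<comment> \<open>\<sigma> permutes the initial segment, so this term is 1/q of the left side and
    can be absorbed there.\<close>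
  also have "(\<Sum>i<m. b (\<sigma> i) powr p) = (\<Sum>i<m. b i powr p)"
    by (rule sum.reindex_bij_betw[OF \<sigma>(1)])
  finally have "(\<Sum>i<m. b i powr p) * (1 - 1 / q) \<le> (\<Sum>i<m. w i powr p) / p" by (simp add: algebra_simps)
  moreover have "1 - 1 / q = 1 / p" using q(2) by linarith
  ultimately show ?thesis using p by (simp add: divide_le_cancel)
qed

text \<open>The inequality of arithmetic and geometric means reduces the product to single sequences
  with exponent \<open>N * q\<close>. The scalar case takes \<open>q = 1\<close>, the
  sequence-valued one \<open>q = r\<close>.\<close>

lemma power_prod_sum_le:
  fixes b :: "nat \<Rightarrow> nat \<Rightarrow> real"
  assumes nn: "\<And>j i. j < N \<Longrightarrow> 0 \<le> b j i"
    and dom: "\<And>j S. j < N \<Longrightarrow> finite S \<Longrightarrow> (\<Sum>i\<in>S. b j i) \<le> W (card S)"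
    and N: "0 < N" and q: "0 < q" "1 < real N * q"
  shows "(\<Sum>i<m. (\<Prod>j<N. b j i) powr q) \<le> (\<Sum>i<m. w i powr (real N * q))"
proof -
  have amgm: "(\<Prod>j<N. b j i) powr q \<le> (\<Sum>j<N. b j i powr (real N * q)) / real N" for i
  proof -
    have "(\<Prod>j<N. b j i powr (real N * q)) powr (1 / real N) \<le> (\<Sum>j<N. b j i powr (real N * q) / real N)"
      using arith_geom_mean[of "{..<N}" "\<lambda>j. b j i powr (real N * q)"] N by auto
    then show ?thesis
      using N by (simp add: prod_powr_distrib[symmetric] powr_powr sum_divide_distrib)
  qed
  have "(\<Sum>i<m. (\<Prod>j<N. b j i) powr q) \<le> (\<Sum>i<m. (\<Sum>j<N. b j i powr (real N * q)) / real N)"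
    by (intro sum_mono amgm)
  also have "\<dots> = (\<Sum>j<N. \<Sum>i<m. b j i powr (real N * q)) / real N"
    unfolding sum_divide_distrib[symmetric] by (subst sum.swap) simp
  also have "\<dots> \<le> (\<Sum>j<N. \<Sum>i<m. w i powr (real N * q)) / real N"
  proof (rule divide_right_mono[OF sum_mono])
    fix j assume "j \<in> {..<N}"
    then show "(\<Sum>i<m. b j i powr (real N * q)) \<le> (\<Sum>i<m. w i powr (real N * q))"
      using nn dom q(2) by (intro power_sum_le) auto
  qed simp
  finally show ?thesis using N by simp
qed

end

section \<open>The target spaces\<close>

text \<open>With A the left side, A/u - 1 = (r - 1)(1 - 1/u). Adding ln t \<le> t - 1 at t = A/u and
  r - 1 times its strict form at t = 1/u makes the right sides cancel, leaving ln A < r ln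
  u.\<close>

lemma powr_Bernoulli_strict:
  fixes u :: real
  assumes r: "1 < r" and u: "0 \<le> u" "u \<noteq> 1"
  shows "1 + r * (u - 1) < u powr r"
proof (cases "u = 0 \<or> 1 + r * (u - 1) \<le> 0")
  case True
  then show ?thesis using r u by (cases "u = 0") (auto intro: le_less_trans)
next
  case False
  define A where "A = 1 + r * (u - 1)"
  have A: "0 < A" "0 < u" using False u by (auto simp: A_def)
  have "ln (A / u) \<le> A / u - 1" using A by (intro ln_le_minus_one) simp
  moreover have "ln (1 / u) < 1 / u - 1"
    using ln_le_minus_one[of "1 / u"] ln_eq_minus_one[of "1 / u"] A u by fastforce
  then have "(r - 1) * ln (1 / u) < (r - 1) * (1 / u - 1)" using r by simp
  ultimately have "ln (A / u) + (r - 1) * ln (1 / u) < (A / u - 1) + (r - 1) * (1 / u - 1)" by simp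
  also have "\<dots> = 0" using A by (simp add: A_def field_simps)
  finally have "ln A < r * ln u" using A by (simp add: ln_div algebra_simps)
  then have "A < exp (r * ln u)" using A by (metis exp_less_cancel_iff exp_ln)
  then show ?thesis using A by (simp add: powr_def A_def)
qed

text \<open>Bernoulli's inequality at s/m and t/m, where m is the midpoint: the linear terms cancel
  in the sum.\<close>

lemma powr_midpoint_strict:
  fixes s t :: real
  assumes r: "1 < r" and st: "0 \<le> s" "0 \<le> t" "s \<noteq> t"
  shows "((s + t) / 2) powr r < (s powr r + t powr r) / 2"
proof -
  define m where "m = (s + t) / 2"
  have m: "0 < m" using st by (auto simp: m_def)
  have "s / m \<noteq> 1" "t / m \<noteq> 1" using st m by (auto simp: m_def)
  then have "1 + r * (s / m - 1) < (s / m) powr r" "1 + r * (t / m - 1) < (t / m) powr r"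
    using st m by (auto intro!: powr_Bernoulli_strict[OF r])
  moreover have "(1 + r * (s / m - 1)) + (1 + r * (t / m - 1)) = 2"
  proof -
    have st2: "s + t = 2 * m" by (simp add: m_def)
    have "(1 + r * (s / m - 1)) + (1 + r * (t / m - 1)) = 2 + r * ((s + t) / m - 2)"
      by (simp add: algebra_simps add_divide_distrib)
    then show ?thesis using m by (simp add: st2)
  qed
  ultimately have "2 < (s / m) powr r + (t / m) powr r" by linarith
  then have "2 * m powr r < s powr r + t powr r"
    using m st by (simp add: powr_divide field_simps)
  then show ?thesis by (simp add: m_def)
qed

text \<open>Different moduli gain from strict convexity of the power, equal moduli from the strict
  triangle inequality of an inner product. The sort covers real and complex scalars at once.\<close>

lemma norm_midpoint_strict:
  fixes x y :: "'k::{real_normed_field, real_inner}"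
  assumes r: "1 < r" and xy: "x \<noteq> y"
  shows "norm ((x + y) / 2) powr r < (norm x powr r + norm y powr r) / 2"
proof -
  have h: "norm ((x + y) / 2) = norm (x + y) / 2" by (simp add: norm_divide)
  have le: "norm (x + y) / 2 \<le> (norm x + norm y) / 2" by (simp add: norm_triangle_ineq)
  show ?thesis
  proof (cases "norm x = norm y")
    case False
    have "norm ((x + y) / 2) powr r \<le> ((norm x + norm y) / 2) powr r"
      unfolding h using le r by (intro powr_mono2) auto
    also have "\<dots> < (norm x powr r + norm y powr r) / 2"
      using False by (intro powr_midpoint_strict[OF r]) auto
    finally show ?thesis .
  next
    case True
    have "norm (x + y) \<noteq> norm x + norm y"
    proof
      assume "norm (x + y) = norm x + norm y"
      then have "norm x *\<^sub>R y = norm y *\<^sub>R x" using norm_triangle_eq[of x y] by simp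
      then show False using True xy by (cases "norm x = 0") auto
    qed
    then have "norm (x + y) / 2 < norm x" using le True by simp
    then have "(norm (x + y) / 2) powr r < norm x powr r" using r by (intro powr_less_mono2) auto
    then show ?thesis unfolding h using True by simp
  qed
qed

lemma norm_midpoint_le:
  fixes x y :: "'k::real_normed_field"
  assumes r: "1 < r"
  shows "norm ((x + y) / 2) powr r \<le> (norm x powr r + norm y powr r) / 2"
proof -
  have "norm ((x + y) / 2) \<le> (norm x + norm y) / 2" by (simp add: norm_divide norm_triangle_ineq)
  then have "norm ((x + y) / 2) powr r \<le> ((norm x + norm y) / 2) powr r"
    using r by (intro powr_mono2) auto
  also have "\<dots> \<le> (norm x powr r + norm y powr r) / 2"
    using powr_midpoint_strict[OF r, of "norm x" "norm y"] by (cases "norm x = norm y") auto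
  finally show ?thesis .
qed

text \<open>The factor comes from writing the sum as twice the midpoint. This crude bound gives
  closure of \<open>ell r\<close> under addition and \<open>ell_norm_diff_le\<close>.\<close>

lemma norm_add_powr_le:
  fixes x y :: "'k::real_normed_field"
  assumes r: "1 < r"
  shows "norm (x + y) powr r \<le> 2 powr r * (norm x powr r + norm y powr r)"
proof -
  have "norm (x + y) powr r = 2 powr r * norm ((x + y) / 2) powr r"
    by (simp add: norm_divide powr_divide)
  also have "\<dots> \<le> 2 powr r * ((norm x powr r + norm y powr r) / 2)"
    by (intro mult_left_mono norm_midpoint_le r) simp
  also have "\<dots> \<le> 2 powr r * (norm x powr r + norm y powr r)" by (intro mult_left_mono) auto
  finally show ?thesis .
qed

section \<open>The sequence space with exponent r\<close>

locale ell_exponent =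
  fixes r :: real
  assumes r: "1 < r"
begin

lemma ell_iff: "x \<in> vcarrier (ell r) \<longleftrightarrow> summable (\<lambda>i. norm (x i) powr r)"
  and vscale_ell [simp]: "vscale (ell r) c x = (\<lambda>i. c * x i)"
  and vnorm_ell: "vnorm (ell r) x = (\<Sum>i. norm (x i) powr r) powr (1 / r)"
  by (simp_all add: ell_def)

lemma root_le_iff: "0 \<le> s \<Longrightarrow> 0 \<le> C \<Longrightarrow> s powr (1 / r) \<le> C \<longleftrightarrow> s \<le> C powr r"
proof
  assume "0 \<le> s" "0 \<le> C" "s powr (1 / r) \<le> C"
  then have "(s powr (1 / r)) powr r \<le> C powr r" using r by (intro powr_mono2) auto
  then show "s \<le> C powr r" using r \<open>0 \<le> s\<close> by (simp add: powr_powr)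
next
  assume "0 \<le> s" "0 \<le> C" "s \<le> C powr r"
  then have "s powr (1 / r) \<le> (C powr r) powr (1 / r)" using r by (intro powr_mono2) auto
  then show "s powr (1 / r) \<le> C" using r \<open>0 \<le> C\<close> by (simp add: powr_powr)
qed

lemma ell_norm_le_iff:
  assumes "x \<in> vcarrier (ell r)" "0 \<le> C"
  shows "vnorm (ell r) x \<le> C \<longleftrightarrow> (\<Sum>i. norm (x i) powr r) \<le> C powr r"
  using root_le_iff[OF suminf_nonneg assms(2)] assms(1) by (simp add: vnorm_ell ell_iff)

lemma normed_carrier_ell: "normed_carrier (ell r :: ('k::real_normed_field, nat \<Rightarrow> 'k) nspace)"
proof
  have "(\<lambda>_. 0 :: 'k) \<in> vcarrier (ell r)" by (simp add: ell_iff)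
  then show "vcarrier (ell r :: ('k, nat \<Rightarrow> 'k) nspace) \<noteq> {}" by blast
next
  fix x y :: "nat \<Rightarrow> 'k" assume "x \<in> vcarrier (ell r)" "y \<in> vcarrier (ell r)"
  then have "summable (\<lambda>i. 2 powr r * (norm (x i) powr r + norm (y i) powr r))"
    unfolding ell_iff by (intro summable_mult summable_add)
  then show "x + y \<in> vcarrier (ell r)"
    unfolding ell_iff by (rule summable_comparison_test'[where N = 0]) (simp add: norm_add_powr_le[OF r])
next
  fix x :: "nat \<Rightarrow> 'k" and c :: 'k assume x: "x \<in> vcarrier (ell r)"
  have eq: "norm (c * x i) powr r = norm c powr r * norm (x i) powr r" for i
    by (simp add: norm_mult powr_mult)
  show "vscale (ell r) c x \<in> vcarrier (ell r)" using x by (simp add: ell_iff eq summable_mult)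
  show "0 \<le> vnorm (ell r) x" by (simp add: vnorm_ell)
  have "0 \<le> (\<Sum>i. norm (x i) powr r)" using x by (intro suminf_nonneg) (auto simp: ell_iff)
  then show "vnorm (ell r) (vscale (ell r) c x) = norm c * vnorm (ell r) x"
    using x r by (simp add: vnorm_ell eq suminf_mult ell_iff powr_mult powr_powr)
qed

lemma ell_coord_le:
  fixes x :: "nat \<Rightarrow> 'k::real_normed_field"
  assumes x: "x \<in> vcarrier (ell r)"
  shows "norm (x i) \<le> vnorm (ell r) x"
proof -
  have "norm (x i) powr r \<le> (\<Sum>i. norm (x i) powr r)"
    using sum_le_suminf[of "\<lambda>i. norm (x i) powr r" "{i}"] x by (simp add: ell_iff)
  then have "(norm (x i) powr r) powr (1 / r) \<le> vnorm (ell r) x"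
    unfolding vnorm_ell using r by (intro powr_mono2) auto
  then show ?thesis using r by (simp add: powr_powr)
qed

text \<open>One factor 2 comes from \<open>norm_add_powr_le\<close>, the other from bounding both
  power sums by the r-th power of the sum of the norms. Its purpose is to bound the difference of
  two multilinear maps, for which any constant will do.\<close>

lemma ell_norm_diff_le:
  fixes x y :: "nat \<Rightarrow> 'k::real_normed_field"
  assumes x: "x \<in> vcarrier (ell r)" and y: "y \<in> vcarrier (ell r)"
  shows "vnorm (ell r) (x - y) \<le> 4 * (vnorm (ell r) x + vnorm (ell r) y)"
proof -
  interpret normed_carrier "ell r :: ('k, nat \<Rightarrow> 'k) nspace" by (rule normed_carrier_ell)
  define C where "C = vnorm (ell r) x + vnorm (ell r) y"
  have nn: "0 \<le> vnorm (ell r) x" "0 \<le> vnorm (ell r) y" using norm_nonneg x y by auto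
  then have C: "0 \<le> C" by (simp add: C_def)
  have X: "(\<Sum>i. norm (x i) powr r) \<le> C powr r" and Y: "(\<Sum>i. norm (y i) powr r) \<le> C powr r"
    using ell_norm_le_iff[OF x C] ell_norm_le_iff[OF y C] nn by (auto simp: C_def)
  have sx: "summable (\<lambda>i. norm (x i) powr r)" and sy: "summable (\<lambda>i. norm (y i) powr r)"
    using x y by (auto simp: ell_iff)
  have "x - y = x + vscale (ell r) (- 1) y" by (auto simp: fun_eq_iff)
  then have d: "x - y \<in> vcarrier (ell r)" using x y by (simp only: add_closed scale_closed)
  have le: "norm ((x - y) i) powr r \<le> 2 powr r * (norm (x i) powr r + norm (y i) powr r)" for i
    using norm_add_powr_le[OF r, of "x i" "- y i"] by simp
  have "(\<Sum>i. norm ((x - y) i) powr r) \<le> (\<Sum>i. 2 powr r * (norm (x i) powr r + norm (y i) powr r))"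
    using d sx sy by (intro suminf_le le summable_mult summable_add) (auto simp: ell_iff)
  also have "\<dots> = 2 powr r * ((\<Sum>i. norm (x i) powr r) + (\<Sum>i. norm (y i) powr r))"
    using sx sy by (simp add: suminf_mult suminf_add summable_add)
  also have "\<dots> \<le> 2 powr r * (2 powr r * C powr r)"
  proof -
    have "2 * C powr r \<le> 2 powr r * C powr r"
      using powr_mono[of 1 r "2 :: real"] r by (intro mult_right_mono) auto
    then show ?thesis using X Y by (intro mult_left_mono) auto
  qed
  also have "\<dots> = (4 * C) powr r"
    using C powr_mult[of 2 2 r] by (simp add: powr_mult)
  finally show ?thesis using ell_norm_le_iff[OF d, of "4 * C"] C by (simp add: C_def)
qed

lemma ell_tail_tendsto_0:
  fixes x :: "nat \<Rightarrow> 'k::real_normed_field"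
  assumes x: "x \<in> vcarrier (ell r)"
  shows "(\<lambda>k. vnorm (ell r) (tail k x)) \<longlonglongrightarrow> 0"
proof -
  let ?f = "\<lambda>i. norm (x i) powr r"
  have s: "summable ?f" using x by (simp add: ell_iff)
  have sums: "(\<lambda>i. norm (tail k x i) powr r) sums (suminf ?f - (\<Sum>i<k. ?f i))" for k
  proof -
    have "(\<lambda>i. if i \<in> {..<k} then 0 else ?f i) sums (suminf ?f - (\<Sum>i<k. ?f i))"
      by (rule sums_If_finite_set'[OF summable_sums[OF s]]) (auto simp: sum_negf)
    also have "(\<lambda>i. if i \<in> {..<k} then 0 else ?f i) = (\<lambda>i. norm (tail k x i) powr r)"
      by (auto simp: tail_def)
    finally show ?thesis .
  qed
  have eq: "vnorm (ell r) (tail k x) = (suminf ?f - (\<Sum>i<k. ?f i)) powr (1 / r)" for k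
    unfolding vnorm_ell sums_unique[OF sums[of k], symmetric] ..
  have "(\<lambda>k. suminf ?f - (\<Sum>i<k. ?f i)) \<longlonglongrightarrow> suminf ?f - suminf ?f"
    by (intro tendsto_diff tendsto_const summable_LIMSEQ s)
  then have "(\<lambda>k. suminf ?f - (\<Sum>i<k. ?f i)) \<longlonglongrightarrow> 0" by simp
  moreover have "0 \<le> suminf ?f - (\<Sum>i<k. ?f i)" for k
    using sum_le_suminf[OF s, of "{..<k}"] by simp
  ultimately show ?thesis unfolding eq using r
    by (intro tendsto_zero_powrI[where b = "1 / r"] tendsto_const always_eventually allI) auto
qed

lemma sequence_carrier_ell: "sequence_carrier (ell r :: ('k::real_normed_field, nat \<Rightarrow> 'k) nspace)"
proof (intro sequence_carrier.intro sequence_carrier_axioms.intro normed_carrier_ell)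
  fix i
  show "(unit_seq i :: nat \<Rightarrow> 'k) \<in> vcarrier (ell r)"
    unfolding ell_iff by (rule summable_finite[of "{i}"]) (auto simp: unit_seq_def)
  show "\<exists>C. \<forall>x\<in>vcarrier (ell r :: ('k, nat \<Rightarrow> 'k) nspace). norm (x i) \<le> C * vnorm (ell r) x"
    using ell_coord_le by (intro exI[of _ 1]) auto
qed simp

text \<open>
  If \<open>f\<close> nearly attains its norm at a finitely supported \<open>u\<close> and \<open>v\<close> is supported beyond \<open>u\<close>, then
  \<open>\<parallel>u + t v\<parallel> \<le> 1 + t powr r\<close> forces \<open>t \<bar>f v\<bar> \<le> \<delta> + \<parallel>f\<parallel> t powr r\<close>, and \<open>r > 1\<close>.
\<close>

lemma shrinking_carrier_ell: "shrinking_carrier (ell r :: ('k::real_normed_field, nat \<Rightarrow> 'k) nspace)"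
proof (intro shrinking_carrier.intro sequence_carrier_ell shrinking_carrier_axioms.intro)
  interpret sequence_carrier "ell r :: ('k, nat \<Rightarrow> 'k) nspace" by (rule sequence_carrier_ell)
  fix f :: "(nat \<Rightarrow> 'k) \<Rightarrow> 'k" and \<epsilon> :: real
  assume f: "f \<in> vcarrier (dual (ell r))" and \<epsilon>: "0 < \<epsilon>"
  define A where "A = vnorm (dual (ell r)) f"
  have A: "0 \<le> A" unfolding A_def by (rule dual_norm_nonneg[OF f])
  \<comment> \<open>Chosen so that \<open>A * t powr (r - 1)\<close> is at most half of \<epsilon>;
    the other half is left to \<delta>, which is t \<epsilon> / 2.\<close>
  define t where "t = (\<epsilon> / 2 / (A + 1)) powr (1 / (r - 1))"
  have t: "0 < t" using \<epsilon> A by (simp add: t_def)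
  have "A * t powr (r - 1) = A / (A + 1) * (\<epsilon> / 2)" using \<epsilon> A r by (simp add: t_def powr_powr)
  also have "\<dots> \<le> 1 * (\<epsilon> / 2)" using A \<epsilon> by (intro mult_right_mono) auto
  finally have At: "A * t powr (r - 1) \<le> \<epsilon> / 2" by simp
  define \<delta> where "\<delta> = t * \<epsilon> / 2"
  have \<delta>: "0 < \<delta>" using t \<epsilon> by (simp add: \<delta>_def)
  have "\<exists>u\<in>unit_ball (ell r). A - \<delta> < norm (f u)"
    using less_cSUP_iff[OF ball_nonempty dual_bdd[OF f], of "A - \<delta>"] \<delta> by (simp add: A_def dual_sel(2))
  then obtain u where u: "u \<in> vcarrier (ell r)" "vnorm (ell r) u \<le> 1" "A - \<delta> < norm (f u)"
    by (auto simp: unit_ball_def)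
  \<comment> \<open>Since tails tend to zero, \<open>u\<close> can be cut to a finite section
    without losing near-attainment.\<close>
  have "(\<lambda>k. vnorm (dual (ell r)) f * vnorm (ell r) (tail k u)) \<longlonglongrightarrow> 0"
    using tendsto_mult[OF tendsto_const ell_tail_tendsto_0[OF u(1)], of "vnorm (dual (ell r)) f"] by simp
  then obtain k where "vnorm (dual (ell r)) f * vnorm (ell r) (tail k u) < norm (f u) - (A - \<delta>)"
    using order_tendstoD(2)[of _ 0 sequentially "norm (f u) - (A - \<delta>)"] u(3)
    by (force simp: eventually_sequentially)
  then have k: "A - \<delta> < norm (f (head k u))"
    using dual_bound[OF f tail_in[OF u(1)], of k] dual_split[OF f u(1), of k]
      norm_triangle_ineq[of "f (head k u)" "f (tail k u)"] by simp
  have ball: "norm (f (tail n x)) \<le> \<epsilon>" if n: "k \<le> n" and x: "x \<in> unit_ball (ell r)" for n and x :: "nat \<Rightarrow> 'k"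
  proof -
    have x': "x \<in> vcarrier (ell r)" "vnorm (ell r) x \<le> 1" using x by (auto simp: unit_ball_def)
    let ?a = "f (head k u)" and ?b = "f (tail n x)"
    \<comment> \<open>\<open>q\<close> is the phase of \<open>?a\<close>, and \<open>p\<close> turns
      \<open>?b\<close> into the same direction, so that the moduli add up in
      \<open>f y\<close>.\<close>
    define q where "q = (if ?a = 0 then 1 else ?a / of_real (norm ?a))"
    have q: "norm q = 1" "?a = q * of_real (norm ?a)" by (auto simp: q_def norm_divide)
    define p where "p = q * (of_real (norm ?b) / ?b)"
    have p: "norm p \<le> 1" "p * ?b = q * of_real (norm ?b)"
      unfolding p_def using norm_phase_le[of ?b] phase_mult[of ?b] by (simp_all only: norm_mult q(1) mult.assoc mult_1)
    let ?c = "of_real t * p"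
    define y where "y = head k u + vscale (ell r) ?c (tail n x)"
    have y: "y \<in> vcarrier (ell r)"
      unfolding y_def by (intro add_closed scale_closed head_in tail_in x'(1))
    have "f y = ?a + of_real t * (p * ?b)"
      unfolding y_def using dual_add[OF f head_in scale_closed[OF tail_in[OF x'(1)]]] dual_scale[OF f tail_in[OF x'(1)]]
      by (simp only: mult.assoc)
    also have "\<dots> = q * of_real (norm ?a + t * norm ?b)"
      by (subst q(2)) (simp add: p(2) algebra_simps)
    finally have "norm (f y) = norm (of_real (norm ?a + t * norm ?b) :: 'k)" by (simp only: norm_mult q(1) mult_1)
    then have fy: "norm (f y) = norm ?a + t * norm ?b" using t by (simp del: of_real_add of_real_mult)
    have le: "norm (y i) powr r \<le> norm (u i) powr r + t powr r * norm (x i) powr r" for i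
    proof -
      have "norm (?c * x i) \<le> t * norm (x i)"
        using t mult_right_mono[OF p(1), of "t * norm (x i)"] by (simp add: norm_mult mult_ac)
      then have "norm (?c * x i) powr r \<le> (t * norm (x i)) powr r" using r by (intro powr_mono2) auto
      then show ?thesis using n t by (auto simp: y_def head_def tail_def powr_mult intro: add_increasing)
    qed
    have su: "summable (\<lambda>i. norm (u i) powr r)" and sx: "summable (\<lambda>i. norm (x i) powr r)"
      using u x' by (auto simp: ell_iff)
    have "(\<Sum>i. norm (y i) powr r) \<le> (\<Sum>i. norm (u i) powr r + t powr r * norm (x i) powr r)"
      using y su sx by (intro suminf_le le summable_add summable_mult) (auto simp: ell_iff)
    also have "\<dots> = (\<Sum>i. norm (u i) powr r) + t powr r * (\<Sum>i. norm (x i) powr r)"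
      using su sx by (simp add: suminf_add[symmetric] suminf_mult summable_mult)
    also have "\<dots> \<le> 1 + t powr r * 1"
      using ell_norm_le_iff[OF u(1), of 1] ell_norm_le_iff[OF x'(1), of 1] u(2) x'(2)
      by (intro add_mono mult_left_mono) auto
    \<comment> \<open>A base at least one raised to a power above one: this avoids computing the
      r-th root.\<close>
    also have "\<dots> \<le> (1 + t powr r) powr r"
      using powr_mono[of 1 r "1 + t powr r"] r by simp
    finally have "vnorm (ell r) y \<le> 1 + t powr r" using ell_norm_le_iff[OF y, of "1 + t powr r"] by simp
    then have "A * vnorm (ell r) y \<le> A * (1 + t powr r)" using A by (rule mult_left_mono)
    then have "norm (f y) \<le> A * (1 + t powr r)" using dual_bound[OF f y] by (simp add: A_def)
    then have "t * norm ?b \<le> \<delta> + A * t powr r" using fy k by (simp add: algebra_simps)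
    also have "A * t powr r = t * (A * t powr (r - 1))"
      using powr_mult_base[of t "r - 1"] t by (simp add: mult_ac)
    also have "\<dots> \<le> t * (\<epsilon> / 2)" using At t by (intro mult_left_mono) auto
    finally have "t * norm ?b \<le> t * \<epsilon>" by (simp add: \<delta>_def mult.commute)
    then show ?thesis using t by simp
  qed
  show "\<exists>m. \<forall>n\<ge>m. \<forall>x\<in>vcarrier (ell r). norm (f (tail n x)) \<le> \<epsilon> * vnorm (ell r) x"
  proof (intro exI[of _ k] allI impI ballI)
    fix n x assume n: "k \<le> n" and x: "x \<in> vcarrier (ell r :: ('k, nat \<Rightarrow> 'k) nspace)"
    show "norm (f (tail n x)) \<le> \<epsilon> * vnorm (ell r) x"
    proof (cases "vnorm (ell r) x = 0")
      case True
      \<comment> \<open>Here definiteness of the norm is needed, since \<open>x\<close> cannot be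
        normalized.\<close>
      have "x i = 0" for i using ell_coord_le[OF x, of i] True by simp
      then have "tail n x = head 0 x" by (auto simp: head_def tail_def)
      then show ?thesis using True by (simp add: dual_head[OF f])
    next
      case False
      let ?c = "of_real (1 / vnorm (ell r) x) :: 'k"
      have pos: "0 < vnorm (ell r) x" using False norm_nonneg[OF x] by simp
      have "vscale (ell r) ?c x \<in> unit_ball (ell r)"
        using pos unfolding unit_ball_def mem_Collect_eq norm_scale[OF x] by (simp add: scale_closed[OF x] norm_divide del: vscale_ell)
      from ball[OF n this] have "norm (f (tail n (vscale (ell r) ?c x))) \<le> \<epsilon>" .
      also have "tail n (vscale (ell r) ?c x) = vscale (ell r) ?c (tail n x)" by (auto simp: tail_def)
      finally have "norm (?c * f (tail n x)) \<le> \<epsilon>" by (simp only: dual_scale[OF f tail_in[OF x]])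
      then show ?thesis using pos by (simp add: norm_mult norm_divide field_simps)
    qed
  qed
qed

text \<open>Test \<open>z\<close> on the functional with coefficients of modulus |z_i|^(r-1) and
  aligned phases. Its value is the power sum s, and Young's inequality bounds its dual norm by 1/r +
  s/q, whence s \<le> 1.\<close>

lemma bidual_ell_sum_le:
  fixes z :: "((nat \<Rightarrow> 'k::real_normed_field) \<Rightarrow> 'k) \<Rightarrow> 'k"
  assumes z: "z \<in> unit_ball (bidual (ell r))"
  shows "(\<Sum>i<n. norm (z (sequence_carrier.coord (ell r) i)) powr r) \<le> 1"
proof -
  interpret sequence_carrier "ell r :: ('k, nat \<Rightarrow> 'k) nspace" by (rule sequence_carrier_ell)
  interpret D: normed_carrier "dual (ell r :: ('k, nat \<Rightarrow> 'k) nspace)" by (rule normed_carrier_dual)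
  have z': "z \<in> vcarrier (bidual (ell r))" "vnorm (bidual (ell r)) z \<le> 1" using z by (auto simp: unit_ball_def)
  define s where "s = (\<Sum>i<n. norm (z (coord i)) powr r)"
  define q where "q = r / (r - 1)"
  have q: "1 < q" "1 / r + 1 / q = 1" "(r - 1) * q = r" using r by (auto simp: q_def field_simps)
  define p where "p i = of_real (norm (z (coord i)) powr (r - 1)) * (of_real (norm (z (coord i))) / z (coord i))" for i
  define g where "g = (\<lambda>x. \<Sum>i<n. p i * coord i x)"
  have g: "g \<in> vcarrier (dual (ell r))" unfolding g_def by (intro dual_sum coord_dual) simp
  have np: "norm (p i) \<le> norm (z (coord i)) powr (r - 1)" for i
    using mult_left_mono[OF norm_phase_le[of "z (coord i)"], of "norm (z (coord i)) powr (r - 1)"]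
    by (simp add: p_def norm_mult del: times_divide_eq_right)
  have "vnorm (dual (ell r)) g \<le> 1 / r + s / q"
  proof (rule dual_norm_le)
    fix x :: "nat \<Rightarrow> 'k" assume "x \<in> unit_ball (ell r)"
    then have x: "x \<in> vcarrier (ell r)" "vnorm (ell r) x \<le> 1" by (auto simp: unit_ball_def)
    have sx: "summable (\<lambda>i. norm (x i) powr r)" using x by (simp add: ell_iff)
    have "norm (g x) \<le> (\<Sum>i<n. norm (p i * x i))"
      using norm_sum[of "\<lambda>i. p i * x i" "{..<n}"] x by (simp add: g_def coord_def)
    also have "\<dots> \<le> (\<Sum>i<n. norm (x i) powr r / r + norm (z (coord i)) powr r / q)"
    proof (rule sum_mono)
      fix i
      have "norm (p i * x i) \<le> norm (x i) * norm (z (coord i)) powr (r - 1)"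
        using mult_left_mono[OF np norm_ge_zero[of "x i"], of i] by (simp add: norm_mult mult.commute)
      also have "\<dots> \<le> norm (x i) powr r / r + (norm (z (coord i)) powr (r - 1)) powr q / q"
        by (rule Youngs_inequality[OF r q(1,2)]) auto
      finally show "norm (p i * x i) \<le> norm (x i) powr r / r + norm (z (coord i)) powr r / q"
        by (simp add: powr_powr q(3))
    qed
    also have "\<dots> = (\<Sum>i<n. norm (x i) powr r) / r + s / q"
      by (simp add: sum.distrib sum_divide_distrib s_def)
    also have "(\<Sum>i<n. norm (x i) powr r) \<le> 1"
      using sum_le_suminf[OF sx, of "{..<n}"] ell_norm_le_iff[OF x(1), of 1] x(2) by simp
    finally show "norm (g x) \<le> 1 / r + s / q" using r by (simp add: divide_right_mono)
  qed
  then have le: "norm (z g) \<le> 1 / r + s / q"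
    using D.dual_bound[OF z'(1) g] mult_right_mono[OF z'(2) dual_norm_nonneg[OF g]] by linarith
  have "z g = (\<Sum>i<n. p i * z (coord i))"
    unfolding g_def by (rule bidual_sum[OF z'(1) _ coord_dual]) simp
  also have "\<dots> = (\<Sum>i<n. of_real (norm (z (coord i)) powr r))"
  proof (rule sum.cong[OF refl])
    fix i
    have "p i * z (coord i) = of_real (norm (z (coord i)) powr (r - 1)) * of_real (norm (z (coord i)))"
      unfolding p_def by (simp only: mult.assoc phase_mult)
    also have "\<dots> = of_real (norm (z (coord i)) powr r)"
      using powr_mult_base[of "norm (z (coord i))" "r - 1"] by (simp only: of_real_mult[symmetric] mult.commute) simp
    finally show "p i * z (coord i) = of_real (norm (z (coord i)) powr r)" .
  qed
  also have "\<dots> = of_real s" by (simp add: s_def)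
  finally have "norm (z g) = s" by (simp add: s_def sum_nonneg del: of_real_sum)
  then have "s \<le> 1 / r + s / q" using le by simp
  then have "s * (1 - 1 / q) \<le> 1 / r" by (simp add: algebra_simps)
  moreover have "1 - 1 / q = 1 / r" using q(2) by linarith
  ultimately show ?thesis using r by (simp add: s_def divide_le_cancel)
qed

text \<open>Two different points differ at some coordinate \<open>i\<close>, where the midpoint
  loses a fixed amount \<open>d\<close>. The loss remains in all partial sums, so all sections, and
  by \<open>bidual_ballI\<close> the midpoint, have norm at most
  \<open>(1 - d) powr (1 / r)\<close>, which is below one.\<close>

lemma strictly_convex_bidual_ell:
  "strictly_convex_nspace (bidual (ell r :: ('k::{real_normed_field, real_inner}, nat \<Rightarrow> 'k) nspace))"
  unfolding strictly_convex_nspace_def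
proof (intro ballI impI, rule ccontr)
  interpret shrinking_carrier "ell r :: ('k, nat \<Rightarrow> 'k) nspace" by (rule shrinking_carrier_ell)
  interpret D: normed_carrier "dual (ell r :: ('k, nat \<Rightarrow> 'k) nspace)" by (rule normed_carrier_dual)
  interpret DD: normed_carrier "bidual (ell r :: ('k, nat \<Rightarrow> 'k) nspace)" by (rule D.normed_carrier_dual)
  fix p q :: "((nat \<Rightarrow> 'k) \<Rightarrow> 'k) \<Rightarrow> 'k"
  let ?m = "vscale (bidual (ell r)) (1 / 2) (p + q)"
  assume p: "p \<in> unit_ball (bidual (ell r))" and q: "q \<in> unit_ball (bidual (ell r))"
    and norm: "vnorm (bidual (ell r)) ?m = 1" and "p \<noteq> q"
  have p': "p \<in> vcarrier (bidual (ell r))" and q': "q \<in> vcarrier (bidual (ell r))"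
    using p q by (auto simp: unit_ball_def)
  obtain i where i: "p (coord i) \<noteq> q (coord i)" using bidual_eqI[OF p' q'] \<open>p \<noteq> q\<close> by blast
  have m: "?m \<in> vcarrier (bidual (ell r))" by (intro DD.scale_closed DD.add_closed p' q')
  have mc: "?m (coord j) = (p (coord j) + q (coord j)) / 2" for j by simp
  define P Q M where "P j = norm (p (coord j)) powr r" and "Q j = norm (q (coord j)) powr r"
    and "M j = norm (?m (coord j)) powr r" for j
  have ineq: "M j \<le> (P j + Q j) / 2" for j
    unfolding M_def P_def Q_def mc by (rule norm_midpoint_le[OF r])
  define d where "d = (P i + Q i) / 2 - M i"
  have d: "0 < d"
    using norm_midpoint_strict[OF r i] unfolding d_def M_def P_def Q_def mc by simp
  have sum: "(\<Sum>j<n. M j) \<le> 1 - d" for n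
  proof -
    \<comment> \<open>Partial sums that stop before \<open>i\<close> are first extended to contain
      it.\<close>
    let ?n = "max n (Suc i)"
    have "(\<Sum>j<n. M j) \<le> (\<Sum>j<?n. M j)" by (intro sum_mono2) (auto simp: M_def)
    also have "\<dots> = M i + (\<Sum>j\<in>{..<?n} - {i}. M j)" by (simp add: sum.remove[of _ i])
    also have "\<dots> \<le> ((P i + Q i) / 2 - d) + (\<Sum>j\<in>{..<?n} - {i}. (P j + Q j) / 2)"
      using ineq by (intro add_mono sum_mono) (auto simp: d_def)
    also have "\<dots> = (\<Sum>j<?n. (P j + Q j) / 2) - d" by (simp add: sum.remove[of "{..<?n}" i])
    also have "\<dots> = ((\<Sum>j<?n. P j) + (\<Sum>j<?n. Q j)) / 2 - d"
      by (simp only: sum_divide_distrib[symmetric] sum.distrib)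
    also have "\<dots> \<le> 1 - d"
      using bidual_ell_sum_le[OF p, of ?n] bidual_ell_sum_le[OF q, of ?n] by (simp add: P_def Q_def)
    finally show ?thesis .
  qed
  have d1: "0 \<le> 1 - d" using sum[of 0] by simp
  have "vnorm (bidual (ell r)) ?m \<le> (1 - d) powr (1 / r)"
  proof (rule bidual_ballI[OF m])
    fix n
    have "(\<Sum>j. norm (head n (\<lambda>i. ?m (coord i)) j) powr r) = (\<Sum>j<n. M j)"
      by (subst suminf_finite[of "{..<n}"]) (auto simp: head_def M_def)
    then show "vnorm (ell r) (head n (\<lambda>i. ?m (coord i))) \<le> (1 - d) powr (1 / r)"
      unfolding vnorm_ell using sum[of n] r by (intro powr_mono2) (auto simp: M_def sum_nonneg)
  qed
  also have "\<dots> < 1 powr (1 / r)" using d d1 r by (intro powr_less_mono2) auto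
  finally show False using norm by simp
qed

end

section \<open>The scalar field as target\<close>

lemma normed_carrier_scalar: "normed_carrier (scalar_space :: ('k::real_normed_field, 'k) nspace)"
  by unfold_locales (auto simp: scalar_space_def norm_mult)

text \<open>An element of the bidual is determined by its value at the identity functional
  \<open>?I\<close>, so the claim reduces to strict convexity of the modulus, used with exponent
  2.\<close>

lemma strictly_convex_bidual_scalar:
  "strictly_convex_nspace (bidual (scalar_space :: ('k::{real_normed_field, real_inner}, 'k) nspace))"
  unfolding strictly_convex_nspace_def
proof (intro ballI impI, rule ccontr)
  interpret normed_carrier "scalar_space :: ('k, 'k) nspace" by (rule normed_carrier_scalar)
  interpret D: normed_carrier "dual (scalar_space :: ('k, 'k) nspace)" by (rule normed_carrier_dual)
  interpret DD: normed_carrier "bidual (scalar_space :: ('k, 'k) nspace)" by (rule D.normed_carrier_dual)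
  let ?I = "\<lambda>c :: 'k. c"
  have I: "?I \<in> vcarrier (dual scalar_space)"
    by (rule dualI[where C = 1]) (auto simp: scalar_space_def)
  have "vnorm (dual scalar_space) ?I \<le> 1"
    by (rule dual_norm_le) (simp add: unit_ball_def scalar_space_def)
  then have I1: "?I \<in> unit_ball (dual scalar_space)" using I by (simp add: unit_ball_def)
  have repr: "z f = f 1 * z ?I" if z: "z \<in> vcarrier (bidual scalar_space)" and f: "f \<in> vcarrier (dual scalar_space)" for z f
  proof -
    have "f = vscale (dual scalar_space) (f 1) ?I"
    proof
      fix c
      have "f (vscale scalar_space c 1) = c * f 1"
        by (rule dual_scale[OF f]) (simp add: scalar_space_def)
      then show "f c = vscale (dual scalar_space) (f 1) ?I c" by (simp add: scalar_space_def mult.commute)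
    qed
    then show ?thesis using dual_scale[OF z I, of "f 1"] by simp
  qed
  fix p q :: "('k \<Rightarrow> 'k) \<Rightarrow> 'k"
  let ?m = "vscale (bidual scalar_space) (1 / 2) (p + q)"
  assume p: "p \<in> unit_ball (bidual scalar_space)" and q: "q \<in> unit_ball (bidual scalar_space)"
    and norm: "vnorm (bidual scalar_space) ?m = 1" and "p \<noteq> q"
  have p': "p \<in> vcarrier (bidual scalar_space)" "vnorm (bidual scalar_space) p \<le> 1"
    and q': "q \<in> vcarrier (bidual scalar_space)" "vnorm (bidual scalar_space) q \<le> 1"
    using p q by (auto simp: unit_ball_def)
  have m: "?m \<in> vcarrier (bidual scalar_space)" by (intro DD.scale_closed DD.add_closed p' q')
  have "p ?I \<noteq> q ?I"
  proof
    assume eq: "p ?I = q ?I"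
    have "p f = q f" for f
      using repr[OF p'(1)] repr[OF q'(1)] eq dual_off[OF p'(1)] dual_off[OF q'(1)]
      by (cases "f \<in> vcarrier (dual (scalar_space :: ('k, 'k) nspace))") auto
    then show False using \<open>p \<noteq> q\<close> by blast
  qed
  then have "norm (?m ?I) powr 2 < (norm (p ?I) powr 2 + norm (q ?I) powr 2) / 2"
    using norm_midpoint_strict[of 2 "p ?I" "q ?I"] by simp
  also have "\<dots> \<le> (1 powr 2 + 1 powr 2) / 2"
    using D.dual_norm_ge[OF p'(1) I1] D.dual_norm_ge[OF q'(1) I1] p'(2) q'(2)
    by (intro divide_right_mono add_mono powr_mono2) auto
  finally have lt: "norm (?m ?I) < 1" by (simp add: abs_square_less_1)
  have "vnorm (bidual scalar_space) ?m \<le> norm (?m ?I)"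
  proof (rule D.dual_norm_le)
    fix f :: "'k \<Rightarrow> 'k" assume "f \<in> unit_ball (dual scalar_space)"
    then have f: "f \<in> vcarrier (dual scalar_space)" "vnorm (dual scalar_space) f \<le> 1" by (auto simp: unit_ball_def)
    have "norm (f 1) \<le> 1"
      using dual_norm_ge[OF f(1), of 1] f(2) by (simp add: unit_ball_def scalar_space_def)
    then show "norm (?m f) \<le> norm (?m ?I)"
      unfolding repr[OF m f(1)] norm_mult by (intro mult_left_le_one_le) auto
  qed
  then show False using lt norm by simp
qed

section \<open>Failure of the Lindenstrauss--Bollobas theorem\<close>

context admissible_weight
begin

text \<open>The argument common to both targets. In \<open>far\<close> the constant \<kappa>
  precedes n, which is found only after \<Psi> and \<open>a\<close>. Vanishing is expressed through
  functionals, the form in which \<open>vanishes_if_attained\<close> delivers it.\<close>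

lemma not_lindenstrauss_bollobas:
  fixes Y :: "('k::real_normed_field, 'y::ab_group_add) nspace"
    and \<Phi> :: "(nat \<Rightarrow> nat \<Rightarrow> 'k) \<Rightarrow> 'y"
  assumes Y: "normed_carrier Y" "strictly_convex_nspace (bidual Y)" and N: "0 < N"
    and \<Phi>: "\<Phi> \<in> cont_multilinear N (\<lambda>_. d_predual w) Y" "multi_norm N (\<lambda>_. d_predual w) Y \<Phi> = 1"
    and approx: "\<And>\<delta>. 0 < \<delta> \<Longrightarrow> \<exists>x m. (\<forall>i\<ge>m. x i = 0) \<and> x \<in> unit_sphere (d_predual w) \<and>
      1 - \<delta> < vnorm Y (\<Phi> (\<lambda>j. if j < N then x else undefined))"
    and \<kappa>: "0 < \<kappa>"
    and far: "\<And>\<Psi> n. \<Psi> \<in> cont_multilinear N (\<lambda>_. d_predual w) Y \<Longrightarrow>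
      (\<And>f. f \<in> vcarrier (dual Y) \<Longrightarrow> f (\<Psi> (\<lambda>j. if j < N then unit_seq n else undefined)) = 0) \<Longrightarrow>
      \<kappa> \<le> multi_norm N (\<lambda>_. d_predual w) Y (\<Phi> - \<Psi>)"
  shows "\<not> lindenstrauss_bollobas N (\<lambda>_. d_predual w) Y"
proof
  let ?X = "d_predual w :: ('k, nat \<Rightarrow> 'k) nspace"
  assume "lindenstrauss_bollobas N (\<lambda>_. d_predual w) Y"
  then obtain \<eta> \<beta> :: "real \<Rightarrow> real" where
    pos: "\<And>\<epsilon>. 0 < \<epsilon> \<Longrightarrow> 0 < \<eta> \<epsilon>" and \<beta>: "(\<beta> \<longlongrightarrow> 0) (at_right 0)" and
    LB: "\<And>\<epsilon> x. 0 < \<epsilon> \<Longrightarrow> x \<in> (\<Pi>\<^sub>E j\<in>{..<N}. unit_sphere ?X) \<Longrightarrow> vnorm Y (\<Phi> x) > 1 - \<eta> \<epsilon> \<Longrightarrow>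
      \<exists>\<Psi> \<in> cont_multilinear N (\<lambda>_. ?X) Y. \<exists>a \<in> (\<Pi>\<^sub>E j\<in>{..<N}. unit_sphere (bidual ?X)).
            multi_norm N (\<lambda>_. ?X) Y \<Psi> = 1 \<and>
            (\<forall>js \<in> permutations_of_set {..<N}. vnorm (bidual Y) (arens_ext N (\<lambda>_. ?X) Y js \<Psi> a) = 1) \<and>
            (\<forall>j<N. vnorm (bidual ?X) (a j - canon ?X (x j)) < \<beta> \<epsilon>) \<and>
            multi_norm N (\<lambda>_. ?X) Y (\<Phi> - \<Psi>) < \<epsilon>"
    unfolding lindenstrauss_bollobas_def using \<Phi> by (elim exE conjE) metis
  interpret shrinking_carrier ?X by (rule shrinking_carrier_d)
  obtain b where b: "0 < b" "\<And>y. 0 < y \<Longrightarrow> y < b \<Longrightarrow> \<beta> y < 1"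
    using order_tendstoD(2)[OF \<beta>, of 1] by (auto simp: eventually_at_right_field)
  \<comment> \<open>Halving \<open>b\<close> puts \<epsilon> strictly inside the interval on which
    \<beta> is below one, as \<open>bidual_perturb\<close> demands.\<close>
  define \<epsilon> where "\<epsilon> = min \<kappa> (b / 2)"
  have \<epsilon>: "0 < \<epsilon>" "\<epsilon> \<le> \<kappa>" "\<beta> \<epsilon> < 1" using b \<kappa> by (auto simp: \<epsilon>_def)
  obtain x m where x: "\<And>i. m \<le> i \<Longrightarrow> x i = 0" "x \<in> unit_sphere ?X"
    "1 - \<eta> \<epsilon> < vnorm Y (\<Phi> (\<lambda>j. if j < N then x else undefined))"
    using approx[OF pos[OF \<epsilon>(1)]] by blast
  have "(\<lambda>j. if j < N then x else undefined) \<in> (\<Pi>\<^sub>E j\<in>{..<N}. unit_sphere ?X)"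
    using x(2) by auto
  from LB[OF \<epsilon>(1) this x(3)] obtain \<Psi> a where
    \<Psi>: "\<Psi> \<in> cont_multilinear N (\<lambda>_. ?X) Y" "multi_norm N (\<lambda>_. ?X) Y \<Psi> = 1"
    and a: "a \<in> (\<Pi>\<^sub>E j\<in>{..<N}. unit_sphere (bidual ?X))"
    and attained: "\<And>js. js \<in> permutations_of_set {..<N} \<Longrightarrow> vnorm (bidual Y) (arens_ext N (\<lambda>_. ?X) Y js \<Psi> a) = 1"
    and near: "\<And>j. j < N \<Longrightarrow> vnorm (bidual ?X) (a j - canon ?X x) < \<beta> \<epsilon>"
    and close: "multi_norm N (\<lambda>_. ?X) Y (\<Phi> - \<Psi>) < \<epsilon>"
    by (elim bexE conjE) (simp add: Ball_def)
  interpret \<Psi>: multilinear_map ?X Y N \<Psi>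
    by (intro multilinear_map.intro multilinear_map_axioms.intro normed_carrier_axioms Y(1) \<Psi>(1))
  have ball: "a j \<in> unit_ball (bidual ?X)" if "j < N" for j
    using PiE_mem[OF a, of j] that by (simp add: unit_ball_def unit_sphere_def)
  define Q where "Q j \<theta> n0 \<longleftrightarrow> 0 < \<theta> \<and> (\<forall>n\<ge>n0. \<forall>c. norm c \<le> \<theta> \<longrightarrow>
      (\<lambda>f. a j f + c * canon ?X (unit_seq n) f) \<in> unit_ball (bidual ?X))" for j \<theta> n0
  have "\<exists>\<theta> n0. Q j \<theta> n0" if j: "j < N" for j
  proof -
    have "vnorm (bidual ?X) (a j - canon ?X x) < 1" using near[OF j] \<epsilon>(3) by linarith
    from bidual_perturb[OF ball[OF j] x(1) this] show ?thesis unfolding Q_def by blast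
  qed
  then obtain \<theta> n0 where Q: "\<And>j. j < N \<Longrightarrow> Q j (\<theta> j) (n0 j)" by metis
  have perturb: "0 < \<theta> j" "\<And>n c. n0 j \<le> n \<Longrightarrow> norm c \<le> \<theta> j \<Longrightarrow>
      (\<lambda>f. a j f + c * canon ?X (unit_seq n) f) \<in> unit_ball (bidual ?X)" if "j < N" for j
    using Q[OF that] by (auto simp: Q_def)
  \<comment> \<open>\<open>vanishes_if_attained\<close> needs one direction and one step size for
    all variables; finitely many variables allow a maximum and a positive minimum.\<close>
  define n where "n = Max (n0 ` {..<N})"
  define c where "c = Min (\<theta> ` {..<N})"
  have ne: "{..<N} \<noteq> {}" using N by auto
  have c: "0 < c" unfolding c_def using ne perturb(1) by (subst Min_gr_iff) auto
  have cj: "c \<le> \<theta> j" and nj: "n0 j \<le> n" if "j < N" for j using that by (auto simp: c_def n_def)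
  have canonical: "vnorm (bidual Y) (\<Psi>.canonical a) = 1"
  proof -
    have "arens_ext N (\<lambda>_. ?X) Y [0..<N] \<Psi> a = \<Psi>.canonical a"
      by (rule \<Psi>.arens_ext_canonical)
        (use ball wstar_net_exists in \<open>auto simp: unit_ball_def\<close>)
    moreover have "[0..<N] \<in> permutations_of_set {..<N}"
      by (rule permutations_of_setI) auto
    ultimately show ?thesis using attained by metis
  qed
  have zero: "f (\<Psi> (\<lambda>j. if j < N then unit_seq n else undefined)) = 0" if "f \<in> vcarrier (dual Y)" for f
  proof (rule \<Psi>.vanishes_if_attained[where c = "of_real c", OF Y(2) _ ball canonical])
    fix j assume j: "j < N"
    show "(\<lambda>f. a j f + of_real c * canon ?X (unit_seq n) f) \<in> unit_ball (bidual ?X)"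
      using perturb(2)[OF j nj[OF j], of "of_real c"] cj[OF j] c by simp
    show "(\<lambda>f. a j f - of_real c * canon ?X (unit_seq n) f) \<in> unit_ball (bidual ?X)"
      using perturb(2)[OF j nj[OF j], of "- of_real c"] cj[OF j] c by simp
  qed (use \<Psi>(2) unit_in c N that in auto)
  have "\<kappa> \<le> multi_norm N (\<lambda>_. ?X) Y (\<Phi> - \<Psi>)" by (rule far[OF \<Psi>(1)], rule zero)
  with close \<epsilon>(2) show False by simp
qed

section \<open>The diagonal maps\<close>

lemma w_neq_0: "w i \<noteq> 0"
  using w_pos[of i] by simp

text \<open>Homogeneous form of \<open>power_prod_sum_le\<close>: each variable is divided by its
  norm, and the bound on partial sums gives convergence as well.\<close>

lemma prod_powr_sum:
  fixes x :: "nat \<Rightarrow> nat \<Rightarrow> 'k::real_normed_field"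
  assumes x: "\<And>j. j < N \<Longrightarrow> x j \<in> vcarrier (d_predual w)"
    and N: "0 < N" and q: "0 < q" "1 < real N * q" and s: "summable (\<lambda>i. w i powr (real N * q))"
  shows "summable (\<lambda>i. norm (\<Prod>j<N. x j i) powr q)"
    and "(\<Sum>i. norm (\<Prod>j<N. x j i) powr q) \<le> (\<Sum>i. w i powr (real N * q)) * (\<Prod>j<N. vnorm (d_predual w) (x j)) powr q"
proof -
  interpret normed_carrier "d_predual w :: ('k, nat \<Rightarrow> 'k) nspace" by (rule normed_carrier_d)
  define M where "M = (\<Sum>i. w i powr (real N * q))"
  define P where "P = (\<Prod>j<N. vnorm (d_predual w) (x j))"
  define b where "b j i = norm (x j i) / vnorm (d_predual w) (x j)" for j i
  have nn: "0 \<le> vnorm (d_predual w) (x j)" if "j < N" for j by (rule norm_nonneg[OF x[OF that]])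
  have b0: "0 \<le> b j i" if "j < N" for j i using nn[OF that] by (simp add: b_def)
  \<comment> \<open>If the norm is zero then so is \<open>x j i\<close>, by
    \<open>d_norm_bound\<close> at a singleton, and the identity still holds.\<close>
  have xb: "norm (x j i) = vnorm (d_predual w) (x j) * b j i" if "j < N" for j i
    using d_norm_bound[OF x[OF that], of "{i}"] by (auto simp: b_def W_1)
  have dom: "(\<Sum>i\<in>S. b j i) \<le> W (card S)" if "j < N" "finite S" for j S
  proof (cases "vnorm (d_predual w) (x j) = 0")
    case True
    then show ?thesis by (simp add: b_def W_nonneg)
  next
    case False
    then have "0 < vnorm (d_predual w) (x j)" using nn[OF that(1)] by simp
    then show ?thesis using d_norm_bound[OF x[OF that(1)] that(2)]
      by (simp add: b_def sum_divide_distrib[symmetric] field_simps)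
  qed
  have le: "(\<Sum>i<m. norm (\<Prod>j<N. x j i) powr q) \<le> M * P powr q" for m
  proof -
    have "(\<Sum>i<m. norm (\<Prod>j<N. x j i) powr q) = (\<Sum>i<m. P powr q * (\<Prod>j<N. b j i) powr q)"
    proof (rule sum.cong[OF refl])
      fix i
      have "norm (\<Prod>j<N. x j i) = P * (\<Prod>j<N. b j i)"
        unfolding prod_norm[symmetric] P_def prod.distrib[symmetric] by (rule prod.cong) (auto simp: xb)
      then show "norm (\<Prod>j<N. x j i) powr q = P powr q * (\<Prod>j<N. b j i) powr q"
        by (simp add: powr_mult)
    qed
    also have "\<dots> = P powr q * (\<Sum>i<m. (\<Prod>j<N. b j i) powr q)" by (simp add: sum_distrib_left)
    also have "\<dots> \<le> P powr q * (\<Sum>i<m. w i powr (real N * q))"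
      by (intro mult_left_mono power_prod_sum_le b0 dom N q) auto
    also have "\<dots> \<le> P powr q * M"
      unfolding M_def by (intro mult_left_mono sum_le_suminf s) auto
    finally show ?thesis by (simp add: mult.commute)
  qed
  show sm: "summable (\<lambda>i. norm (\<Prod>j<N. x j i) powr q)"
    by (rule summableI_nonneg_bounded[OF _ le]) simp
  show "(\<Sum>i. norm (\<Prod>j<N. x j i) powr q) \<le> M * P powr q"
    by (rule suminf_le_const[OF sm le])
qed

definition w_head :: "nat \<Rightarrow> nat \<Rightarrow> 'k::real_normed_field" where
  "w_head m i = (if i < m then of_real (w i) else 0)"

lemma w_head_sphere:
  assumes "0 < m"
  shows "(w_head m :: nat \<Rightarrow> 'k::real_normed_field) \<in> unit_sphere (d_predual w)"
proof -
  let ?x = "w_head m :: nat \<Rightarrow> 'k"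
  have x: "?x \<in> vcarrier (d_predual w)"
    by (rule finite_support_in_d[of m]) (simp add: w_head_def)
  have "vnorm (d_predual w) ?x \<le> 1"
    unfolding d_norm_le_iff[OF x]
  proof (intro allI impI)
    fix S :: "nat set" assume S: "finite S"
    have "(\<Sum>i\<in>S. norm (?x i)) \<le> (\<Sum>i\<in>S. w i)"
      by (intro sum_mono) (simp add: w_head_def w_nonneg)
    also have "\<dots> \<le> W (card S)" by (rule sum_w_le[OF S])
    finally show "(\<Sum>i\<in>S. norm (?x i)) \<le> 1 * W (card S)" by simp
  qed
  moreover have "1 \<le> vnorm (d_predual w) ?x"
    using d_norm_bound[OF x, of "{0}"] assms by (simp add: w_head_def W_1)
  ultimately show ?thesis using x by (simp add: unit_sphere_def)
qed

lemma prod_const: "(\<Prod>j<N. (if j < N then x else y) i) = (x i :: 'k::real_normed_field) ^ N"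
proof -
  have "(\<Prod>j<N. (if j < N then x else y) i) = (\<Prod>j<N. x i)" by (rule prod.cong) auto
  then show ?thesis by simp
qed

lemma prod_upd:
  fixes x :: "nat \<Rightarrow> nat \<Rightarrow> 'k::real_normed_field"
  assumes "j < N"
  shows "(\<Prod>k<N. (x(j := u)) k i) = u i * (\<Prod>k\<in>{..<N} - {j}. x k i)"
proof -
  have "(\<Prod>k<N. (x(j := u)) k i) = (x(j := u)) j i * (\<Prod>k\<in>{..<N} - {j}. (x(j := u)) k i)"
    using assms by (intro prod.remove) auto
  also have "(\<Prod>k\<in>{..<N} - {j}. (x(j := u)) k i) = (\<Prod>k\<in>{..<N} - {j}. x k i)"
    by (rule prod.cong) auto
  finally show ?thesis by simp
qed

lemma upd_carrier:
  assumes "x \<in> (\<Pi>\<^sub>E j\<in>{..<N}. vcarrier X)" "j < N" "u \<in> vcarrier X" "k < N"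
  shows "(x(j := u)) k \<in> vcarrier X"
  using assms(2-4) PiE_mem[OF assms(1), of k] by simp

lemma ball_norm_prod_le:
  assumes X: "normed_carrier X" and x: "x \<in> (\<Pi>\<^sub>E j\<in>{..<N}. unit_ball X)"
  shows "0 \<le> (\<Prod>j<N. vnorm X (x j))" "(\<Prod>j<N. vnorm X (x j)) \<le> 1"
proof -
  interpret normed_carrier X by fact
  have "0 \<le> vnorm X (x j) \<and> vnorm X (x j) \<le> 1" if "j < N" for j
    using PiE_mem[OF x, of j] that by (auto simp: unit_ball_def norm_nonneg)
  then show "0 \<le> (\<Prod>j<N. vnorm X (x j))" "(\<Prod>j<N. vnorm X (x j)) \<le> 1"
    by (auto intro!: prod_le_1 prod_nonneg)
qed

text \<open>The limit along truncated weights yields both the lower bound for the norm and the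
  near-maximizers of finite support. The factor 1 in the bound matches the constant in
  \<open>cont_multilinear\<close>.\<close>

lemma multi_norm_eq_1I:
  fixes Y :: "('k::real_normed_field, 'y::ab_group_add) nspace"
  assumes bound: "\<And>x. x \<in> (\<Pi>\<^sub>E j\<in>{..<N}. vcarrier (d_predual w :: ('k, nat \<Rightarrow> 'k) nspace)) \<Longrightarrow>
      vnorm Y (\<Phi> x) \<le> 1 * (\<Prod>j<N. vnorm (d_predual w) (x j))"
    and lim: "(\<lambda>m. vnorm Y (\<Phi> (\<lambda>j. if j < N then w_head m else undefined))) \<longlonglongrightarrow> 1"
  shows "multi_norm N (\<lambda>_. d_predual w) Y \<Phi> = 1"
    and "0 < \<delta> \<Longrightarrow> \<exists>x m. (\<forall>i\<ge>m. x i = 0) \<and> x \<in> unit_sphere (d_predual w) \<and>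
      1 - \<delta> < vnorm Y (\<Phi> (\<lambda>j. if j < N then x else undefined))"
proof -
  let ?X = "d_predual w :: ('k, nat \<Rightarrow> 'k) nspace"
  interpret normed_carrier ?X by (rule normed_carrier_d)
  have approx: "\<exists>m>0. 1 - \<delta> < vnorm Y (\<Phi> (\<lambda>j. if j < N then w_head m else undefined))" if \<delta>: "0 < \<delta>" for \<delta>
  proof -
    obtain m where "\<And>k. m \<le> k \<Longrightarrow> 1 - \<delta> < vnorm Y (\<Phi> (\<lambda>j. if j < N then w_head k else undefined))"
      using order_tendstoD(1)[OF lim, of "1 - \<delta>"] \<delta> unfolding eventually_sequentially by auto
    \<comment> \<open>A positive index is required: \<open>w_head 0\<close> is zero and not on the
      sphere.\<close>
    from this[of "Suc m"] show ?thesis by (intro exI[of _ "Suc m"]) auto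
  qed
  show "\<exists>x m. (\<forall>i\<ge>m. x i = 0) \<and> x \<in> unit_sphere ?X \<and>
      1 - \<delta> < vnorm Y (\<Phi> (\<lambda>j. if j < N then x else undefined))" if \<delta>: "0 < \<delta>"
  proof -
    obtain m where m: "0 < m" "1 - \<delta> < vnorm Y (\<Phi> (\<lambda>j. if j < N then w_head m else undefined))"
      using approx[OF \<delta>] by blast
    have "\<forall>i\<ge>m. w_head m i = (0 :: 'k)" by (simp add: w_head_def)
    with m w_head_sphere[OF m(1)] show ?thesis by blast
  qed
  have ball: "(\<lambda>j. if j < N then w_head m else undefined) \<in> (\<Pi>\<^sub>E j\<in>{..<N}. unit_ball ?X)" if "0 < m" for m
    using w_head_sphere[OF that] by (auto simp: unit_ball_def unit_sphere_def)
  show "multi_norm N (\<lambda>_. ?X) Y \<Phi> = 1"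
  proof (rule antisym)
    show "multi_norm N (\<lambda>_. ?X) Y \<Phi> \<le> 1"
      unfolding multi_norm_def
    proof (rule cSUP_least)
      show "(\<Pi>\<^sub>E j\<in>{..<N}. unit_ball ?X) \<noteq> {}" using ball[of 1] by auto
      fix x assume x: "x \<in> (\<Pi>\<^sub>E j\<in>{..<N}. unit_ball ?X)"
      then have "x \<in> (\<Pi>\<^sub>E j\<in>{..<N}. vcarrier ?X)" by (auto simp: unit_ball_def PiE_def Pi_def)
      from bound[OF this] ball_norm_prod_le[OF normed_carrier_d x] show "vnorm Y (\<Phi> x) \<le> 1" by simp
    qed
    show "1 \<le> multi_norm N (\<lambda>_. ?X) Y \<Phi>"
    proof (rule field_le_epsilon)
      fix e :: real assume "0 < e"
      then obtain m where m: "0 < m" "1 - e < vnorm Y (\<Phi> (\<lambda>j. if j < N then w_head m else undefined))"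
        using approx by blast
      have "vnorm Y (\<Phi> (\<lambda>j. if j < N then w_head m else undefined)) \<le> multi_norm N (\<lambda>_. ?X) Y \<Phi>"
        by (rule multi_norm_ge[OF normed_carrier_d bound ball[OF m(1)]])
      with m show "1 \<le> multi_norm N (\<lambda>_. ?X) Y \<Phi> + e" by simp
    qed
  qed
qed

lemma unit_seq_ball: "(\<lambda>j. if j < N then unit_seq n else undefined) \<in>
    (\<Pi>\<^sub>E j\<in>{..<N}. unit_ball (d_predual w :: ('k::real_normed_field, nat \<Rightarrow> 'k) nspace))"
proof -
  interpret sequence_carrier "d_predual w :: ('k, nat \<Rightarrow> 'k) nspace" by (rule sequence_carrier_d)
  have "vnorm (d_predual w) (unit_seq n :: nat \<Rightarrow> 'k) \<le> 1"
    unfolding d_norm_le_iff[OF unit_in]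
  proof (intro allI impI)
    fix S :: "nat set" assume S: "finite S"
    show "(\<Sum>i\<in>S. norm (unit_seq n i :: 'k)) \<le> 1 * W (card S)"
    proof (cases "S = {}")
      case False
      have "(\<Sum>i\<in>S. norm (unit_seq n i :: 'k)) = (\<Sum>i\<in>S. if i = n then 1 else 0)"
        by (intro sum.cong) (auto simp: unit_seq_def)
      also have "\<dots> \<le> 1" using S by simp
      also have "\<dots> \<le> W (card S)" using S False by (intro W_ge_1) (simp add: card_gt_0_iff)
      finally show ?thesis by simp
    qed simp
  qed
  then show ?thesis using unit_in by (auto simp: unit_ball_def)
qed

text \<open>The weak triangle inequality \<open>diff\<close> only ensures that the supremum for
  \<open>\<Phi> - \<Psi>\<close> is over a bounded set; \<open>K\<close> does not enter the
  conclusion.\<close>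

lemma multi_norm_diff_ge:
  fixes Y :: "('k::real_normed_field, 'y::ab_group_add) nspace"
  assumes Y: "normed_carrier Y"
    and diff: "\<And>u v. u \<in> vcarrier Y \<Longrightarrow> v \<in> vcarrier Y \<Longrightarrow> vnorm Y (u - v) \<le> K * (vnorm Y u + vnorm Y v)"
    and K: "0 \<le> K"
    and \<Phi>: "\<Phi> \<in> cont_multilinear N (\<lambda>_. d_predual w) Y" and \<Psi>: "\<Psi> \<in> cont_multilinear N (\<lambda>_. d_predual w) Y"
    and x: "x \<in> (\<Pi>\<^sub>E j\<in>{..<N}. unit_ball (d_predual w))"
  shows "vnorm Y (\<Phi> x - \<Psi> x) \<le> multi_norm N (\<lambda>_. d_predual w) Y (\<Phi> - \<Psi>)"
proof -
  interpret P: multilinear_map "d_predual w" Y N \<Phi>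
    by (intro multilinear_map.intro multilinear_map_axioms.intro normed_carrier_d Y \<Phi>)
  interpret Q: multilinear_map "d_predual w" Y N \<Psi>
    by (intro multilinear_map.intro multilinear_map_axioms.intro normed_carrier_d Y \<Psi>)
  obtain C where C: "\<And>x. x \<in> P.args {..<N} \<Longrightarrow> vnorm Y (\<Phi> x) \<le> C * (\<Prod>j<N. vnorm (d_predual w) (x j))"
    using P.map_bound by blast
  obtain D where D: "\<And>x. x \<in> P.args {..<N} \<Longrightarrow> vnorm Y (\<Psi> x) \<le> D * (\<Prod>j<N. vnorm (d_predual w) (x j))"
    using Q.map_bound by blast
  have bound: "vnorm Y ((\<Phi> - \<Psi>) y) \<le> (K * (C + D)) * (\<Prod>j<N. vnorm (d_predual w) (y j))"
    if y: "y \<in> P.args {..<N}" for y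
  proof -
    have "vnorm Y ((\<Phi> - \<Psi>) y) \<le> K * (vnorm Y (\<Phi> y) + vnorm Y (\<Psi> y))"
      using diff[OF P.map_in[OF y] Q.map_in[OF y]] by simp
    also have "\<dots> \<le> K * (C * (\<Prod>j<N. vnorm (d_predual w) (y j)) + D * (\<Prod>j<N. vnorm (d_predual w) (y j)))"
      by (intro mult_left_mono add_mono C D y K)
    finally show ?thesis by (simp add: algebra_simps)
  qed
  have "vnorm Y ((\<Phi> - \<Psi>) x) \<le> multi_norm N (\<lambda>_. d_predual w) Y (\<Phi> - \<Psi>)"
    by (rule multi_norm_ge[OF normed_carrier_d bound x]) (simp only: P.PiE_args)
  then show ?thesis by (simp only: minus_apply)
qed

text \<open>Power sums with \<open>q = 1\<close> require \<open>N\<close> above one. The form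
  divided by \<open>M\<close> has norm one and modulus \<open>1 / M\<close> at every diagonal unit
  point, which is the value of \<kappa>.\<close>

lemma not_lindenstrauss_bollobas_scalar:
  assumes N: "1 < N" and s: "summable (\<lambda>i. w i powr real N)"
  shows "\<not> lindenstrauss_bollobas N (\<lambda>_. d_predual w)
    (scalar_space :: ('k::{real_normed_field, real_inner, banach}, 'k) nspace)"
proof -
  let ?X = "d_predual w :: ('k, nat \<Rightarrow> 'k) nspace"
  interpret normed_carrier ?X by (rule normed_carrier_d)
  define M where "M = (\<Sum>i. w i powr real N)"
  have M: "0 < M"
    unfolding M_def by (rule suminf_pos[OF s]) (simp add: w_neq_0)
  define \<Phi> where "\<Phi> x = (\<Sum>i. \<Prod>j<N. x j i) / of_real M" for x :: "nat \<Rightarrow> nat \<Rightarrow> 'k"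
  have P: "summable (\<lambda>i. norm (\<Prod>j<N. x j i))"
      "(\<Sum>i. norm (\<Prod>j<N. x j i)) \<le> M * (\<Prod>j<N. vnorm ?X (x j))"
    if x: "\<And>j. j < N \<Longrightarrow> x j \<in> vcarrier ?X" for x
  proof -
    have "0 \<le> (\<Prod>j<N. vnorm ?X (x j))" using x by (auto intro!: prod_nonneg norm_nonneg)
    then show "summable (\<lambda>i. norm (\<Prod>j<N. x j i))"
      "(\<Sum>i. norm (\<Prod>j<N. x j i)) \<le> M * (\<Prod>j<N. vnorm ?X (x j))"
      using prod_powr_sum[where q = 1 and x = x and N = N, OF x] N s by (simp_all add: M_def)
  qed
  have summ: "summable (\<lambda>i. \<Prod>k<N. (x(j := u)) k i)"
    if "x \<in> (\<Pi>\<^sub>E j\<in>{..<N}. vcarrier ?X)" "j < N" "u \<in> vcarrier ?X" for x j u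
    by (rule summable_norm_cancel, rule P(1)) (rule upd_carrier[OF that])
  have bound: "vnorm scalar_space (\<Phi> x) \<le> 1 * (\<Prod>j<N. vnorm ?X (x j))"
    if x: "x \<in> (\<Pi>\<^sub>E j\<in>{..<N}. vcarrier ?X)" for x
  proof -
    have x': "x j \<in> vcarrier ?X" if "j < N" for j using x that by auto
    have "norm (\<Sum>i. \<Prod>j<N. x j i) \<le> M * (\<Prod>j<N. vnorm ?X (x j))"
      using summable_norm[OF P(1)[of x, OF x']] P(2)[of x, OF x'] by linarith
    then show ?thesis using M by (simp add: scalar_space_def \<Phi>_def norm_divide field_simps)
  qed
  have \<Phi>: "\<Phi> \<in> cont_multilinear N (\<lambda>_. ?X) scalar_space"
    unfolding cont_multilinear_def
  proof (intro CollectI conjI ballI allI impI exI[of _ 1] bound)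
    fix x j u v assume x: "x \<in> (\<Pi>\<^sub>E j\<in>{..<N}. vcarrier ?X)" and j: "j < N"
      and u: "u \<in> vcarrier ?X" and v: "v \<in> vcarrier ?X"
    have "(\<Sum>i. \<Prod>k<N. (x(j := u + v)) k i) = (\<Sum>i. (\<Prod>k<N. (x(j := u)) k i) + (\<Prod>k<N. (x(j := v)) k i))"
      unfolding prod_upd[OF j] by (simp add: distrib_right)
    also have "\<dots> = (\<Sum>i. \<Prod>k<N. (x(j := u)) k i) + (\<Sum>i. \<Prod>k<N. (x(j := v)) k i)"
      by (rule suminf_add[OF summ[OF x j u] summ[OF x j v], symmetric])
    finally show "\<Phi> (x(j := u + v)) = \<Phi> (x(j := u)) + \<Phi> (x(j := v))"
      unfolding \<Phi>_def by (simp only: add_divide_distrib)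
  next
    fix x j c u assume x: "x \<in> (\<Pi>\<^sub>E j\<in>{..<N}. vcarrier ?X)" and j: "j < N" and u: "u \<in> vcarrier ?X"
    have "(\<Sum>i. \<Prod>k<N. (x(j := vscale ?X c u)) k i) = (\<Sum>i. c * (\<Prod>k<N. (x(j := u)) k i))"
      unfolding prod_upd[OF j] by (simp add: mult.assoc)
    also have "\<dots> = c * (\<Sum>i. \<Prod>k<N. (x(j := u)) k i)"
      by (rule suminf_mult[OF summ[OF x j u]])
    finally show "\<Phi> (x(j := vscale ?X c u)) = vscale scalar_space c (\<Phi> (x(j := u)))"
      unfolding \<Phi>_def by (simp add: scalar_space_def del: vscale_d)
  qed (simp add: scalar_space_def)
  have val: "vnorm scalar_space (\<Phi> (\<lambda>j. if j < N then w_head m else undefined)) = (\<Sum>i<m. w i powr real N) / M" for m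
  proof -
    have "(\<Sum>i. (w_head m i :: 'k) ^ N) = (\<Sum>i<m. (w_head m i) ^ N)"
      using N by (intro suminf_finite) (auto simp: w_head_def)
    also have "\<dots> = of_real (\<Sum>i<m. w i powr real N)"
      using w_pos by (simp add: w_head_def powr_realpow)
    finally show ?thesis using M unfolding \<Phi>_def prod_const
      by (simp add: scalar_space_def norm_divide sum_nonneg del: of_real_sum)
  qed
  have "(\<lambda>m. (\<Sum>i<m. w i powr real N) / M) \<longlonglongrightarrow> M / M"
    unfolding M_def using M by (intro tendsto_divide summable_LIMSEQ s tendsto_const) (simp add: M_def)
  then have lim: "(\<lambda>m. vnorm scalar_space (\<Phi> (\<lambda>j. if j < N then w_head m else undefined))) \<longlonglongrightarrow> 1"
    using M by (simp add: val)
  note norm1 = multi_norm_eq_1I[OF bound lim]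
  show ?thesis
  proof (rule not_lindenstrauss_bollobas[OF normed_carrier_scalar strictly_convex_bidual_scalar _ \<Phi> norm1(1) norm1(2)])
    show "0 < 1 / M" using M by simp
    fix \<Psi> n assume \<Psi>: "\<Psi> \<in> cont_multilinear N (\<lambda>_. ?X) scalar_space"
      and zero: "\<And>f. f \<in> vcarrier (dual scalar_space) \<Longrightarrow> f (\<Psi> (\<lambda>j. if j < N then unit_seq n else undefined)) = 0"
    let ?e = "\<lambda>j. if j < N then unit_seq n else undefined :: nat \<Rightarrow> 'k"
    \<comment> \<open>Vanishing under all functionals is read off at the identity.\<close>
    have "(\<lambda>c. c) \<in> vcarrier (dual (scalar_space :: ('k, 'k) nspace))"
      by (rule dualI[where C = 1]) (auto simp: scalar_space_def)
    from zero[OF this] have \<Psi>e: "\<Psi> ?e = 0" .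
    have "(\<Sum>i. (unit_seq n i :: 'k) ^ N) = (\<Sum>i\<in>{n}. (unit_seq n i) ^ N)"
      using N by (intro suminf_finite) (auto simp: unit_seq_def)
    then have \<Phi>e: "norm (\<Phi> ?e) = 1 / M"
      using M unfolding \<Phi>_def prod_const by (simp add: unit_seq_def norm_divide)
    have "vnorm scalar_space (\<Phi> ?e - \<Psi> ?e) \<le> multi_norm N (\<lambda>_. ?X) scalar_space (\<Phi> - \<Psi>)"
      by (rule multi_norm_diff_ge[OF normed_carrier_scalar _ _ \<Phi> \<Psi> unit_seq_ball, where K = 1])
        (auto simp: scalar_space_def norm_triangle_ineq4)
    then show "1 / M \<le> multi_norm N (\<lambda>_. ?X) scalar_space (\<Phi> - \<Psi>)"
      using \<Phi>e \<Psi>e by (simp add: scalar_space_def)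
  qed (use N in simp_all)
qed

text \<open>With \<open>q = r\<close> the exponent exceeds one even for a single variable, so linear
  operators are included. Here \<kappa> is \<open>1 / L\<close>, the modulus of the n-th coordinate
  of the diagonal map at the unit point.\<close>

lemma not_lindenstrauss_bollobas_ell:
  assumes N: "0 < N" and r: "1 < r" and s: "summable (\<lambda>i. w i powr (real N * r))"
  shows "\<not> lindenstrauss_bollobas N (\<lambda>_. d_predual w)
    (ell r :: ('k::{real_normed_field, real_inner}, nat \<Rightarrow> 'k) nspace)"
proof -
  let ?X = "d_predual w :: ('k, nat \<Rightarrow> 'k) nspace"
  interpret normed_carrier ?X by (rule normed_carrier_d)
  interpret E: ell_exponent r by unfold_locales (rule r)
  interpret Y: sequence_carrier "ell r :: ('k, nat \<Rightarrow> 'k) nspace" by (rule E.sequence_carrier_ell)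
  define M where "M = (\<Sum>i. w i powr (real N * r))"
  have M: "0 < M"
    unfolding M_def by (rule suminf_pos[OF s]) (simp add: w_neq_0)
  define L where "L = M powr (1 / r)"
  have L: "0 < L" "L powr r = M" using M r by (simp_all add: L_def powr_powr)
  have Nr: "1 < real N * r" using N r by (metis less_1_mult mult_1 of_nat_1_eq_iff One_nat_def Suc_leI le_neq_implies_less of_nat_less_iff)
  define \<Phi> where "\<Phi> x = (\<lambda>i. (\<Prod>j<N. x j i) / of_real L)" for x :: "nat \<Rightarrow> nat \<Rightarrow> 'k"
  have np: "norm (\<Phi> x i) powr r = norm (\<Prod>j<N. x j i) powr r / M" for x i
    using L by (simp add: \<Phi>_def norm_divide powr_divide)
  have P: "summable (\<lambda>i. norm (\<Prod>j<N. x j i) powr r)"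
      "(\<Sum>i. norm (\<Prod>j<N. x j i) powr r) \<le> M * (\<Prod>j<N. vnorm ?X (x j)) powr r"
    if x: "\<And>j. j < N \<Longrightarrow> x j \<in> vcarrier ?X" for x
    using prod_powr_sum[where x = x, OF x N _ Nr s] r by (simp_all add: M_def)
  have mem: "\<Phi> x \<in> vcarrier (ell r)" if x: "x \<in> (\<Pi>\<^sub>E j\<in>{..<N}. vcarrier ?X)" for x
  proof -
    have x': "x j \<in> vcarrier ?X" if "j < N" for j using x that by auto
    show ?thesis unfolding E.ell_iff np by (rule summable_divide[OF P(1)[of x, OF x']])
  qed
  have bound: "vnorm (ell r) (\<Phi> x) \<le> 1 * (\<Prod>j<N. vnorm ?X (x j))"
    if x: "x \<in> (\<Pi>\<^sub>E j\<in>{..<N}. vcarrier ?X)" for x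
  proof -
    have x': "x j \<in> vcarrier ?X" if "j < N" for j using x that by auto
    have nn: "0 \<le> (\<Prod>j<N. vnorm ?X (x j))" using x' by (auto intro!: prod_nonneg norm_nonneg)
    have "(\<Sum>i. norm (\<Phi> x i) powr r) \<le> (\<Prod>j<N. vnorm ?X (x j)) powr r"
    proof -
      have "(\<Sum>i. norm (\<Phi> x i) powr r) = (\<Sum>i. norm (\<Prod>j<N. x j i) powr r) / M"
        unfolding np by (rule suminf_divide[OF P(1)[of x, OF x']])
      then show ?thesis
        using P(2)[of x, OF x'] by (simp only: pos_divide_le_eq[OF M] mult.commute)
    qed
    then show ?thesis using E.ell_norm_le_iff[OF mem[OF x] nn] by simp
  qed
  have \<Phi>: "\<Phi> \<in> cont_multilinear N (\<lambda>_. ?X) (ell r)"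
    unfolding cont_multilinear_def
  proof (intro CollectI conjI ballI allI impI exI[of _ 1] bound mem)
    fix x j u v assume j: "j < N"
    show "\<Phi> (x(j := u + v)) = \<Phi> (x(j := u)) + \<Phi> (x(j := v))"
      unfolding \<Phi>_def prod_upd[OF j] by (auto simp: fun_eq_iff distrib_right add_divide_distrib)
  next
    fix x j c u assume j: "j < N"
    show "\<Phi> (x(j := vscale ?X c u)) = vscale (ell r) c (\<Phi> (x(j := u)))"
      unfolding \<Phi>_def prod_upd[OF j] by (auto simp: mult.assoc)
  qed
  have val: "vnorm (ell r) (\<Phi> (\<lambda>j. if j < N then w_head m else undefined))
      = ((\<Sum>i<m. w i powr (real N * r)) / M) powr (1 / r)" for m
  proof -
    have "(\<Sum>i. norm ((w_head m i :: 'k) ^ N) powr r / M) = (\<Sum>i<m. norm ((w_head m i :: 'k) ^ N) powr r / M)"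
      using N by (intro suminf_finite) (auto simp: w_head_def)
    also have "\<dots> = (\<Sum>i<m. w i powr (real N * r) / M)"
    proof (rule sum.cong[OF refl])
      fix i assume "i \<in> {..<m}"
      moreover have "(w i ^ N) powr r = w i powr (real N * r)" by (metis powr_powr powr_realpow w_pos)
      ultimately show "norm ((w_head m i :: 'k) ^ N) powr r / M = w i powr (real N * r) / M"
        by (simp add: w_head_def norm_power w_nonneg)
    qed
    finally show ?thesis unfolding E.vnorm_ell np prod_const by (simp add: sum_divide_distrib)
  qed
  have "(\<lambda>m. ((\<Sum>i<m. w i powr (real N * r)) / M) powr (1 / r)) \<longlonglongrightarrow> (M / M) powr (1 / r)"
    using M by (intro tendsto_powr tendsto_divide summable_LIMSEQ[OF s, folded M_def] tendsto_const) auto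
  then have lim: "(\<lambda>m. vnorm (ell r) (\<Phi> (\<lambda>j. if j < N then w_head m else undefined))) \<longlonglongrightarrow> 1"
    using M by (simp add: val)
  note norm1 = multi_norm_eq_1I[OF bound lim]
  show ?thesis
  proof (rule not_lindenstrauss_bollobas[OF E.normed_carrier_ell E.strictly_convex_bidual_ell N \<Phi> norm1(1) norm1(2)])
    show "0 < 1 / L" using L by simp
    fix \<Psi> n assume \<Psi>: "\<Psi> \<in> cont_multilinear N (\<lambda>_. ?X) (ell r)"
      and zero: "\<And>f. f \<in> vcarrier (dual (ell r)) \<Longrightarrow> f (\<Psi> (\<lambda>j. if j < N then unit_seq n else undefined)) = 0"
    let ?e = "\<lambda>j. if j < N then unit_seq n else undefined :: nat \<Rightarrow> 'k"
    interpret \<Psi>: multilinear_map ?X "ell r" N \<Psi>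
      by (intro multilinear_map.intro multilinear_map_axioms.intro normed_carrier_d E.normed_carrier_ell \<Psi>)
    have e: "?e \<in> (\<Pi>\<^sub>E j\<in>{..<N}. vcarrier ?X)"
      using unit_seq_ball[of N n] by (auto simp: unit_ball_def PiE_def Pi_def)
    then have \<Psi>e_in: "\<Psi> ?e \<in> vcarrier (ell r)" by (intro \<Psi>.map_in) (simp only: \<Psi>.PiE_args)
    \<comment> \<open>The n-th coordinate suffices for the lower bound, since a coordinate never
      exceeds the norm.\<close>
    from zero[OF Y.coord_dual[of n]] have \<Psi>e: "\<Psi> ?e n = 0" using \<Psi>e_in by (simp add: Y.coord_def)
    have \<Phi>e: "norm (\<Phi> ?e n) = 1 / L"
      using L unfolding \<Phi>_def prod_const by (simp add: unit_seq_def norm_divide)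
    have "\<Phi> ?e - \<Psi> ?e = \<Phi> ?e + vscale (ell r) (- 1) (\<Psi> ?e)" by (auto simp: fun_eq_iff)
    then have "\<Phi> ?e - \<Psi> ?e \<in> vcarrier (ell r)"
      using mem[OF e] \<Psi>e_in by (simp only: Y.add_closed Y.scale_closed)
    from E.ell_coord_le[OF this, of n] have "1 / L \<le> vnorm (ell r) (\<Phi> ?e - \<Psi> ?e)"
      using \<Phi>e \<Psi>e by simp
    also have "\<dots> \<le> multi_norm N (\<lambda>_. ?X) (ell r) (\<Phi> - \<Psi>)"
      by (rule multi_norm_diff_ge[OF E.normed_carrier_ell _ _ \<Phi> \<Psi> unit_seq_ball, where K = 4],
          rule E.ell_norm_diff_le) simp_all
    finally show "1 / L \<le> multi_norm N (\<lambda>_. ?X) (ell r) (\<Phi> - \<Psi>)" .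
  qed simp
qed

end

theorem proposition4p4:
  fixes w :: "nat \<Rightarrow> real" and r :: real
  assumes "admissible w" and "1 < r" and "w \<in> vcarrier (ell r)"
  shows "(\<forall>N::nat. r \<le> real N \<longrightarrow>
            \<not> lindenstrauss_bollobas N (\<lambda>_. d_predual w) (scalar_space :: (real, real) nspace) \<and>
            \<not> lindenstrauss_bollobas N (\<lambda>_. d_predual w) (scalar_space :: (complex, complex) nspace)) \<and>
         (\<forall>N::nat. 1 \<le> N \<longrightarrow>
            \<not> lindenstrauss_bollobas N (\<lambda>_. d_predual w) (ell r :: (real, nat \<Rightarrow> real) nspace) \<and>
            \<not> lindenstrauss_bollobas N (\<lambda>_. d_predual w) (ell r :: (complex, nat \<Rightarrow> complex) nspace))"
proof -
  interpret admissible_weight w by unfold_locales (rule assms(1))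
  have "summable (\<lambda>i. w i powr r)"
    using assms(3) w_nonneg by (simp add: ell_def)
  \<comment> \<open>The weights are at most one, so raising the exponent lowers them; this is used
    for the exponents \<open>N\<close> and \<open>N * r\<close>.\<close>
  then have s: "summable (\<lambda>i. w i powr p)" if "r \<le> p" for p
  proof (rule summable_comparison_test'[where N = 0])
    fix i show "norm (w i powr p) \<le> w i powr r"
      using powr_mono'[OF that, of "w i"] w_nonneg[of i] w_le_1[of i] by simp
  qed
  have a: "1 < N" if "r \<le> real N" for N :: nat using that assms(2) by linarith
  have b: "r \<le> real N * r" if "1 \<le> N" for N :: nat using that assms(2) by simp
  show ?thesis
    by (intro conjI allI impI not_lindenstrauss_bollobas_scalar[OF a s]
        not_lindenstrauss_bollobas_ell[OF _ assms(2) s[OF b]]) simp_all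
qed

end
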